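(* Let $\epsilon>0$ be fixed and let $\nu\in\{v\in(C^1(\Omega_\epsilon))^*:\langle v,1\rangle=0\}$. Then, as $\delta\to0$, $\Gamma\text{-}\lim_{\delta\to0}\mathcal H^{\nu}_{\epsilon,\delta}=\mathcal H^{\nu}_{\epsilon,0}$ with respect to weak-$*$ convergence in $\mathcal M(\Omega_\epsilon;\mathbb R^d)$.
   Context: Setting: $d\in\mathbb N$; $\Omega\subset\mathbb R^d$ is compact and its interior $\Omega^\circ$ is a bounded Lipschitz domain; $\Omega$ is strictly star shaped with respect to $0$: $\lambda x\in\Omega^\circ$ for all $x\in\Omega$, $0\le\lambda<1$; $w:\Omega\to[0,\infty)$ is continuous; $1<\alpha<\frac{d}{d-1}$, $\alpha'=\frac{\alpha}{\alpha-1}$. $|\cdot|$ is the Euclidean norm, $dx$ Lebesgue measure, $\mathcal M(K;\mathbb R^d)$ the $\mathbb R^d$-valued Radon measures on a compact set $K$ (weak-$*$ topology as dual of $C(K;\mathbb R^d)$). Spaces, for a compact set $K$ (here $K=\Omega$ or $K=\Omega_\epsilon$ below; Sobolev spaces on the interior): $W^{1,p}_\emptyset(K)=\{v\in W^{1,p}(K):\int_K v\,dx=0\}$; $W^{-1,p}_\perp(K)=\{v\in(W^{1,p'}(K))^*:\langle v,1\rangle=0\}$ with $p'$ conjugate to $p$; $\operatorname{div}:L^p(K;\mathbb R^d)\to W^{-1,p}_\perp(K)$, $\langle\operatorname{div}q,\phi\rangle=-\int_K q\cdot\nabla\phi\,dx$ for $\phi\in W^{1,p'}_\emptyset(K)$.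 Assumption on $\Omega$: for every $\eta\in W^{-1,\alpha'}_\perp(\Omega)$ there is a unique $y\in W^{1,\alpha'}_\emptyset(\Omega)$ with $-\int_\Omega\nabla y\cdot\nabla\phi\,dx=\langle\eta,\phi\rangle$ for all $\phi\in W^{1,\alpha}_\emptyset(\Omega)$. Enlarged domains: fix a sequence of parameters $\tau>0$, $\tau\to0$, and nonnegative mollifiers $\phi_\tau\in C_c^\infty(\mathbb R^d)$ ($\int\phi_\tau=1$, supports shrinking to $\{0\}$). For each $\tau$ choose $s_\tau>0$, $s_\tau\to0$, such that $\Omega_\tau:=(1+s_\tau)\Omega\supset\Omega+\operatorname{supp}\phi_\tau$ and $\Omega_\tau\supset\Omega_\vartheta$ for $\tau>\vartheta$. Put $\tilde\Omega=\bigcup_\tau\Omega_\tau$; $\hat w$ is a continuous extension of $w$ to $\tilde\Omega$ with $\min_{\tilde\Omega}\hat w=\min_\Omega w$. $\epsilon$ is one of these parameters and $\Omega_\epsilon$ the corresponding domain. Integrand: for $x\in\tilde\Omega$, $q\in\mathbb R^d$, $\delta>0$: $\mathcal G^*_{\epsilon,\delta}(x,q)=|q|^2\frac{\hat w(x)}{2\delta}-\delta\hat w(x)$ if $|q|\le\delta$, and $\mathcal G^*_{\epsilon,\delta}(x,q)=\frac\epsilon\alpha(|q|-\delta)^\alpha-\frac32\delta\hat w(x)+|q|\hat w(x)$ otherwise; $\mathcal G^*_{\epsilon,0}(x,q)=\hat w(x)|q|+\frac\epsilon\alpha|q|^\alpha$. Functionals: for $\delta\ge0$ and $q\in\mathcal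 M(\Omega_\epsilon;\mathbb R^d)$, $\mathcal H^\nu_{\epsilon,\delta}(q)=\int_{\Omega_\epsilon}\mathcal G^*_{\epsilon,\delta}(x,\frac{dq}{dx}(x))\,dx$ if $q\ll dx$, $\frac{dq}{dx}\in L^\alpha(\Omega_\epsilon;\mathbb R^d)$ and $\operatorname{div}\frac{dq}{dx}=\nu$ in $W^{-1,\alpha}_\perp(\Omega_\epsilon)$ (meaning that the functional $\operatorname{div}\frac{dq}{dx}$ restricts to $\nu$ on $C^1(\Omega_\epsilon)$); $\mathcal H^\nu_{\epsilon,\delta}(q)=+\infty$ otherwise. $\Gamma$-convergence $F=\Gamma\text{-}\lim F_n$: (i) $F(x)\le\liminf F_n(x_n)$ whenever $x_n\to x$; (ii) for every $x$ there is $x_n\to x$ with $F(x)\ge\limsup F_n(x_n)$; here convergence is weak-$*$ (sequential), and the limit $\delta\to0$ is along positive sequences. *)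

theory Defs
  imports "HOL-Analysis.Analysis"
begin

section \<open>Domains and classical function spaces\<close>

text \<open>Near each boundary point the set is, after a rotation, the strict epigraph of a Lipschitz
  function on the hyperplane orthogonal to \<open>e\<close>.\<close>

definition lipschitz_domain :: "'a::euclidean_space set \<Rightarrow> bool" where
  "lipschitz_domain U \<longleftrightarrow>
     open U \<and> connected U \<and> U \<noteq> {} \<and>
     (\<forall>x\<in>frontier U. \<exists>r>0. \<exists>e \<gamma> L. norm e = 1 \<and> L-lipschitz_on {y. y \<bullet> e = 0} \<gamma> \<and>
        U \<inter> ball x r = {y \<in> ball x r. y \<bullet> e > \<gamma> (y - (y \<bullet> e) *\<^sub>R e)})"

definition strictly_star_shaped :: "'a::euclidean_space set \<Rightarrow> bool" where
  "strictly_star_shaped \<Omega> \<longleftrightarrow> (\<forall>x\<in>\<Omega>. \<forall>c. 0 \<le> c \<and> c < 1 \<longrightarrow> c *\<^sub>R x \<in> interior \<Omega>)"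

definition gradient :: "('a::euclidean_space \<Rightarrow> real) \<Rightarrow> 'a \<Rightarrow> 'a" where
  "gradient f x = (THE D. GDERIV f x :> D)"

definition supp :: "('a::euclidean_space \<Rightarrow> real) \<Rightarrow> 'a set" where
  "supp f = closure {x. f x \<noteq> 0}"

fun C_k :: "nat \<Rightarrow> ('a::euclidean_space \<Rightarrow> real) \<Rightarrow> bool" where
  "C_k 0 f \<longleftrightarrow> continuous_on UNIV f"
| "C_k (Suc k) f \<longleftrightarrow>
     (\<forall>x. f differentiable (at x)) \<and> (\<forall>b\<in>Basis. C_k k (\<lambda>x. gradient f x \<bullet> b))"

definition Cc_infty :: "'a::euclidean_space set \<Rightarrow> ('a \<Rightarrow> real) set" where
  "Cc_infty U = {f. (\<forall>k. C_k k f) \<and> compact (supp f) \<and> supp f \<subseteq> U}"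

text \<open>\<open>C\<^sup>1(K)\<close> consists of the continuous functions on \<open>K\<close> that are \<open>C\<^sup>1\<close> in the interior with a
  gradient extending continuously to \<open>K\<close>. Functions on \<open>K\<close> are represented by total functions whose
  values off \<open>K\<close> are irrelevant; a functional that is bounded with respect to \<open>C1_norm\<close> cannot
  see those values.\<close>

definition C1 :: "'a::euclidean_space set \<Rightarrow> ('a \<Rightarrow> real) set" where
  "C1 K = {f. continuous_on K f \<and>
     (\<exists>g. continuous_on K g \<and> (\<forall>x\<in>interior K. GDERIV f x :> g x))}"

definition C1_norm :: "'a::euclidean_space set \<Rightarrow> ('a \<Rightarrow> real) \<Rightarrow> real" where
  "C1_norm K f = (SUP x\<in>K. \<bar>f x\<bar>) + (SUP x\<in>interior K. norm (gradient f x))"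

definition bounded_functionals ::
    "('a \<Rightarrow> real) set \<Rightarrow> (('a \<Rightarrow> real) \<Rightarrow> real) \<Rightarrow> (('a \<Rightarrow> real) \<Rightarrow> real) set" where
  "bounded_functionals V N = {\<eta>.
     (\<forall>u\<in>V. \<forall>v\<in>V. \<eta> (\<lambda>x. u x + v x) = \<eta> u + \<eta> v) \<and>
     (\<forall>c. \<forall>u\<in>V. \<eta> (\<lambda>x. c * u x) = c * \<eta> u) \<and>
     (\<exists>C. \<forall>u\<in>V. \<bar>\<eta> u\<bar> \<le> C * N u)}"

definition C1_dual :: "'a::euclidean_space set \<Rightarrow> (('a \<Rightarrow> real) \<Rightarrow> real) set" where
  "C1_dual K = bounded_functionals (C1 K) (C1_norm K)"

section \<open>Lebesgue and Sobolev spaces\<close>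

definition conj_exp :: "real \<Rightarrow> real" where
  "conj_exp p = p / (p - 1)"

definition Lp :: "real \<Rightarrow> 'a::euclidean_space set \<Rightarrow> ('a \<Rightarrow> 'b::euclidean_space) set" where
  "Lp p S = {f. f \<in> borel_measurable (lebesgue_on S) \<and>
     integrable (lebesgue_on S) (\<lambda>x. norm (f x) powr p)}"

definition Lp_norm :: "real \<Rightarrow> 'a::euclidean_space set \<Rightarrow> ('a \<Rightarrow> 'b::euclidean_space) \<Rightarrow> real" where
  "Lp_norm p S f = (LINT x|lebesgue_on S. norm (f x) powr p) powr (1 / p)"

definition locally_integrable ::
    "'a::euclidean_space set \<Rightarrow> ('a \<Rightarrow> 'b::euclidean_space) \<Rightarrow> bool" where
  "locally_integrable U f \<longleftrightarrow> (\<forall>C. compact C \<and> C \<subseteq> U \<longrightarrow> integrable (lebesgue_on C) f)"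

definition is_weak_gradient ::
    "'a::euclidean_space set \<Rightarrow> ('a \<Rightarrow> real) \<Rightarrow> ('a \<Rightarrow> 'a) \<Rightarrow> bool" where
  "is_weak_gradient U v g \<longleftrightarrow> locally_integrable U v \<and> locally_integrable U g \<and>
     (\<forall>\<psi>\<in>Cc_infty U. (LINT x|lebesgue_on U. v x *\<^sub>R gradient \<psi> x) =
        - (LINT x|lebesgue_on U. \<psi> x *\<^sub>R g x))"

text \<open>The weak gradient is determined up to null sets on \<open>U\<close>, and only used under integrals.\<close>

definition weak_gradient ::
    "'a::euclidean_space set \<Rightarrow> ('a \<Rightarrow> real) \<Rightarrow> 'a \<Rightarrow> 'a" where
  "weak_gradient U v = (SOME g. is_weak_gradient U v g)"

text \<open>Spaces attached to a compact set \<open>K\<close> are Sobolev spaces on its interior. Elements are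
  representatives; functionals bounded in \<open>W1_norm\<close> do not distinguish almost everywhere equal ones.\<close>

definition W1 :: "real \<Rightarrow> 'a::euclidean_space set \<Rightarrow> ('a \<Rightarrow> real) set" where
  "W1 p K = {v. v \<in> Lp p (interior K) \<and>
     (\<exists>g\<in>Lp p (interior K). is_weak_gradient (interior K) v g)}"

definition W1_norm :: "real \<Rightarrow> 'a::euclidean_space set \<Rightarrow> ('a \<Rightarrow> real) \<Rightarrow> real" where
  "W1_norm p K v =
     Lp_norm p (interior K) v + Lp_norm p (interior K) (weak_gradient (interior K) v)"

definition W1_mean0 :: "real \<Rightarrow> 'a::euclidean_space set \<Rightarrow> ('a \<Rightarrow> real) set" where
  "W1_mean0 p K = {v \<in> W1 p K. (LINT x|lebesgue_on (interior K). v x) = 0}"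

definition W_neg1_perp :: "real \<Rightarrow> 'a::euclidean_space set \<Rightarrow> (('a \<Rightarrow> real) \<Rightarrow> real) set" where
  "W_neg1_perp p K =
     {\<eta> \<in> bounded_functionals (W1 (conj_exp p) K) (W1_norm (conj_exp p) K). \<eta> (\<lambda>_. 1) = 0}"

text \<open>The divergence of \<open>q \<in> L\<^sup>p(K)\<close>, as a functional on \<open>W\<^sup>1\<^sup>,\<^sup>p\<^sup>'(K)\<close>. Prescribing the formula for
  \<open>\<phi>\<close> with mean zero and the value 0 on constants amounts to using it for every \<open>\<phi>\<close>. The integral
  is taken over the interior, where \<open>\<nabla>\<phi>\<close> lives: the frontier of a strictly star shaped compact set is
  a null set.\<close>

definition divergence ::
    "'a::euclidean_space set \<Rightarrow> ('a \<Rightarrow> 'a) \<Rightarrow> ('a \<Rightarrow> real) \<Rightarrow> real" where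
  "divergence K q \<phi> = - (LINT x|lebesgue_on (interior K). q x \<bullet> weak_gradient (interior K) \<phi> x)"

definition poisson_regular :: "real \<Rightarrow> 'a::euclidean_space set \<Rightarrow> bool" where
  "poisson_regular \<alpha> \<Omega> \<longleftrightarrow>
     (let solves = (\<lambda>\<eta> y. y \<in> W1_mean0 (conj_exp \<alpha>) \<Omega> \<and>
        (\<forall>\<phi>\<in>W1_mean0 \<alpha> \<Omega>. - (LINT x|lebesgue_on (interior \<Omega>).
            weak_gradient (interior \<Omega>) y x \<bullet> weak_gradient (interior \<Omega>) \<phi> x) = \<eta> \<phi>))
      in \<forall>\<eta>\<in>W_neg1_perp (conj_exp \<alpha>) \<Omega>.
        \<exists>y. solves \<eta> y \<and>
          (\<forall>z. solves \<eta> z \<longrightarrow> (AE x in lebesgue_on (interior \<Omega>). z x = y x)))"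

section \<open>Vector-valued Radon measures\<close>

text \<open>On a compact subset of a Euclidean space every countably additive vector-valued set function
  on the Borel sets is automatically a (finite, regular) Radon measure.\<close>

definition radon :: "'a::euclidean_space set \<Rightarrow> ('a set \<Rightarrow> 'a) set" where
  "radon K = {q. \<forall>A :: nat \<Rightarrow> 'a set.
     (\<forall>n. A n \<in> sets borel \<and> A n \<subseteq> K) \<and> disjoint_family A \<longrightarrow>
       (\<lambda>n. q (A n)) sums q (\<Union>n. A n)}"

text \<open>The positive part of the Jordan decomposition: \<open>\<sigma>\<^sup>+(A) = sup {\<sigma>(B) | B \<subseteq> A}\<close>; the supremum is
  over a family containing \<open>\<sigma>({}) = 0\<close>, so truncating by \<open>ennreal\<close> is harmless.\<close>

definition pos_part :: "'a::euclidean_space set \<Rightarrow> ('a set \<Rightarrow> real) \<Rightarrow> 'a measure" where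
  "pos_part K \<sigma> = measure_of K (sets (restrict_space borel K))
     (\<lambda>A. SUP B\<in>{B \<in> sets borel. B \<subseteq> A}. ennreal (\<sigma> B))"

definition signed_integral ::
    "'a::euclidean_space set \<Rightarrow> ('a set \<Rightarrow> real) \<Rightarrow> ('a \<Rightarrow> real) \<Rightarrow> real" where
  "signed_integral K \<sigma> f =
     (LINT x|pos_part K \<sigma>. f x) - (LINT x|pos_part K (\<lambda>A. - \<sigma> A). f x)"

definition vector_integral ::
    "'a::euclidean_space set \<Rightarrow> ('a set \<Rightarrow> 'a) \<Rightarrow> ('a \<Rightarrow> 'a) \<Rightarrow> real" where
  "vector_integral K q f = (\<Sum>b\<in>Basis. signed_integral K (\<lambda>A. q A \<bullet> b) (\<lambda>x. f x \<bullet> b))"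

definition weak_star_conv ::
    "'a::euclidean_space set \<Rightarrow> (nat \<Rightarrow> 'a set \<Rightarrow> 'a) \<Rightarrow> ('a set \<Rightarrow> 'a) \<Rightarrow> bool" where
  "weak_star_conv K Q q \<longleftrightarrow> (\<forall>f. continuous_on K f \<longrightarrow>
     (\<lambda>n. vector_integral K (Q n) f) \<longlonglongrightarrow> vector_integral K q f)"

definition abs_cont_lebesgue :: "'a::euclidean_space set \<Rightarrow> ('a set \<Rightarrow> 'a) \<Rightarrow> bool" where
  "abs_cont_lebesgue K q \<longleftrightarrow>
     (\<forall>A. A \<in> sets borel \<and> A \<subseteq> K \<and> emeasure lborel A = 0 \<longrightarrow> q A = 0)"

definition density_of :: "'a::euclidean_space set \<Rightarrow> ('a set \<Rightarrow> 'a) \<Rightarrow> 'a \<Rightarrow> 'a" where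
  "density_of K q = (SOME f. integrable (lebesgue_on K) f \<and>
     (\<forall>A. A \<in> sets borel \<and> A \<subseteq> K \<longrightarrow> q A = (LINT x|lebesgue_on A. f x)))"

section \<open>The functionals\<close>

definition G_star ::
    "real \<Rightarrow> ('a::euclidean_space \<Rightarrow> real) \<Rightarrow> real \<Rightarrow> real \<Rightarrow> 'a \<Rightarrow> 'a \<Rightarrow> real" where
  "G_star \<alpha> w \<epsilon> \<delta> x q =
     (if \<delta> = 0 then w x * norm q + \<epsilon> / \<alpha> * norm q powr \<alpha>
      else if norm q \<le> \<delta> then (norm q)\<^sup>2 * (w x / (2 * \<delta>)) - \<delta> * w x
      else \<epsilon> / \<alpha> * (norm q - \<delta>) powr \<alpha> - 3 / 2 * \<delta> * w x + norm q * w x)"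

text \<open>In the finite case the integrand is integrable, so the real-valued integral is the right one.\<close>

definition H_fun ::
    "real \<Rightarrow> ('a::euclidean_space \<Rightarrow> real) \<Rightarrow> 'a set \<Rightarrow> (('a \<Rightarrow> real) \<Rightarrow> real) \<Rightarrow>
     real \<Rightarrow> real \<Rightarrow> ('a set \<Rightarrow> 'a) \<Rightarrow> ereal" where
  "H_fun \<alpha> w K \<nu> \<epsilon> \<delta> q =
     (if abs_cont_lebesgue K q \<and> density_of K q \<in> Lp \<alpha> K \<and>
         (\<forall>\<phi>\<in>C1 K. divergence K (density_of K q) \<phi> = \<nu> \<phi>)
      then ereal (LINT x|lebesgue_on K. G_star \<alpha> w \<epsilon> \<delta> x (density_of K q x))
      else \<infinity>)"

definition Gamma_limit ::
    "'x set \<Rightarrow> ((nat \<Rightarrow> 'x) \<Rightarrow> 'x \<Rightarrow> bool) \<Rightarrow> (nat \<Rightarrow> 'x \<Rightarrow> ereal) \<Rightarrow> ('x \<Rightarrow> ereal) \<Rightarrow> bool" where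
  "Gamma_limit X conv F F0 \<longleftrightarrow>
     (\<forall>x\<in>X. \<forall>\<xi>. (\<forall>n. \<xi> n \<in> X) \<and> conv \<xi> x \<longrightarrow> F0 x \<le> liminf (\<lambda>n. F n (\<xi> n))) \<and>
     (\<forall>x\<in>X. \<exists>\<xi>. (\<forall>n. \<xi> n \<in> X) \<and> conv \<xi> x \<and> limsup (\<lambda>n. F n (\<xi> n)) \<le> F0 x)"

definition has_minimum :: "('a \<Rightarrow> real) \<Rightarrow> 'a set \<Rightarrow> real \<Rightarrow> bool" where
  "has_minimum f S m \<longleftrightarrow> m \<in> f ` S \<and> (\<forall>x\<in>S. m \<le> f x)"

abbreviation dilate :: "'a::euclidean_space set \<Rightarrow> real \<Rightarrow> 'a set" where
  "dilate \<Omega> s \<equiv> (\<lambda>x. (1 + s) *\<^sub>R x) ` \<Omega>"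

end

theory Submission
  imports Defs
begin

text \<open>The recovery sequence is constant, because \<open>G_star\<close> for \<open>\<delta> > 0\<close> lies below \<open>G_star\<close> for
  \<open>\<delta> = 0\<close>. For the lower bound, \<open>G_star\<close> for \<open>\<delta>\<close> exceeds \<open>G_star\<close> for 0 minus
  \<open>O(\<delta> (1 + |v|\<^sup>\<alpha>))\<close>, so bounded energies bound the densities in \<open>L\<^sup>\<alpha>\<close>. By Young's
  inequality the weak-* limit, tested with a continuous \<open>\<phi>\<close>, is at most \<open>C + \<integral> |\<phi>|\<^sup>p / p\<close> with
  \<open>p\<close> conjugate to \<open>\<alpha>\<close>; this makes it absolutely continuous with density in \<open>L\<^sup>\<alpha>\<close>, and weak-* convergence
  becomes weak convergence in \<open>L\<^sup>\<alpha>\<close>. Weak convergence preserves the divergence constraint, and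
  integrating the subgradient inequality of the convex limit integrand at the limit density
  gives lower semicontinuity. The mollifiers of the hypotheses double as the smooth test functions
  needed to identify \<open>weak_gradient\<close> of a \<open>C\<^sup>1\<close> function with its classical gradient.\<close>

section \<open>Signed set functions and their positive variation\<close>

text \<open>No compactness theorem is invoked: the weak-* limit is given and only has to be
  identified. Young's inequality does this because its right-hand side does not depend on the index.
  Measures enter as bare countably additive set functions, so the Jordan decomposition and
  Radon-Nikodym densities come first. Both \<open>density_of\<close> and
  \<open>weak_gradient\<close> are arbitrary choices; an integral containing one of them can be
  evaluated only after uniqueness almost everywhere is known. The error of order
  \<open>\<delta> * |v|^\<alpha>\<close> in the comparison of the integrands is not controlled
  beforehand: once \<open>\<delta> \<le> 1 / (2 * \<alpha>)\<close>, it costs at most half of the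
  coercive term \<open>\<epsilon> / \<alpha> * |v|^\<alpha>\<close>, and the other half bounds the
  densities. Smooth test functions are produced only by translating the mollifiers: in the
  uniqueness proof Fubini moves the smoothing from a locally integrable function to a continuous
  one, so no convolution has to be differentiated.\<close>

definition signed_on :: "'a::topological_space set \<Rightarrow> ('a set \<Rightarrow> real) \<Rightarrow> bool" where
  "signed_on K \<sigma> \<longleftrightarrow> (\<forall>A :: nat \<Rightarrow> 'a set.
     (\<forall>n. A n \<in> sets borel \<and> A n \<subseteq> K) \<and> disjoint_family A \<longrightarrow> (\<lambda>n. \<sigma> (A n)) sums \<sigma> (\<Union>n. A n))"

lemma signed_onD:
  assumes "signed_on K \<sigma>" "\<And>n::nat. A n \<in> sets borel" "\<And>n. A n \<subseteq> K" "disjoint_family A"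
  shows "(\<lambda>n. \<sigma> (A n)) sums \<sigma> (\<Union>n. A n)"
  using assms unfolding signed_on_def by blast

lemma signed_on_uminus: "signed_on K \<sigma> \<Longrightarrow> signed_on K (\<lambda>A. - \<sigma> A)"
  unfolding signed_on_def by (intro allI impI sums_minus) simp

lemma signed_on_empty:
  assumes "signed_on K \<sigma>"
  shows "\<sigma> {} = 0"
proof -
  \<comment> \<open>The empty set, repeated, is a disjoint sequence, and a constant series converges
    only if its terms are 0.\<close>
  have "(\<lambda>n::nat. \<sigma> {}) sums \<sigma> (\<Union>n::nat. {})"
    by (rule signed_onD[OF assms]) (auto simp: disjoint_family_on_def)
  then have "summable (\<lambda>n::nat. \<sigma> {})" by (rule sums_summable)
  then show ?thesis by (simp add: summable_const_iff)
qed

lemma signed_on_Un: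
  assumes "signed_on K \<sigma>" "A \<in> sets borel" "B \<in> sets borel" "A \<subseteq> K" "B \<subseteq> K" "A \<inter> B = {}"
  shows "\<sigma> (A \<union> B) = \<sigma> A + \<sigma> B"
proof -
  have "(\<lambda>n. \<sigma> (binaryset A B n)) sums \<sigma> (\<Union>n. binaryset A B n)"
    using assms by (intro signed_onD[OF assms(1)])
      (auto simp: binaryset_def disjoint_family_on_def split: if_splits)
  moreover have "(\<lambda>n. \<sigma> (binaryset A B n)) sums (\<sigma> A + \<sigma> B)"
    by (rule binaryset_sums) (rule signed_on_empty[OF assms(1)])
  ultimately show ?thesis
    by (simp add: UN_binaryset_eq sums_unique2)
qed

lemma signed_on_Diff:
  assumes "signed_on K \<sigma>" "A \<in> sets borel" "B \<in> sets borel" "A \<subseteq> K" "B \<subseteq> A"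
  shows "\<sigma> (A - B) = \<sigma> A - \<sigma> B"
proof -
  have "\<sigma> (B \<union> (A - B)) = \<sigma> B + \<sigma> (A - B)"
    using assms by (intro signed_on_Un[OF assms(1)]) auto
  moreover have "B \<union> (A - B) = A" using assms by auto
  ultimately show ?thesis by simp
qed

text \<open>The set function handed to \<open>measure_of\<close> in \<open>pos_part\<close>. It is
  studied by itself because \<open>measure_of\<close> keeps the given values only once they are
  known to be countably additive.\<close>

definition pos_var :: "('a::topological_space set \<Rightarrow> real) \<Rightarrow> 'a set \<Rightarrow> ennreal" where
  "pos_var \<sigma> A = (SUP B\<in>{B \<in> sets borel. B \<subseteq> A}. ennreal (\<sigma> B))"

lemma pos_var_upper: "B \<in> sets borel \<Longrightarrow> B \<subseteq> A \<Longrightarrow> ennreal (\<sigma> B) \<le> pos_var \<sigma> A"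
  unfolding pos_var_def by (intro SUP_upper) auto

lemma pos_var_least: "(\<And>B. B \<in> sets borel \<Longrightarrow> B \<subseteq> A \<Longrightarrow> ennreal (\<sigma> B) \<le> c) \<Longrightarrow> pos_var \<sigma> A \<le> c"
  unfolding pos_var_def by (intro SUP_least) auto

lemma pos_var_mono: "A \<subseteq> B \<Longrightarrow> pos_var \<sigma> A \<le> pos_var \<sigma> B"
  by (intro pos_var_least pos_var_upper) auto

text \<open>Only an inequality, since \<open>ennreal\<close> sends negative numbers to 0 and so
  destroys cancellation.\<close>

lemma ennreal_plus_le: "ennreal (a + b) \<le> ennreal a + ennreal b"
proof (cases "a \<ge> 0 \<and> b \<ge> 0")
  case False
  then consider "a \<le> 0" | "b \<le> 0" by linarith
  then show ?thesis
  proof cases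
    case 1 then have "ennreal (a + b) \<le> ennreal b" by (intro ennreal_leI) auto
    then show ?thesis by (simp add: add_increasing)
  next
    case 2 then have "ennreal (a + b) \<le> ennreal a" by (intro ennreal_leI) auto
    then show ?thesis by (simp add: add_increasing2)
  qed
qed simp

lemma ennreal_sum_le: "finite I \<Longrightarrow> ennreal (\<Sum>i\<in>I. f i) \<le> (\<Sum>i\<in>I. ennreal (f i))"
proof (induction I rule: finite_induct)
  case (insert x F)
  then show ?case
    using order_trans[OF ennreal_plus_le[of "f x" "sum f F"] add_left_mono] by simp
qed simp

text \<open>The union of a competitor for \<open>A\<close> and one for \<open>B\<close> competes for
  \<open>A \<union> B\<close>. If one of the two has negative content, which \<open>ennreal\<close>
  truncates, the other alone is the better competitor.\<close>

lemma pos_var_superadditive: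
  assumes \<sigma>: "signed_on K \<sigma>" and "A \<subseteq> K" "B \<subseteq> K" "A \<inter> B = {}"
  shows "pos_var \<sigma> A + pos_var \<sigma> B \<le> pos_var \<sigma> (A \<union> B)"
proof -
  let ?I = "\<lambda>A. {B \<in> sets borel. B \<subseteq> A}"
  have ne: "?I A \<noteq> {}" for A :: "'a set" by (auto intro: exI[of _ "{}"])
  have step: "ennreal (\<sigma> C) + ennreal (\<sigma> D) \<le> pos_var \<sigma> (A \<union> B)"
    if C: "C \<in> ?I A" and D: "D \<in> ?I B" for C D
  proof -
    consider "\<sigma> C \<le> 0" | "\<sigma> D \<le> 0" | "0 \<le> \<sigma> C" "0 \<le> \<sigma> D" by linarith
    then show ?thesis
    proof cases
      case 1
      then have "ennreal (\<sigma> C) = 0" by (simp add: ennreal_neg)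
      moreover have "ennreal (\<sigma> D) \<le> pos_var \<sigma> (A \<union> B)" using D by (intro pos_var_upper) auto
      ultimately show ?thesis by simp
    next
      case 2
      then have "ennreal (\<sigma> D) = 0" by (simp add: ennreal_neg)
      moreover have "ennreal (\<sigma> C) \<le> pos_var \<sigma> (A \<union> B)" using C by (intro pos_var_upper) auto
      ultimately show ?thesis by simp
    next
      case 3
      have "\<sigma> (C \<union> D) = \<sigma> C + \<sigma> D" using assms C D by (intro signed_on_Un[OF \<sigma>]) auto
      then have "ennreal (\<sigma> C) + ennreal (\<sigma> D) = ennreal (\<sigma> (C \<union> D))" using 3 by simp
      also have "\<dots> \<le> pos_var \<sigma> (A \<union> B)" using C D by (intro pos_var_upper) auto
      finally show ?thesis .
    qed
  qed
  have "pos_var \<sigma> A + pos_var \<sigma> B = (SUP C\<in>?I A. ennreal (\<sigma> C) + pos_var \<sigma> B)"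
    unfolding pos_var_def[of \<sigma> A] using ne by (subst ennreal_SUP_add_left) auto
  also have "\<dots> = (SUP C\<in>?I A. SUP D\<in>?I B. ennreal (\<sigma> C) + ennreal (\<sigma> D))"
    unfolding pos_var_def[of \<sigma> B] using ne by (subst ennreal_SUP_add_right) auto
  also have "\<dots> \<le> pos_var \<sigma> (A \<union> B)" using step by (intro SUP_least) blast
  finally show ?thesis .
qed

lemma pos_var_empty: "signed_on K \<sigma> \<Longrightarrow> pos_var \<sigma> {} = 0"
  using pos_var_least[of "{}" \<sigma> 0] by (simp add: signed_on_empty)

text \<open>One direction is superadditivity on finite unions. For the other, a competitor
  \<open>B\<close> for the union is sliced into the pieces \<open>B \<inter> A n\<close>, each
  competing for its own \<open>A n\<close>.\<close>

lemma pos_var_suminf: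
  assumes \<sigma>: "signed_on K \<sigma>" and A: "\<And>n::nat. A n \<in> sets borel" "\<And>n. A n \<subseteq> K" "disjoint_family A"
  shows "(\<Sum>n. pos_var \<sigma> (A n)) = pos_var \<sigma> (\<Union>n. A n)"
proof (rule antisym)
  have "(\<Sum>i<n. pos_var \<sigma> (A i)) \<le> pos_var \<sigma> (\<Union>i<n. A i)" for n
  proof (induction n)
    case (Suc n)
    have "A i \<inter> A n = {}" if "i < n" for i
      using disjoint_family_onD[OF A(3), of i n] that by auto
    then have "(\<Union>i<n. A i) \<inter> A n = {}" by blast
    then have "pos_var \<sigma> (\<Union>i<n. A i) + pos_var \<sigma> (A n) \<le> pos_var \<sigma> ((\<Union>i<n. A i) \<union> A n)"
      using A by (intro pos_var_superadditive[OF \<sigma>]) auto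
    moreover have "(\<Union>i<n. A i) \<union> A n = (\<Union>i<Suc n. A i)" by (auto simp: less_Suc_eq)
    ultimately show ?case
      using order_trans[OF add_right_mono[OF Suc, of "pos_var \<sigma> (A n)"]] by simp
  qed simp
  then have "(\<Sum>i<n. pos_var \<sigma> (A i)) \<le> pos_var \<sigma> (\<Union>n. A n)" for n
    by (rule order_trans) (intro pos_var_mono UN_mono, auto)
  then show "(\<Sum>n. pos_var \<sigma> (A n)) \<le> pos_var \<sigma> (\<Union>n. A n)"
    unfolding suminf_eq_SUP by (rule SUP_least)
next
  show "pos_var \<sigma> (\<Union>n. A n) \<le> (\<Sum>n. pos_var \<sigma> (A n))"
  proof (rule pos_var_least)
    fix B assume B: "B \<in> sets borel" "B \<subseteq> (\<Union>n. A n)"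
    have "(\<lambda>n. \<sigma> (B \<inter> A n)) sums \<sigma> (\<Union>n. B \<inter> A n)"
    proof (rule signed_onD[OF \<sigma>])
      show "disjoint_family (\<lambda>n. B \<inter> A n)" using A(3) unfolding disjoint_family_on_def by blast
    qed (use A B in auto)
    moreover have "(\<Union>n. B \<inter> A n) = B" using B by auto
    ultimately have "(\<lambda>n. \<Sum>i<n. \<sigma> (B \<inter> A i)) \<longlonglongrightarrow> \<sigma> B" by (simp add: sums_def)
    then have "(\<lambda>n. ennreal (\<Sum>i<n. \<sigma> (B \<inter> A i))) \<longlonglongrightarrow> ennreal (\<sigma> B)"
      by (rule tendsto_ennrealI)
    moreover have "ennreal (\<Sum>i<n. \<sigma> (B \<inter> A i)) \<le> (\<Sum>n. pos_var \<sigma> (A n))" for n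
    proof -
      have "ennreal (\<Sum>i<n. \<sigma> (B \<inter> A i)) \<le> (\<Sum>i<n. ennreal (\<sigma> (B \<inter> A i)))"
        by (rule ennreal_sum_le) simp
      also have "\<dots> \<le> (\<Sum>i<n. pos_var \<sigma> (A i))"
        using A B by (intro sum_mono pos_var_upper) auto
      also have "\<dots> \<le> (\<Sum>n. pos_var \<sigma> (A n))" by (rule sum_le_suminf) auto
      finally show ?thesis .
    qed
    ultimately show "ennreal (\<sigma> B) \<le> (\<Sum>n. pos_var \<sigma> (A n))"
      by (intro LIMSEQ_le_const2[where a="\<Sum>n. pos_var \<sigma> (A n)"]) auto
  qed
qed

lemma pos_var_Un:
  assumes \<sigma>: "signed_on K \<sigma>" and "A \<in> sets borel" "B \<in> sets borel" "A \<subseteq> K" "B \<subseteq> K" "A \<inter> B = {}"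
  shows "pos_var \<sigma> (A \<union> B) = pos_var \<sigma> A + pos_var \<sigma> B"
proof -
  have "(\<Sum>n. pos_var \<sigma> (binaryset A B n)) = pos_var \<sigma> (\<Union>n. binaryset A B n)"
    using assms by (intro pos_var_suminf[OF \<sigma>])
      (auto simp: binaryset_def disjoint_family_on_def split: if_splits)
  moreover have "(\<lambda>n. pos_var \<sigma> (binaryset A B n)) sums (pos_var \<sigma> A + pos_var \<sigma> B)"
    by (rule binaryset_sums) (rule pos_var_empty[OF \<sigma>])
  ultimately show ?thesis by (simp add: UN_binaryset_eq sums_iff)
qed

text \<open>If the positive variation of \<open>K\<close> were infinite, one could repeatedly split off a piece of
  \<open>\<sigma>\<close>-content at least 1 in absolute value while keeping infinite variation on the rest;
  the pieces would contradict the convergence of \<open>\<sigma>\<close> along disjoint sequences.\<close>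

lemma pos_var_finite:
  assumes \<sigma>: "signed_on K \<sigma>" and K: "K \<in> sets borel"
  shows "pos_var \<sigma> K < \<infinity>"
proof (rule ccontr)
  assume "\<not> ?thesis"
  then have inf: "pos_var \<sigma> K = \<infinity>" by (simp add: less_top[symmetric])
  define P where "P E \<longleftrightarrow> E \<in> sets borel \<and> E \<subseteq> K \<and> pos_var \<sigma> E = \<infinity>" for E
  have step: "\<exists>F. P F \<and> F \<subseteq> E \<and> 1 \<le> \<bar>\<sigma> (E - F)\<bar>" if E: "P E" for E
  proof -
    \<comment> \<open>With this threshold \<open>B\<close> has content above 1 and
      \<open>E - B\<close> has content below -1. Whichever of the two keeps infinite variation, the
      other can be split off.\<close>
    have "ennreal (1 + \<bar>\<sigma> E\<bar>) < pos_var \<sigma> E"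
      using E unfolding P_def infinity_ennreal_def by (metis ennreal_less_top)
    then obtain B where B: "B \<in> sets borel" "B \<subseteq> E" "ennreal (1 + \<bar>\<sigma> E\<bar>) < ennreal (\<sigma> B)"
      by (auto simp: less_SUP_iff pos_var_def)
    then have gt: "1 + \<bar>\<sigma> E\<bar> < \<sigma> B"
      by (metis abs_ge_zero add_nonneg_nonneg ennreal_less_iff zero_le_one)
    have EB: "E \<in> sets borel" "E \<subseteq> K" using E by (auto simp: P_def)
    have d: "\<sigma> (E - B) = \<sigma> E - \<sigma> B" using EB B by (intro signed_on_Diff[OF \<sigma>]) auto
    have "pos_var \<sigma> (B \<union> (E - B)) = pos_var \<sigma> B + pos_var \<sigma> (E - B)"
      using EB B by (intro pos_var_Un[OF \<sigma>]) auto
    moreover have "B \<union> (E - B) = E" using B by auto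
    ultimately have "pos_var \<sigma> B = \<infinity> \<or> pos_var \<sigma> (E - B) = \<infinity>"
      using E unfolding P_def infinity_ennreal_def by (metis ennreal_add_eq_top)
    then show ?thesis
    proof
      assume "pos_var \<sigma> B = \<infinity>"
      then show ?thesis using EB B gt d by (intro exI[of _ B]) (auto simp: P_def)
    next
      assume *: "pos_var \<sigma> (E - B) = \<infinity>"
      have "E - (E - B) = B" using B by auto
      with * show ?thesis using EB B gt by (intro exI[of _ "E - B"]) (auto simp: P_def)
    qed
  qed
  have "\<exists>F. \<forall>n. P (F n) \<and> (F (Suc n) \<subseteq> F n \<and> 1 \<le> \<bar>\<sigma> (F n - F (Suc n))\<bar>)"
    by (rule dependent_nat_choice) (use K inf step in \<open>auto simp: P_def\<close>)
  then obtain F where F: "\<And>n. P (F n)" "\<And>n. F (Suc n) \<subseteq> F n"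
    "\<And>n::nat. 1 \<le> \<bar>\<sigma> (F n - F (Suc n))\<bar>" by blast
  have dec: "F n \<subseteq> F m" if "m \<le> n" for m n
    using that F(2) by (rule lift_Suc_antimono_le[rotated])
  have dj: "(F m - F (Suc m)) \<inter> (F n - F (Suc n)) = {}" if "m < n" for m n
    using dec[of "Suc m" n] that by auto
  have "(\<lambda>n. \<sigma> (F n - F (Suc n))) sums \<sigma> (\<Union>n. F n - F (Suc n))"
  proof (rule signed_onD[OF \<sigma>])
    show "disjoint_family (\<lambda>n. F n - F (Suc n))"
      unfolding disjoint_family_on_def using dj by (metis Int_commute linorder_neqE_nat)
  qed (use F(1) in \<open>auto simp: P_def\<close>)
  then have "(\<lambda>n. \<sigma> (F n - F (Suc n))) \<longlonglongrightarrow> 0"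
    by (intro summable_LIMSEQ_zero sums_summable)
  then have "\<forall>\<^sub>F n in sequentially. \<bar>\<sigma> (F n - F (Suc n))\<bar> < 1"
    by (auto dest!: tendstoD[of _ _ _ 1])
  then show False using F(3) by (auto simp: eventually_sequentially not_less[symmetric])
qed

text \<open>Countable additivity of \<open>pos_var\<close> on subsets of \<open>K\<close> is what
  makes the measure built by \<open>measure_of\<close> take these values.\<close>

lemma
  assumes \<sigma>: "signed_on K \<sigma>" and K: "K \<in> sets borel"
  shows space_pos_part: "space (pos_part K \<sigma>) = K"
    and sets_pos_part: "sets (pos_part K \<sigma>) = sets (restrict_space borel K)"
    and emeasure_pos_part: "A \<in> sets borel \<Longrightarrow> A \<subseteq> K \<Longrightarrow> emeasure (pos_part K \<sigma>) A = pos_var \<sigma> A"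
    and finite_measure_pos_part: "finite_measure (pos_part K \<sigma>)"
proof -
  let ?S = "sets (restrict_space borel K)"
  have S: "A \<in> ?S \<longleftrightarrow> A \<in> sets borel \<and> A \<subseteq> K" for A
    using K by (auto simp: sets_restrict_space_iff)
  have sa: "sigma_algebra K ?S"
    using sets.sigma_algebra_axioms[of "restrict_space borel K"] by (simp add: space_restrict_space)
  have pp: "pos_part K \<sigma> = measure_of K ?S (pos_var \<sigma>)"
    unfolding pos_part_def pos_var_def ..
  show sp: "space (pos_part K \<sigma>) = K"
    unfolding pp using S by (subst space_measure_of) auto
  show se: "sets (pos_part K \<sigma>) = ?S"
    unfolding pp using sa by (simp add: sigma_algebra.sets_measure_of_eq)
  have "countably_additive ?S (pos_var \<sigma>)"
    unfolding countably_additive_def using pos_var_suminf[OF \<sigma>] S by blast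
  then show em: "A \<in> sets borel \<Longrightarrow> A \<subseteq> K \<Longrightarrow> emeasure (pos_part K \<sigma>) A = pos_var \<sigma> A" for A
    unfolding pp using S pos_var_empty[OF \<sigma>]
    by (intro emeasure_measure_of_sigma[OF sa]) (auto simp: positive_def)
  show "finite_measure (pos_part K \<sigma>)"
    using pos_var_finite[OF \<sigma> K] by (intro finite_measureI) (simp add: sp em K)
qed

text \<open>The Jordan decomposition. Replacing \<open>B\<close> by \<open>A - B\<close> turns
  competitors for \<open>\<sigma>\<close> into competitors for its negative, up to the shift
  \<open>\<sigma> A\<close>; both variations are finite, so the identity can be read in the
  reals.\<close>

lemma pos_var_uminus:
  assumes \<sigma>: "signed_on K \<sigma>" and K: "K \<in> sets borel" and A: "A \<in> sets borel" "A \<subseteq> K"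
  shows "\<sigma> A = enn2real (pos_var \<sigma> A) - enn2real (pos_var (\<lambda>A. - \<sigma> A) A)"
proof -
  have \<sigma>': "signed_on K (\<lambda>A. - \<sigma> A)" by (rule signed_on_uminus[OF \<sigma>])
  have "pos_var \<sigma> A < \<infinity>" "pos_var (\<lambda>A. - \<sigma> A) A < \<infinity>"
    using pos_var_finite[OF \<sigma> K] pos_var_finite[OF \<sigma>' K] pos_var_mono[OF A(2)] 
    by (auto intro: le_less_trans)
  then obtain p n where e: "pos_var \<sigma> A = ennreal p" "pos_var (\<lambda>A. - \<sigma> A) A = ennreal n"
    and pn: "0 \<le> p" "0 \<le> n"
    unfolding infinity_ennreal_def by (metis less_top_ennreal)
  have le: "\<sigma> B \<le> p" "- \<sigma> B \<le> n" if "B \<in> sets borel" "B \<subseteq> A" for B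
    using pos_var_upper[OF that, of \<sigma>] pos_var_upper[OF that, of "\<lambda>A. - \<sigma> A"] unfolding e
    using pn by (auto simp: ennreal_le_iff)
  have "pos_var \<sigma> A \<le> ennreal (\<sigma> A + n)"
  proof (rule pos_var_least)
    fix B assume B: "B \<in> sets borel" "B \<subseteq> A"
    have "\<sigma> (A - B) = \<sigma> A - \<sigma> B" using A B by (intro signed_on_Diff[OF \<sigma>]) auto
    moreover have "- \<sigma> (A - B) \<le> n" using A B by (intro le) auto
    ultimately show "ennreal (\<sigma> B) \<le> ennreal (\<sigma> A + n)" by (intro ennreal_leI) auto
  qed
  moreover have "0 \<le> \<sigma> A + n" using le(2)[of A] A by auto
  ultimately have 1: "p \<le> \<sigma> A + n" unfolding e using pn by (simp add: ennreal_le_iff)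
  have "pos_var (\<lambda>A. - \<sigma> A) A \<le> ennreal (p - \<sigma> A)"
  proof (rule pos_var_least)
    fix B assume B: "B \<in> sets borel" "B \<subseteq> A"
    have "\<sigma> (A - B) = \<sigma> A - \<sigma> B" using A B by (intro signed_on_Diff[OF \<sigma>]) auto
    moreover have "\<sigma> (A - B) \<le> p" using A B by (intro le) auto
    ultimately show "ennreal (- \<sigma> B) \<le> ennreal (p - \<sigma> A)" by (intro ennreal_leI) auto
  qed
  moreover have "0 \<le> p - \<sigma> A" using le(1)[of A] A by auto
  ultimately have "n \<le> p - \<sigma> A" unfolding e using pn by (simp add: ennreal_le_iff)
  with 1 show ?thesis unfolding e using pn by simp
qed

lemma measure_pos_part_diff:
  assumes \<sigma>: "signed_on K \<sigma>" and K: "K \<in> sets borel" and A: "A \<in> sets borel" "A \<subseteq> K"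
  shows "\<sigma> A = measure (pos_part K \<sigma>) A - measure (pos_part K (\<lambda>A. - \<sigma> A)) A"
  using pos_var_uminus[OF assms] emeasure_pos_part[OF \<sigma> K A]
    emeasure_pos_part[OF signed_on_uminus[OF \<sigma>] K A] by (simp add: measure_def)

section \<open>Densities of absolutely continuous signed set functions\<close>

lemma integral_lebesgue_on_subset:
  fixes f :: "'a::euclidean_space \<Rightarrow> 'b::euclidean_space"
  assumes "A \<in> sets lebesgue" "S \<in> sets lebesgue" "A \<subseteq> S"
  shows "(LINT x|lebesgue_on A. f x) = (LINT x|lebesgue_on S. indicator A x *\<^sub>R f x)"
proof -
  have "indicator S x *\<^sub>R (indicator A x *\<^sub>R f x) = indicator A x *\<^sub>R f x" for x
    using assms(3) by (auto simp: indicator_def)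
  then show ?thesis using assms by (simp add: integral_restrict_space del: scaleR_scaleR)
qed

lemma integrable_lebesgue_on_subset:
  fixes f :: "'a::euclidean_space \<Rightarrow> 'b::euclidean_space"
  assumes "integrable (lebesgue_on S) f" "A \<in> sets lebesgue" "S \<in> sets lebesgue" "A \<subseteq> S"
  shows "integrable (lebesgue_on A) f"
proof -
  have "integrable lebesgue (\<lambda>x. indicator A x *\<^sub>R (indicator S x *\<^sub>R f x))"
    by (rule integrable_mult_indicator) (use assms in \<open>auto simp: integrable_restrict_space\<close>)
  moreover have "indicator A x *\<^sub>R (indicator S x *\<^sub>R f x) = indicator A x *\<^sub>R f x" for x
    using assms(4) by (auto simp: indicator_def)
  ultimately show ?thesis using assms by (simp add: integrable_restrict_space del: scaleR_scaleR)
qed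

lemma finite_measure_lebesgue_on_bounded:
  fixes S :: "'a::euclidean_space set"
  assumes "S \<in> sets lebesgue" "bounded S"
  shows "finite_measure (lebesgue_on S)"
  using bounded_set_imp_lmeasurable[OF assms(2,1)] by (rule finite_measure_lebesgue_on)

text \<open>Closed sets approximate \<open>A\<close> from inside, and a closed set is a countable
  union of its intersections with closed balls, which are compact.\<close>

lemma null_if_compact_subsets_null:
  fixes A :: "'a::euclidean_space set"
  assumes A: "A \<in> sets lebesgue" and null: "\<And>C. compact C \<Longrightarrow> C \<subseteq> A \<Longrightarrow> emeasure lebesgue C = 0"
  shows "emeasure lebesgue A = 0"
proof (rule ccontr)
  assume ne: "emeasure lebesgue A \<noteq> 0"
  \<comment> \<open>The choice \<open>e = 1\<close> covers a set \<open>A\<close> of infinite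
    measure.\<close>
  then obtain e :: real where e: "0 < e" "ennreal e \<le> emeasure lebesgue A"
    by (cases "emeasure lebesgue A") (auto simp: less_le intro: that[of 1])
  obtain T where T: "closed T" "T \<subseteq> A" "A - T \<in> lmeasurable" "emeasure lebesgue (A - T) < ennreal e"
    using sets_lebesgue_inner_closed[OF A e(1)] by blast
  have Ts: "T \<in> sets lebesgue" using T(1) by (simp add: borel_closed)
  have "emeasure lebesgue (T \<inter> cball 0 (real n)) = 0" for n
    using T by (intro null) (auto simp: closed_Int_compact)
  moreover have "(\<Union>n. T \<inter> cball 0 (real n)) = T"
  proof -
    have "\<exists>n. norm x \<le> real n" for x :: 'a by (rule real_arch_simple)
    then show ?thesis by auto
  qed
  moreover have "range (\<lambda>n. T \<inter> cball 0 (real n)) \<subseteq> sets lebesgue" using Ts by auto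
  ultimately have "emeasure lebesgue T = 0"
    using emeasure_UN_eq_0[of lebesgue "\<lambda>n. T \<inter> cball 0 (real n)"] by simp
  moreover have "emeasure lebesgue A \<le> emeasure lebesgue T + emeasure lebesgue (A - T)"
    using T A Ts emeasure_subadditive[of T lebesgue "A - T"] by (simp add: Un_absorb1)
  ultimately show False using T(4) e(2) by simp
qed

text \<open>On a compact subset of the set where \<open>u\<close> is positive, a vanishing integral
  of a positive function forces measure 0. Inner approximation then makes the whole set null, and
  likewise for negative values.\<close>

lemma AE_zero_if_compact_integrals_zero:
  fixes u :: "'a::euclidean_space \<Rightarrow> real"
  assumes S: "S \<in> sets lebesgue" and u: "u \<in> borel_measurable (lebesgue_on S)"
    and int: "\<And>C. compact C \<Longrightarrow> C \<subseteq> S \<Longrightarrow> integrable (lebesgue_on C) u"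
    and zero: "\<And>C. compact C \<Longrightarrow> C \<subseteq> S \<Longrightarrow> (LINT x|lebesgue_on C. u x) = 0"
  shows "AE x in lebesgue_on S. u x = 0"
proof -
  \<comment> \<open>The factor \<open>c\<close> is 1 or -1 and treats both signs at once.\<close>
  have pos: "emeasure lebesgue {x \<in> S. 0 < c * u x} = 0" if c: "\<bar>c\<bar> = 1" for c :: real
  proof (rule null_if_compact_subsets_null)
    have "{x \<in> space (lebesgue_on S). 0 < c * u x} \<in> sets (lebesgue_on S)"
      using u by measurable
    then show "{x \<in> S. 0 < c * u x} \<in> sets lebesgue"
      using S by (simp add: sets_restrict_space_iff)
  next
    fix C assume C: "compact C" "C \<subseteq> {x \<in> S. 0 < c * u x}"
    then have C': "C \<in> sets lebesgue" "C \<subseteq> S" by (auto simp: borel_compact)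
    have "AE x in lebesgue_on C. c * u x = 0"
    proof (subst integral_nonneg_eq_0_iff_AE[symmetric])
      show "integrable (lebesgue_on C) (\<lambda>x. c * u x)" using int C C' by simp
      show "AE x in lebesgue_on C. 0 \<le> c * u x" using C by (intro AE_I2) auto
      show "(LINT x|lebesgue_on C. c * u x) = 0" using zero C C' by simp
    qed
    then have "AE x in lebesgue_on C. False"
      by (rule lebesgue_on_mono) (use C in auto)
    then show "emeasure lebesgue C = 0"
      using C' AE_iff_measurable[of C "lebesgue_on C" "\<lambda>_. False"]
      by (simp add: emeasure_restrict_space sets_restrict_space_iff)
  qed
  have "AE x in lebesgue. x \<notin> {x \<in> S. 0 < c * u x}" if c: "\<bar>c\<bar> = 1" for c :: real
  proof (rule AE_not_in)
    have "{x \<in> space (lebesgue_on S). 0 < c * u x} \<in> sets (lebesgue_on S)"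
      using u by measurable
    then show "{x \<in> S. 0 < c * u x} \<in> null_sets lebesgue"
      using S pos[OF c] by (auto simp: null_sets_def sets_restrict_space_iff)
  qed
  from this[OF abs_one] this[of "-1", simplified abs_minus abs_one, OF refl]
  have "AE x in lebesgue. x \<in> S \<longrightarrow> u x = 0"
    by eventually_elim auto
  then show ?thesis using S by (simp add: AE_restrict_space_iff)
qed

text \<open>The variations live on the Borel sigma-algebra of \<open>K\<close>, the functionals
  integrate against the completed measure; this is the passage between them.\<close>

lemma integral_restrict_borel_eq_lebesgue_on:
  fixes f :: "'a::euclidean_space \<Rightarrow> real"
  assumes K: "K \<in> sets borel" and f: "f \<in> borel_measurable (restrict_space borel K)"
  shows "integrable (restrict_space lborel K) f \<longleftrightarrow> integrable (lebesgue_on K) f"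
    and "(LINT x|restrict_space lborel K. f x) = (LINT x|lebesgue_on K. f x)"
    and "f \<in> borel_measurable (lebesgue_on K)"
proof -
  have m: "(\<lambda>x. indicator K x *\<^sub>R f x) \<in> borel_measurable lborel"
    using f K borel_measurable_restrict_space_iff[of K borel f] by simp
  show "integrable (restrict_space lborel K) f \<longleftrightarrow> integrable (lebesgue_on K) f"
    using K m by (simp add: integrable_restrict_space integrable_completion)
  show "(LINT x|restrict_space lborel K. f x) = (LINT x|lebesgue_on K. f x)"
    using K m by (simp add: integral_restrict_space integral_completion)
  have "(\<lambda>x. indicator K x *\<^sub>R f x) \<in> borel_measurable lebesgue"
    using m by (rule measurable_completion)
  then show "f \<in> borel_measurable (lebesgue_on K)"
    using K by (subst borel_measurable_restrict_space_iff) auto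
qed

text \<open>Radon-Nikodym for the positive variation. Boundedness of \<open>f\<close> gives
  integrability against a finite measure, which is needed when the formulas for the two variations
  are subtracted.\<close>

lemma pos_part_density:
  fixes K :: "'a::euclidean_space set"
  assumes \<sigma>: "signed_on K \<sigma>" and K: "K \<in> sets borel" "bounded K"
    and ac: "\<And>A. A \<in> sets borel \<Longrightarrow> A \<subseteq> K \<Longrightarrow> emeasure lborel A = 0 \<Longrightarrow> \<sigma> A = 0"
  shows "\<exists>p. integrable (lebesgue_on K) p \<and>
    (\<forall>f\<in>borel_measurable (restrict_space borel K).
      (LINT x|pos_part K \<sigma>. f x :: real) = (LINT x|lebesgue_on K. f x * p x) \<and>
      (bounded (f ` K) \<longrightarrow> integrable (lebesgue_on K) (\<lambda>x. f x * p x)))"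
proof -
  let ?M = "restrict_space lborel K" and ?P = "pos_part K \<sigma>"
  have sets: "sets ?P = sets ?M" "sets ?M = sets (restrict_space borel K)"
    using sets_pos_part[OF \<sigma> K(1)] by (simp_all add: sets_restrict_space)
  have meas: "borel_measurable ?M = borel_measurable (restrict_space borel K)"
    by (rule measurable_cong_sets) (simp_all add: sets)
  interpret P: finite_measure ?P by (rule finite_measure_pos_part[OF \<sigma> K(1)])
  have "emeasure lborel K < \<infinity>" using emeasure_bounded_finite[OF K(2)] by simp
  then interpret M: finite_measure ?M
    using K by (intro finite_measureI) (auto simp: emeasure_restrict_space space_restrict_space)
  have "absolutely_continuous ?M ?P"
    unfolding absolutely_continuous_def
  proof
    fix A assume "A \<in> null_sets ?M"
    then have A: "A \<in> sets borel" "A \<subseteq> K" "emeasure lborel A = 0" and A': "A \<in> sets ?M"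
      using K by (auto simp: null_sets_def sets_restrict_space_iff emeasure_restrict_space)
    \<comment> \<open>Every competitor is a subset of a null set, so it is null itself and has
      content 0.\<close>
    have "pos_var \<sigma> A \<le> 0"
    proof (rule pos_var_least)
      fix B assume B: "B \<in> sets borel" "B \<subseteq> A"
      then have "emeasure lborel B \<le> emeasure lborel A" using A by (intro emeasure_mono) auto
      then have "\<sigma> B = 0" using A B by (intro ac) auto
      then show "ennreal (\<sigma> B) \<le> 0" by simp
    qed
    then show "A \<in> null_sets ?P"
      using A A' sets by (simp add: null_sets_def emeasure_pos_part[OF \<sigma> K(1)])
  qed
  then obtain p where p: "p \<in> borel_measurable ?M" "AE x in ?M. RN_deriv ?M ?P x = ennreal (p x)"
      "\<And>x. 0 \<le> p x"
    using M.real_RN_deriv[OF P.finite_measure_axioms _ sets(1)] by metis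
  have "density ?M (RN_deriv ?M ?P) = ?P"
    by (rule M.density_RN_deriv) fact+
  moreover have "density ?M (RN_deriv ?M ?P) = density ?M (\<lambda>x. ennreal (p x))"
    using p by (intro density_cong) auto
  ultimately have P: "?P = density ?M (\<lambda>x. ennreal (p x))" by simp
  have pm: "p \<in> borel_measurable (restrict_space borel K)" using p(1) by (simp add: meas)
  note conv = integral_restrict_borel_eq_lebesgue_on[OF K(1)]
  have int: "integrable (lebesgue_on K) (\<lambda>x. f x * p x)"
    if f: "f \<in> borel_measurable (restrict_space borel K)" and B: "\<And>x. x \<in> K \<Longrightarrow> \<bar>f x\<bar> \<le> B" for f B
  proof -
    have "integrable ?P f"
    proof (rule P.integrable_const_bound[where B=B])
      show "f \<in> borel_measurable ?P" using f measurable_cong_sets[OF trans[OF sets] refl] by blast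
      show "AE x in ?P. norm (f x) \<le> B" using B by (intro AE_I2) (auto simp: space_pos_part[OF \<sigma> K(1)])
    qed
    then have "integrable ?M (\<lambda>x. p x *\<^sub>R f x)"
      unfolding P using p f meas by (subst (asm) integrable_density) auto
    then show ?thesis using f pm by (subst conv(1)[symmetric]) (auto simp: mult.commute)
  qed
  show ?thesis
  proof (intro exI[of _ p] conjI ballI impI)
    show "integrable (lebesgue_on K) p" using int[of "\<lambda>_. 1" 1] by simp
    fix f :: "'a \<Rightarrow> real" assume f: "f \<in> borel_measurable (restrict_space borel K)"
    have "(LINT x|?P. f x) = (LINT x|?M. p x *\<^sub>R f x)"
      unfolding P using p f meas by (intro integral_density) auto
    also have "\<dots> = (LINT x|lebesgue_on K. f x * p x)"
      using f pm by (subst conv(2)) (auto simp: mult.commute)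
    finally show "(LINT x|?P. f x) = (LINT x|lebesgue_on K. f x * p x)" .
    assume "bounded (f ` K)"
    then obtain B where "\<And>x. x \<in> K \<Longrightarrow> \<bar>f x\<bar> \<le> B" by (auto simp: bounded_iff)
    with f show "integrable (lebesgue_on K) (\<lambda>x. f x * p x)" by (rule int)
  qed
qed

text \<open>The density is the difference of those of the two variations. Taking an indicator for
  \<open>f\<close> recovers the set function, taking a continuous \<open>f\<close> the
  integral.\<close>

lemma signed_integral_density_exists:
  fixes K :: "'a::euclidean_space set"
  assumes \<sigma>: "signed_on K \<sigma>" and K: "compact K"
    and ac: "\<And>A. A \<in> sets borel \<Longrightarrow> A \<subseteq> K \<Longrightarrow> emeasure lborel A = 0 \<Longrightarrow> \<sigma> A = 0"
  shows "\<exists>h. integrable (lebesgue_on K) h \<and>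
    (\<forall>A. A \<in> sets borel \<and> A \<subseteq> K \<longrightarrow> \<sigma> A = (LINT x|lebesgue_on A. h x)) \<and>
    (\<forall>f. continuous_on K f \<longrightarrow> signed_integral K \<sigma> f = (LINT x|lebesgue_on K. f x * h x))"
proof -
  have Kb: "K \<in> sets borel" "bounded K" using K by (auto simp: borel_compact compact_imp_bounded)
  note \<sigma>' = signed_on_uminus[OF \<sigma>]
  let ?B = "borel_measurable (restrict_space borel K)"
  have ac': "- \<sigma> A = 0" if "A \<in> sets borel" "A \<subseteq> K" "emeasure lborel A = 0" for A
    using ac that by simp
  obtain p where p: "integrable (lebesgue_on K) p"
    "\<forall>f\<in>?B. (LINT x|pos_part K \<sigma>. f x :: real) = (LINT x|lebesgue_on K. f x * p x) \<and>
      (bounded (f ` K) \<longrightarrow> integrable (lebesgue_on K) (\<lambda>x. f x * p x))"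
    using pos_part_density[OF \<sigma> Kb ac] by blast
  obtain n where n: "integrable (lebesgue_on K) n"
    "\<forall>f\<in>?B. (LINT x|pos_part K (\<lambda>A. - \<sigma> A). f x :: real) = (LINT x|lebesgue_on K. f x * n x) \<and>
      (bounded (f ` K) \<longrightarrow> integrable (lebesgue_on K) (\<lambda>x. f x * n x))"
    using pos_part_density[OF \<sigma>' Kb ac'] by blast
  have sub: "(LINT x|pos_part K \<sigma>. f x) - (LINT x|pos_part K (\<lambda>A. - \<sigma> A). f x)
      = (LINT x|lebesgue_on K. f x * (p x - n x))"
    if f: "f \<in> ?B" "bounded (f ` K)" for f
  proof -
    have "(LINT x|lebesgue_on K. f x * (p x - n x)) = (LINT x|lebesgue_on K. f x * p x - f x * n x)"
      by (simp add: algebra_simps)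
    also have "\<dots> = (LINT x|lebesgue_on K. f x * p x) - (LINT x|lebesgue_on K. f x * n x)"
      using p(2) n(2) f by (intro Bochner_Integration.integral_diff) auto
    finally show ?thesis using p(2) n(2) f by simp
  qed
  show ?thesis
  proof (intro exI[of _ "\<lambda>x. p x - n x"] conjI allI impI; (elim conjE)?)
    show "integrable (lebesgue_on K) (\<lambda>x. p x - n x)" using p n by simp
    fix A assume A: "A \<in> sets borel" "A \<subseteq> K"
    have ind: "indicat_real A \<in> ?B"
      using A by (intro borel_measurable_indicator) (auto simp: sets_restrict_space_iff Kb)
    have AP: "A \<in> sets (pos_part K \<sigma>)" "A \<in> sets (pos_part K (\<lambda>A. - \<sigma> A))"
      using A Kb sets_pos_part[OF \<sigma> Kb(1)] sets_pos_part[OF \<sigma>' Kb(1)] by (auto simp: sets_restrict_space_iff)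
    have "\<sigma> A = measure (pos_part K \<sigma>) A - measure (pos_part K (\<lambda>A. - \<sigma> A)) A"
      by (rule measure_pos_part_diff[OF \<sigma> Kb(1) A])
    also have "\<dots> = (LINT x|pos_part K \<sigma>. indicat_real A x) - (LINT x|pos_part K (\<lambda>A. - \<sigma> A). indicat_real A x)"
      using A by (simp add: space_pos_part[OF \<sigma> Kb(1)] space_pos_part[OF \<sigma>' Kb(1)] Int_absorb2)
    also have "\<dots> = (LINT x|lebesgue_on K. indicator A x * (p x - n x))"
      by (rule sub[OF ind]) (auto intro!: boundedI[where B=1] simp: indicator_def)
    also have "\<dots> = (LINT x|lebesgue_on A. p x - n x)"
      using A Kb by (subst integral_lebesgue_on_subset[of A K]) auto
    finally show "\<sigma> A = (LINT x|lebesgue_on A. p x - n x)" .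
  next
    fix f :: "'a \<Rightarrow> real" assume f: "continuous_on K f"
    show "signed_integral K \<sigma> f = (LINT x|lebesgue_on K. f x * (p x - n x))"
      unfolding signed_integral_def
      by (rule sub[OF borel_measurable_continuous_on_restrict[OF f] compact_imp_bounded[OF compact_continuous_image[OF f K]]])
  qed
qed

text \<open>Two densities have equal integrals over compact sets and hence agree almost everywhere.
  So any density computes the integral, in particular one picked by choice, as in
  \<open>density_of\<close>.\<close>

lemma signed_integral_density:
  fixes K :: "'a::euclidean_space set"
  assumes \<sigma>: "signed_on K \<sigma>" and K: "compact K" and h: "integrable (lebesgue_on K) h"
    and eq: "\<And>A. A \<in> sets borel \<Longrightarrow> A \<subseteq> K \<Longrightarrow> \<sigma> A = (LINT x|lebesgue_on A. h x)"
    and f: "continuous_on K f"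
  shows "signed_integral K \<sigma> f = (LINT x|lebesgue_on K. f x * h x)"
proof -
  have Kb: "K \<in> sets lebesgue" using K by (auto simp: borel_compact)
  have "\<sigma> A = 0" if "A \<in> sets borel" "A \<subseteq> K" "emeasure lborel A = 0" for A
  proof -
    have "A \<in> null_sets lebesgue" using that by (auto simp: null_sets_def)
    then have "AE x in lebesgue_on A. False"
      using AE_not_in[of A lebesgue] by (subst AE_restrict_space_iff) auto
    then have "(LINT x|lebesgue_on A. h x) = 0"
      by (intro integral_eq_zero_AE) (auto elim: eventually_mono)
    then show ?thesis using eq that by simp
  qed
  then obtain k where k: "integrable (lebesgue_on K) k"
    "\<forall>A. A \<in> sets borel \<and> A \<subseteq> K \<longrightarrow> \<sigma> A = (LINT x|lebesgue_on A. k x)"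
    "\<forall>f. continuous_on K f \<longrightarrow> signed_integral K \<sigma> f = (LINT x|lebesgue_on K. f x * k x)"
    using signed_integral_density_exists[OF \<sigma> K] by metis
  have "AE x in lebesgue_on K. h x - k x = 0"
  proof (rule AE_zero_if_compact_integrals_zero[OF Kb])
    show "(\<lambda>x. h x - k x) \<in> borel_measurable (lebesgue_on K)" using h k by simp
    fix C assume C: "compact C" "C \<subseteq> K"
    then have i: "integrable (lebesgue_on C) h" "integrable (lebesgue_on C) k"
      using h k(1) Kb by (auto intro!: integrable_lebesgue_on_subset[of K] simp: borel_compact)
    then show "integrable (lebesgue_on C) (\<lambda>x. h x - k x)" by simp
    show "(LINT x|lebesgue_on C. h x - k x) = 0"
      using i eq[of C] k(2)[rule_format, of C] C by (simp add: borel_compact)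
  qed
  then have "AE x in lebesgue_on K. f x * h x = f x * k x" by eventually_elim simp
  moreover have "f \<in> borel_measurable (lebesgue_on K)"
    by (rule continuous_imp_measurable_on_sets_lebesgue[OF f Kb])
  ultimately show ?thesis
    using h k by (subst k(3)[rule_format, OF f], intro integral_cong_AE) auto
qed

section \<open>Testing against continuous functions\<close>

lemma powr_abs_le_add:
  fixes a b p :: real
  assumes "0 \<le> a" "0 \<le> b" "0 \<le> p"
  shows "(a + b) powr p \<le> 2 powr p * (a powr p + b powr p)"
proof -
  have "(a + b) powr p \<le> (2 * max a b) powr p"
    using assms by (intro powr_mono2) auto
  also have "\<dots> = 2 powr p * max a b powr p" using assms by (intro powr_mult)
  also have "\<dots> \<le> 2 powr p * (a powr p + b powr p)"
    by (intro mult_left_mono) (auto simp: max_def)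
  finally show ?thesis .
qed

text \<open>Clipping continuous approximants at the levels \<open>B\<close> and \<open>- B\<close>
  preserves continuity and the limit, and gives the uniform bound for dominated convergence.\<close>

lemma bounded_measurable_continuous_approx:
  fixes g :: "'a::euclidean_space \<Rightarrow> real"
  assumes S: "S \<in> sets lebesgue" and g: "g \<in> borel_measurable (lebesgue_on S)"
    and B: "\<And>x. x \<in> S \<Longrightarrow> \<bar>g x\<bar> \<le> B" "0 \<le> B"
  obtains \<phi> :: "nat \<Rightarrow> 'a \<Rightarrow> real"
  where "\<And>n. continuous_on UNIV (\<phi> n)" "\<And>n x. \<bar>\<phi> n x\<bar> \<le> B"
    "AE x in lebesgue_on S. (\<lambda>n. \<phi> n x) \<longlonglongrightarrow> g x"
proof -
  let ?g = "\<lambda>x. if x \<in> S then g x else 0"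
  have "?g measurable_on UNIV"
    using borel_measurable_if_I[OF g S] by (intro lebesgue_measurable_imp_measurable_on_real) auto
  then obtain N G where N: "negligible N" and G: "\<And>n. continuous_on UNIV (G n)"
    and lim: "\<And>x. x \<notin> N \<Longrightarrow> (\<lambda>n. G n x) \<longlonglongrightarrow> ?g x"
    unfolding measurable_on_def by auto
  show thesis
  proof
    show "continuous_on UNIV (\<lambda>x. max (- B) (min B (G n x)))" for n
      by (intro continuous_intros G)
    show "\<bar>max (- B) (min B (G n x))\<bar> \<le> B" for n x using B(2) by auto
    have "AE x in lebesgue. x \<notin> N"
      using N by (intro AE_not_in) (simp add: negligible_iff_null_sets)
    then have "AE x in lebesgue. x \<in> S \<longrightarrow> (\<lambda>n. max (- B) (min B (G n x))) \<longlonglongrightarrow> g x"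
    proof eventually_elim
      case (elim x)
      show ?case
      proof
        assume x: "x \<in> S"
        have "(\<lambda>n. max (- B) (min B (G n x))) \<longlonglongrightarrow> max (- B) (min B (g x))"
          using lim[OF elim] x by (intro tendsto_intros) auto
        moreover have "max (- B) (min B (g x)) = g x" using B(1)[OF x] by auto
        ultimately show "(\<lambda>n. max (- B) (min B (G n x))) \<longlonglongrightarrow> g x" by simp
      qed
    qed
    then show "AE x in lebesgue_on S. (\<lambda>n. max (- B) (min B (G n x))) \<longlonglongrightarrow> g x"
      using S by (simp add: AE_restrict_space_iff)
  qed
qed

lemma borel_measurable_lebesgue_on_continuous [simp]:
  fixes f :: "'a::euclidean_space \<Rightarrow> 'b::euclidean_space"
  assumes "continuous_on UNIV f"
  shows "f \<in> borel_measurable (lebesgue_on S)"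
  using borel_measurable_continuous_onI[OF assms]
  by (intro measurable_restrict_space1 measurable_completion) simp

lemma integrable_bounded_lebesgue_on:
  fixes g :: "'a::euclidean_space \<Rightarrow> 'b::euclidean_space"
  assumes "S \<in> sets lebesgue" "bounded S" "g \<in> borel_measurable (lebesgue_on S)"
    "\<And>x. x \<in> S \<Longrightarrow> norm (g x) \<le> B"
  shows "integrable (lebesgue_on S) g"
proof -
  interpret finite_measure "lebesgue_on S"
    by (rule finite_measure_lebesgue_on_bounded[OF assms(1,2)])
  show ?thesis using assms by (intro integrable_const_bound[where B=B]) (auto intro!: AE_I2)
qed

lemmas integrable_bounded_real = integrable_bounded_lebesgue_on[where 'b=real, unfolded real_norm_def]

text \<open>Allows test functions that are built from \<open>h\<close> itself and are merely
  measurable: both sides converge along clipped continuous approximants.\<close>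

lemma bounded_test_inequality:
  fixes h g :: "'a::euclidean_space \<Rightarrow> real"
  assumes S: "S \<in> sets lebesgue" "bounded S" and h: "integrable (lebesgue_on S) h" and p: "0 < p"
    and test: "\<And>\<phi>. continuous_on UNIV \<phi> \<Longrightarrow>
      (LINT x|lebesgue_on S. \<phi> x * h x) \<le> C + c * (LINT x|lebesgue_on S. \<bar>\<phi> x\<bar> powr p)"
    and g: "g \<in> borel_measurable (lebesgue_on S)" "\<And>x. x \<in> S \<Longrightarrow> \<bar>g x\<bar> \<le> B" "0 \<le> B"
  shows "(LINT x|lebesgue_on S. g x * h x) \<le> C + c * (LINT x|lebesgue_on S. \<bar>g x\<bar> powr p)"
proof -
  let ?M = "lebesgue_on S"
  interpret finite_measure ?M by (rule finite_measure_lebesgue_on_bounded[OF S])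
  obtain \<phi> :: "nat \<Rightarrow> 'a \<Rightarrow> real" where \<phi>: "\<And>n. continuous_on UNIV (\<phi> n)"
    "\<And>n x. \<bar>\<phi> n x\<bar> \<le> B" "AE x in ?M. (\<lambda>n. \<phi> n x) \<longlonglongrightarrow> g x"
    using bounded_measurable_continuous_approx[OF S(1) g] by blast
  have \<phi>m[measurable]: "\<phi> n \<in> borel_measurable ?M" for n using \<phi>(1) by simp
  note [measurable] = g(1) borel_measurable_integrable[OF h]
  have 1: "(\<lambda>n. LINT x|?M. \<phi> n x * h x) \<longlonglongrightarrow> (LINT x|?M. g x * h x)"
  proof (rule integral_dominated_convergence[where w="\<lambda>x. B * \<bar>h x\<bar>"])
    show "AE x in ?M. (\<lambda>n. \<phi> n x * h x) \<longlonglongrightarrow> g x * h x"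
      using \<phi>(3) by eventually_elim (intro tendsto_intros)
    show "AE x in ?M. norm (\<phi> n x * h x) \<le> B * \<bar>h x\<bar>" for n
      using \<phi>(2) by (intro AE_I2) (auto simp: abs_mult intro!: mult_right_mono)
  qed (use h in auto)
  have 2: "(\<lambda>n. LINT x|?M. \<bar>\<phi> n x\<bar> powr p) \<longlonglongrightarrow> (LINT x|?M. \<bar>g x\<bar> powr p)"
  proof (rule integral_dominated_convergence[where w="\<lambda>x. B powr p"])
    show "AE x in ?M. (\<lambda>n. \<bar>\<phi> n x\<bar> powr p) \<longlonglongrightarrow> \<bar>g x\<bar> powr p"
      using \<phi>(3) by eventually_elim (intro tendsto_powr' tendsto_intros, use p in auto)
    show "AE x in ?M. norm (\<bar>\<phi> n x\<bar> powr p) \<le> B powr p" for n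
      using \<phi>(2) p by (intro AE_I2) (auto intro!: powr_mono2)
  qed auto
  show ?thesis
    by (rule LIMSEQ_le[OF 1 tendsto_add[OF tendsto_const tendsto_mult[OF tendsto_const 2]]])
      (use test \<phi>(1) in blast)
qed

lemma conj_exp_arith:
  fixes \<alpha> :: real
  assumes "1 < \<alpha>"
  shows "1 < conj_exp \<alpha>" "1 / \<alpha> + 1 / conj_exp \<alpha> = 1" "(\<alpha> - 1) * conj_exp \<alpha> = \<alpha>"
    "0 < conj_exp \<alpha>"
  using assms by (auto simp: conj_exp_def field_simps)

text \<open>Testing with a truncation of the function dual to \<open>h\<close>, the term with
  \<open>1 / conj_exp \<alpha>\<close> is absorbed on the left. The bound does not depend on the
  truncation level, so monotone convergence applies.\<close>

lemma powr_integrable_if_test_inequality: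
  fixes h :: "'a::euclidean_space \<Rightarrow> real"
  assumes S: "S \<in> sets lebesgue" "bounded S" and h: "integrable (lebesgue_on S) h" and \<alpha>: "1 < \<alpha>"
    and test: "\<And>\<phi>. continuous_on UNIV \<phi> \<Longrightarrow> (LINT x|lebesgue_on S. \<phi> x * h x)
      \<le> C + 1 / conj_exp \<alpha> * (LINT x|lebesgue_on S. \<bar>\<phi> x\<bar> powr conj_exp \<alpha>)"
  shows "integrable (lebesgue_on S) (\<lambda>x. \<bar>h x\<bar> powr \<alpha>)"
proof -
  let ?M = "lebesgue_on S" and ?p = "conj_exp \<alpha>"
  note p = conj_exp_arith[OF \<alpha>]
  note [measurable] = borel_measurable_integrable[OF h]
  define k where "k m x = (if \<bar>h x\<bar> \<le> real m then \<bar>h x\<bar> powr \<alpha> else 0)" for m x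
  have km[measurable]: "k m \<in> borel_measurable ?M" for m unfolding k_def by measurable
  have kb: "\<bar>k m x\<bar> \<le> real m powr \<alpha>" for m x using \<alpha> by (auto simp: k_def intro: powr_mono2)
  have kint: "integrable ?M (k m)" for m
    by (rule integrable_bounded_real[OF S km kb])
  have bound: "(LINT x|?M. k m x) \<le> \<alpha> * C" for m
  proof -
    \<comment> \<open>The equality case of Young's inequality: below level \<open>m\<close>, both
      \<open>g * h\<close> and the conjugate power of \<open>|g|\<close> equal the power
      \<open>\<alpha>\<close> of \<open>|h|\<close>.\<close>
    define g where "g x = (if \<bar>h x\<bar> \<le> real m then sgn (h x) * \<bar>h x\<bar> powr (\<alpha> - 1) else 0)" for x
    have gm: "g \<in> borel_measurable ?M" unfolding g_def by measurable
    have gb: "\<bar>g x\<bar> \<le> real m powr (\<alpha> - 1)" for x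
      using \<alpha> by (auto simp: g_def abs_mult abs_sgn_eq intro: powr_mono2)
    have pa: "\<bar>y\<bar> * \<bar>y\<bar> powr (\<alpha> - 1) = \<bar>y\<bar> powr \<alpha>" for y :: real
      using powr_add[of "\<bar>y\<bar>" 1 "\<alpha> - 1"] by (cases "y = 0") auto
    have gh: "g x * h x = k m x" for x
      using pa[of "h x"] by (auto simp: g_def k_def sgn_if mult_ac)
    have gp: "\<bar>g x\<bar> powr ?p = k m x" for x
      using p(4) \<alpha> by (auto simp: g_def k_def abs_mult abs_sgn_eq powr_powr p(3))
    have "(LINT x|?M. g x * h x) \<le> C + 1 / ?p * (LINT x|?M. \<bar>g x\<bar> powr ?p)"
      by (rule bounded_test_inequality[OF S h p(4) test gm gb]) auto
    then have "(LINT x|?M. k m x) * (1 - 1 / ?p) \<le> C" by (simp add: gh gp algebra_simps)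
    moreover have "1 - 1 / ?p = 1 / \<alpha>" using p(2) by simp
    ultimately show ?thesis using \<alpha> by (simp add: field_simps)
  qed
  have kmono: "incseq (\<lambda>m. k m x)" for x
    by (auto simp: k_def incseq_def)
  have "incseq (\<lambda>m. LINT x|?M. k m x)"
    unfolding incseq_def
  proof (intro allI impI)
    fix m n :: nat assume "m \<le> n"
    then show "(LINT x|?M. k m x) \<le> (LINT x|?M. k n x)"
      using kint incseqD[OF kmono] by (intro integral_mono) auto
  qed
  then obtain L where L: "(\<lambda>m. LINT x|?M. k m x) \<longlonglongrightarrow> L"
    using bound by (metis incseq_convergent)
  show ?thesis
  proof (rule integrable_monotone_convergence[where f=k])
    show "AE x in ?M. mono (\<lambda>m. k m x)" using kmono by (intro AE_I2)
    show "AE x in ?M. (\<lambda>m. k m x) \<longlonglongrightarrow> \<bar>h x\<bar> powr \<alpha>"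
    proof (intro AE_I2 tendsto_eventually)
      fix x
      obtain m0 where "\<bar>h x\<bar> \<le> real m0" using real_arch_simple by blast
      then show "\<forall>\<^sub>F m in sequentially. k m x = \<bar>h x\<bar> powr \<alpha>"
        unfolding eventually_sequentially k_def by (intro exI[of _ m0]) auto
    qed
  qed (use kint L in auto)
qed

section \<open>Duality of conjugate exponents and weak convergence\<close>

lemma powr_mult_integrable:
  fixes h g :: "'a \<Rightarrow> real"
  assumes \<alpha>: "1 < \<alpha>" and h: "h \<in> borel_measurable M" "integrable M (\<lambda>x. \<bar>h x\<bar> powr \<alpha>)"
    and g: "g \<in> borel_measurable M" "integrable M (\<lambda>x. \<bar>g x\<bar> powr conj_exp \<alpha>)" and t: "0 < t"
  shows "integrable M (\<lambda>x. g x * h x)"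
    and "\<bar>LINT x|M. g x * h x\<bar> \<le> t powr \<alpha> * (LINT x|M. \<bar>h x\<bar> powr \<alpha>)
      + (1 / t) powr conj_exp \<alpha> * (LINT x|M. \<bar>g x\<bar> powr conj_exp \<alpha>)"
proof -
  let ?p = "conj_exp \<alpha>"
  note p = conj_exp_arith[OF \<alpha>]
  have le: "\<bar>g x * h x\<bar> \<le> t powr \<alpha> * \<bar>h x\<bar> powr \<alpha> + (1 / t) powr ?p * \<bar>g x\<bar> powr ?p" for x
  proof -
    \<comment> \<open>The weight \<open>t\<close> shifts size between the factors before Young's
      inequality is applied. A small \<open>t\<close> makes the \<open>h\<close> term small,
      whatever bound \<open>h\<close> has, at the price of a large factor on the \<open>g\<close>
      term.\<close>
    have "\<bar>g x * h x\<bar> = (t * \<bar>h x\<bar>) * (1 / t * \<bar>g x\<bar>)" using t by (simp add: abs_mult)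
    also have "\<dots> \<le> (t * \<bar>h x\<bar>) powr \<alpha> / \<alpha> + (1 / t * \<bar>g x\<bar>) powr ?p / ?p"
      using t \<alpha> p by (intro Youngs_inequality) auto
    also have "\<dots> \<le> (t * \<bar>h x\<bar>) powr \<alpha> + (1 / t * \<bar>g x\<bar>) powr ?p"
    proof (intro add_mono)
      have "y / c \<le> y" if "0 \<le> y" "1 < c" for y c :: real
        using that by (simp add: divide_le_eq mult_le_cancel_left1)
      then show "(t * \<bar>h x\<bar>) powr \<alpha> / \<alpha> \<le> (t * \<bar>h x\<bar>) powr \<alpha>"
        "(1 / t * \<bar>g x\<bar>) powr ?p / ?p \<le> (1 / t * \<bar>g x\<bar>) powr ?p" using \<alpha> p(1) by auto
    qed
    also have "\<dots> = t powr \<alpha> * \<bar>h x\<bar> powr \<alpha> + (1 / t) powr ?p * \<bar>g x\<bar> powr ?p"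
      using t by (simp only: powr_mult)
    finally show ?thesis .
  qed
  have int: "integrable M (\<lambda>x. t powr \<alpha> * \<bar>h x\<bar> powr \<alpha> + (1 / t) powr ?p * \<bar>g x\<bar> powr ?p)"
    using h g by simp
  show i: "integrable M (\<lambda>x. g x * h x)"
    by (rule Bochner_Integration.integrable_bound[OF int]) (use h g le in \<open>auto intro!: AE_I2\<close>)
  have "\<bar>LINT x|M. g x * h x\<bar> \<le> (LINT x|M. \<bar>g x * h x\<bar>)" by (rule integral_abs_bound)
  also have "\<dots> \<le> (LINT x|M. t powr \<alpha> * \<bar>h x\<bar> powr \<alpha> + (1 / t) powr ?p * \<bar>g x\<bar> powr ?p)"
    using i int le by (intro integral_mono) auto
  also have "\<dots> = t powr \<alpha> * (LINT x|M. \<bar>h x\<bar> powr \<alpha>) + (1 / t) powr ?p * (LINT x|M. \<bar>g x\<bar> powr ?p)"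
    using h g by simp
  finally show "\<bar>LINT x|M. g x * h x\<bar> \<le> \<dots>" .
qed

text \<open>Two approximations: first \<open>g\<close> is truncated at a height \<open>m\<close>,
  then the truncation is replaced by a continuous function clipped at the same height.\<close>

lemma continuous_dense_powr:
  fixes g :: "'a::euclidean_space \<Rightarrow> real"
  assumes S: "S \<in> sets lebesgue" "bounded S" and p: "0 < p" and e: "0 < e"
    and g: "g \<in> borel_measurable (lebesgue_on S)" "integrable (lebesgue_on S) (\<lambda>x. \<bar>g x\<bar> powr p)"
  obtains \<phi> B where "continuous_on UNIV \<phi>" "\<And>x. \<bar>\<phi> x\<bar> \<le> B"
    "(LINT x|lebesgue_on S. \<bar>g x - \<phi> x\<bar> powr p) < e"
proof -
  let ?M = "lebesgue_on S"
  interpret finite_measure ?M by (rule finite_measure_lebesgue_on_bounded[OF S])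
  note [measurable] = g(1)
  define T where "T m x = max (- real m) (min (real m) (g x))" for m x
  have Tm[measurable]: "T m \<in> borel_measurable ?M" for m unfolding T_def by measurable
  \<comment> \<open>The error allowed to each approximation; \<open>powr_abs_le_add\<close> costs
    the factor \<open>2 powr p\<close> when the two are combined.\<close>
  define c where "c = e / (2 * 2 powr p)"
  have c: "0 < c" using e by (simp add: c_def)
  have "(\<lambda>m. LINT x|?M. \<bar>g x - T m x\<bar> powr p) \<longlonglongrightarrow> (LINT x|?M. 0)"
  proof (rule integral_dominated_convergence[where w="\<lambda>x. \<bar>g x\<bar> powr p"])
    show "AE x in ?M. (\<lambda>m. \<bar>g x - T m x\<bar> powr p) \<longlonglongrightarrow> 0"
    proof (intro AE_I2 tendsto_eventually)
      fix x
      obtain m0 where "\<bar>g x\<bar> \<le> real m0" using real_arch_simple by blast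
      then show "\<forall>\<^sub>F m in sequentially. \<bar>g x - T m x\<bar> powr p = 0"
        unfolding eventually_sequentially T_def by (intro exI[of _ m0]) auto
    qed
    show "AE x in ?M. norm (\<bar>g x - T m x\<bar> powr p) \<le> \<bar>g x\<bar> powr p" for m
      using p by (intro AE_I2) (auto simp: T_def intro!: powr_mono2)
  qed (use g in auto)
  then have "\<forall>\<^sub>F m in sequentially. (LINT x|?M. \<bar>g x - T m x\<bar> powr p) < c"
    using c by (intro order_tendstoD(2)) auto
  then obtain m where m: "(LINT x|?M. \<bar>g x - T m x\<bar> powr p) < c"
    by (auto simp: eventually_sequentially)
  have Tb: "\<bar>T m x\<bar> \<le> real m" for x by (auto simp: T_def)
  obtain \<phi> :: "nat \<Rightarrow> 'a \<Rightarrow> real" where \<phi>: "\<And>n. continuous_on UNIV (\<phi> n)"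
    "\<And>n x. \<bar>\<phi> n x\<bar> \<le> real m" "AE x in ?M. (\<lambda>n. \<phi> n x) \<longlonglongrightarrow> T m x"
    using bounded_measurable_continuous_approx[OF S(1) Tm Tb] by (metis of_nat_0_le_iff)
  have \<phi>m[measurable]: "\<phi> n \<in> borel_measurable ?M" for n using \<phi>(1) by simp
  have b2: "\<bar>T m x - \<phi> n x\<bar> powr p \<le> (2 * real m) powr p" for x n
    using Tb[of x] \<phi>(2)[of n x] p by (intro powr_mono2) auto
  have "(\<lambda>n. LINT x|?M. \<bar>T m x - \<phi> n x\<bar> powr p) \<longlonglongrightarrow> (LINT x|?M. 0)"
  proof (rule integral_dominated_convergence[where w="\<lambda>x. (2 * real m) powr p"])
    show "AE x in ?M. (\<lambda>n. \<bar>T m x - \<phi> n x\<bar> powr p) \<longlonglongrightarrow> 0"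
      using \<phi>(3)
    proof eventually_elim
      case (elim x)
      have "(\<lambda>n. \<bar>T m x - \<phi> n x\<bar> powr p) \<longlonglongrightarrow> \<bar>T m x - T m x\<bar> powr p"
        using p elim by (intro tendsto_powr' tendsto_intros) auto
      then show ?case by simp
    qed
    show "AE x in ?M. norm (\<bar>T m x - \<phi> n x\<bar> powr p) \<le> (2 * real m) powr p" for n
      using b2 by (intro AE_I2) auto
  qed auto
  then have "\<forall>\<^sub>F n in sequentially. (LINT x|?M. \<bar>T m x - \<phi> n x\<bar> powr p) < c"
    using c by (intro order_tendstoD(2)) auto
  then obtain n where n: "(LINT x|?M. \<bar>T m x - \<phi> n x\<bar> powr p) < c"
    by (auto simp: eventually_sequentially)
  have i1: "integrable ?M (\<lambda>x. \<bar>g x - T m x\<bar> powr p)"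
    by (rule Bochner_Integration.integrable_bound[OF g(2)])
      (use p in \<open>auto simp: T_def intro!: AE_I2 powr_mono2\<close>)
  have i2: "integrable ?M (\<lambda>x. \<bar>T m x - \<phi> n x\<bar> powr p)"
    using b2 by (intro integrable_bounded_real[OF S]) auto
  have "(LINT x|?M. \<bar>g x - \<phi> n x\<bar> powr p)
      \<le> (LINT x|?M. 2 powr p * (\<bar>g x - T m x\<bar> powr p + \<bar>T m x - \<phi> n x\<bar> powr p))"
  proof (rule integral_mono')
    show "integrable ?M (\<lambda>x. 2 powr p * (\<bar>g x - T m x\<bar> powr p + \<bar>T m x - \<phi> n x\<bar> powr p))"
      using i1 i2 by simp
    fix x
    have "\<bar>g x - \<phi> n x\<bar> powr p \<le> (\<bar>g x - T m x\<bar> + \<bar>T m x - \<phi> n x\<bar>) powr p"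
      using p by (intro powr_mono2) auto
    also have "\<dots> \<le> 2 powr p * (\<bar>g x - T m x\<bar> powr p + \<bar>T m x - \<phi> n x\<bar> powr p)"
      using p by (intro powr_abs_le_add) auto
    finally show "\<bar>g x - \<phi> n x\<bar> powr p
      \<le> 2 powr p * (\<bar>g x - T m x\<bar> powr p + \<bar>T m x - \<phi> n x\<bar> powr p)" .
  qed simp
  also have "\<dots> = 2 powr p * ((LINT x|?M. \<bar>g x - T m x\<bar> powr p) + (LINT x|?M. \<bar>T m x - \<phi> n x\<bar> powr p))"
    using i1 i2 by simp
  also have "\<dots> < 2 powr p * (c + c)"
    using m n by (intro mult_strict_left_mono add_strict_mono) auto
  also have "\<dots> = e" by (simp add: c_def)
  finally show thesis using that \<phi>(1,2) by blast
qed

text \<open>A continuous function close to \<open>g\<close> replaces it, with an error that is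
  uniform in \<open>n\<close> because the \<open>hn n\<close> have bounded norms.\<close>

lemma weak_convergence_powr:
  fixes h :: "'a::euclidean_space \<Rightarrow> real"
  assumes S: "S \<in> sets lebesgue" "bounded S" and \<alpha>: "1 < \<alpha>"
    and hn: "\<And>n. hn n \<in> borel_measurable (lebesgue_on S)"
      "\<And>n. integrable (lebesgue_on S) (\<lambda>x. \<bar>hn n x\<bar> powr \<alpha>)"
      "\<And>n. (LINT x|lebesgue_on S. \<bar>hn n x\<bar> powr \<alpha>) \<le> C"
    and h: "h \<in> borel_measurable (lebesgue_on S)"
      "integrable (lebesgue_on S) (\<lambda>x. \<bar>h x\<bar> powr \<alpha>)"
    and test: "\<And>\<phi>. continuous_on UNIV \<phi> \<Longrightarrow>
      (\<lambda>n. LINT x|lebesgue_on S. \<phi> x * hn n x) \<longlonglongrightarrow> (LINT x|lebesgue_on S. \<phi> x * h x)"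
    and g: "g \<in> borel_measurable (lebesgue_on S)"
      "integrable (lebesgue_on S) (\<lambda>x. \<bar>g x\<bar> powr conj_exp \<alpha>)"
  shows "(\<lambda>n. LINT x|lebesgue_on S. g x * hn n x) \<longlonglongrightarrow> (LINT x|lebesgue_on S. g x * h x)"
proof (rule LIMSEQ_I)
  let ?M = "lebesgue_on S" and ?p = "conj_exp \<alpha>"
  interpret finite_measure ?M by (rule finite_measure_lebesgue_on_bounded[OF S])
  note p = conj_exp_arith[OF \<alpha>]
  fix e :: real assume e: "0 < e"
  define D where "D = max (max C (LINT x|?M. \<bar>h x\<bar> powr \<alpha>)) 0"
  \<comment> \<open>Makes the \<open>k\<close> term of the weighted Young inequality at most
    \<open>e / 6\<close> for every \<open>k\<close> within the bound \<open>D\<close>. The summand 1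
    keeps the denominator positive.\<close>
  define t where "t = (e / (6 * (D + 1))) powr (1 / \<alpha>)"
  have D: "0 \<le> D" by (simp add: D_def)
  have t: "0 < t" using e D by (simp add: t_def)
  have ta: "t powr \<alpha> = e / (6 * (D + 1))" using e D \<alpha> by (simp add: t_def powr_powr)
  have taD: "t powr \<alpha> * D \<le> e / 6" unfolding ta using e D by (simp add: field_simps)
  \<comment> \<open>After multiplication by \<open>(1 / t) powr ?p\<close>, the approximation error
    of \<open>g\<close> contributes at most another \<open>e / 6\<close>. Each exchange of
    \<open>g\<close> for \<open>\<phi>\<close> thus costs \<open>e / 3\<close>.\<close>
  define \<eta> where "\<eta> = t powr ?p * (e / 6)"
  have "0 < \<eta>" using t e by (simp add: \<eta>_def)
  then obtain \<phi> B where \<phi>: "continuous_on UNIV \<phi>" "\<And>x. \<bar>\<phi> x\<bar> \<le> B"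
    and small: "(LINT x|?M. \<bar>g x - \<phi> x\<bar> powr ?p) < \<eta>"
    using continuous_dense_powr[OF S p(4) _ g] by blast
  have \<phi>m[measurable]: "\<phi> \<in> borel_measurable ?M" using \<phi>(1) by simp
  note [measurable] = g(1)
  have ip: "integrable ?M (\<lambda>x. \<bar>\<phi> x\<bar> powr ?p)"
    using \<phi>(2) p(4) by (intro integrable_bounded_real[OF S, where B="B powr ?p"])
      (auto intro!: powr_mono2)
  have id: "integrable ?M (\<lambda>x. \<bar>g x - \<phi> x\<bar> powr ?p)"
  proof (rule Bochner_Integration.integrable_bound)
    show "integrable ?M (\<lambda>x. 2 powr ?p * (\<bar>g x\<bar> powr ?p + \<bar>\<phi> x\<bar> powr ?p))" using g ip by simp
    have "\<bar>g x - \<phi> x\<bar> powr ?p \<le> 2 powr ?p * (\<bar>g x\<bar> powr ?p + \<bar>\<phi> x\<bar> powr ?p)" for x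
      using p(4) powr_mono2[of ?p "\<bar>g x - \<phi> x\<bar>" "\<bar>g x\<bar> + \<bar>\<phi> x\<bar>"] powr_abs_le_add[of "\<bar>g x\<bar>" "\<bar>\<phi> x\<bar>" ?p]
      by (auto intro: order_trans[OF _ powr_abs_le_add] simp: abs_triangle_ineq4)
    then show "AE x in ?M. norm (\<bar>g x - \<phi> x\<bar> powr ?p) \<le> norm (2 powr ?p * (\<bar>g x\<bar> powr ?p + \<bar>\<phi> x\<bar> powr ?p))"
      by (intro AE_I2) auto
  qed simp
  have est: "\<bar>(LINT x|?M. g x * k x) - (LINT x|?M. \<phi> x * k x)\<bar> \<le> e / 3"
    if k: "k \<in> borel_measurable ?M" "integrable ?M (\<lambda>x. \<bar>k x\<bar> powr \<alpha>)" "(LINT x|?M. \<bar>k x\<bar> powr \<alpha>) \<le> D" for k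
  proof -
    have "(LINT x|?M. g x * k x) - (LINT x|?M. \<phi> x * k x) = (LINT x|?M. (g x - \<phi> x) * k x)"
      using powr_mult_integrable(1)[OF \<alpha> k(1,2) g zero_less_one] powr_mult_integrable(1)[OF \<alpha> k(1,2) \<phi>m ip zero_less_one]
      by (simp add: left_diff_distrib)
    also have "\<bar>\<dots>\<bar> \<le> t powr \<alpha> * (LINT x|?M. \<bar>k x\<bar> powr \<alpha>) + (1 / t) powr ?p * (LINT x|?M. \<bar>g x - \<phi> x\<bar> powr ?p)"
      using id by (intro powr_mult_integrable(2)[OF \<alpha> k(1,2) _ _ t]) auto
    also have "\<dots> \<le> t powr \<alpha> * D + (1 / t) powr ?p * \<eta>"
      using k(3) small by (intro add_mono mult_left_mono) auto
    also have "(1 / t) powr ?p * \<eta> = e / 6" using t by (simp add: \<eta>_def powr_divide)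
    finally show ?thesis using taD by simp
  qed
  have "\<exists>N. \<forall>n\<ge>N. norm ((LINT x|?M. \<phi> x * hn n x) - (LINT x|?M. \<phi> x * h x)) < e / 3"
    using test[OF \<phi>(1)] e by (intro LIMSEQ_D) auto
  then obtain N where N: "\<And>n. N \<le> n \<Longrightarrow> \<bar>(LINT x|?M. \<phi> x * hn n x) - (LINT x|?M. \<phi> x * h x)\<bar> < e / 3"
    by auto
  have Dn: "(LINT x|?M. \<bar>hn n x\<bar> powr \<alpha>) \<le> D" for n using hn(3)[of n] by (simp add: D_def)
  have Dh: "(LINT x|?M. \<bar>h x\<bar> powr \<alpha>) \<le> D" by (simp add: D_def)
  show "\<exists>N. \<forall>n\<ge>N. norm ((LINT x|?M. g x * hn n x) - (LINT x|?M. g x * h x)) < e"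
  proof (intro exI allI impI)
    fix n assume "N \<le> n"
    from N[OF this] est[OF hn(1,2) Dn, of n] est[OF h Dh]
    show "norm ((LINT x|?M. g x * hn n x) - (LINT x|?M. g x * h x)) < e" unfolding real_norm_def by linarith
  qed
qed

section \<open>Absolute continuity from a test inequality\<close>

lemma finite_borel_inner_compact:
  fixes Q :: "'a::euclidean_space measure"
  assumes "finite_measure Q" "sets Q = sets borel" "A \<in> sets borel" "0 < e"
  obtains C where "compact C" "C \<subseteq> A" "measure Q (A - C) < e"
proof -
  interpret finite_measure Q by fact
  have sp: "space Q = UNIV" using assms(2) sets_eq_imp_space_eq by fastforce
  show thesis
  proof (cases "emeasure Q A = 0")
    case True
    then show ?thesis using assms that[of "{}"] by (simp add: measure_def)
  next
    case False
    have "emeasure Q A = (SUP K \<in> {K. K \<subseteq> A \<and> compact K}. emeasure Q K)"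
      using assms sp by (intro inner_regular) auto
    moreover have "emeasure Q A - ennreal e < emeasure Q A"
      using False assms(4) by (intro ennreal_between) (auto simp: less_top[symmetric] less_le)
    ultimately obtain C where C: "compact C" "C \<subseteq> A" "emeasure Q A - ennreal e < emeasure Q C"
      by (auto simp: less_SUP_iff)
    have Cb: "C \<in> sets Q" "A \<in> sets Q" using C assms by (auto simp: borel_compact)
    have "measure Q A - e < measure Q C"
      using C(3) assms(4) unfolding emeasure_eq_measure
      by (cases "e \<le> measure Q A") (auto simp: ennreal_minus ennreal_less_iff zero_less_measure_iff intro: less_le_trans[OF _ measure_nonneg])
    moreover have "measure Q (A - C) = measure Q A - measure Q C"
      using C Cb by (intro finite_measure_Diff) auto
    ultimately show ?thesis using C that by auto
  qed
qed

lemma compact_indicator_limit: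
  fixes x :: "'a::euclidean_space"
  assumes "compact C" "C \<noteq> {}"
  shows "(\<lambda>n. max 0 (1 - real n * infdist x C)) \<longlonglongrightarrow> indicator C x"
proof (cases "x \<in> C")
  case False
  then have d: "0 < infdist x C"
    using assms infdist_pos_not_in_closed[of C x] compact_imp_closed by blast
  obtain n0 where n0: "1 / infdist x C \<le> real n0" using real_arch_simple by blast
  have "max 0 (1 - real n * infdist x C) = 0" if "n0 \<le> n" for n
  proof -
    have "1 / infdist x C \<le> real n" using n0 that by linarith
    then show ?thesis using d by (simp add: field_simps)
  qed
  then show ?thesis using False
    by (intro tendsto_eventually) (auto simp: eventually_sequentially)
qed (use assms in simp)

text \<open>Continuous functions decreasing to a multiple of the indicator of a compact null set
  have vanishing power integrals in the limit, so arbitrarily large multiples of its content stay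
  below \<open>D\<close>. Inner regularity of both variations extends this from compact sets to
  Borel sets.\<close>

lemma signed_abs_cont_if_test_inequality:
  fixes K :: "'a::euclidean_space set"
  assumes \<sigma>: "signed_on K \<sigma>" and K: "compact K" and p: "0 < p"
    and test: "\<And>\<phi>. continuous_on UNIV \<phi> \<Longrightarrow>
      signed_integral K \<sigma> \<phi> \<le> D + c * (LINT x|lebesgue_on K. \<bar>\<phi> x\<bar> powr p)"
    and A: "A \<in> sets borel" "A \<subseteq> K" "emeasure lborel A = 0"
  shows "\<sigma> A = 0"
proof -
  note \<sigma>' = signed_on_uminus[OF \<sigma>]
  let ?P = "pos_part K \<sigma>" and ?N = "pos_part K (\<lambda>A. - \<sigma> A)"
  have Kb: "K \<in> sets borel" "bounded K" "K \<in> sets lebesgue"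
    using K by (auto simp: borel_compact compact_imp_bounded)
  interpret P: finite_measure ?P by (rule finite_measure_pos_part[OF \<sigma> Kb(1)])
  interpret N: finite_measure ?N by (rule finite_measure_pos_part[OF \<sigma>' Kb(1)])
  interpret M: finite_measure "lebesgue_on K" by (rule finite_measure_lebesgue_on_bounded[OF Kb(3,2)])
  have setsPN: "sets ?P = sets (restrict_space borel K)" "sets ?N = sets (restrict_space borel K)"
    "space ?P = K" "space ?N = K"
    using \<sigma> \<sigma>' Kb by (simp_all add: sets_pos_part space_pos_part)
  have measPN: "f \<in> borel_measurable ?P" "f \<in> borel_measurable ?N"
    if "continuous_on UNIV f" for f :: "'a \<Rightarrow> real"
    using borel_measurable_continuous_on_restrict[OF continuous_on_subset[OF that subset_UNIV], of K]
      measurable_cong_sets[OF setsPN(1) refl] measurable_cong_sets[OF setsPN(2) refl] by blast+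
  have zero: "\<sigma> C = 0" if C: "compact C" "C \<subseteq> A" for C
  proof (cases "C = {}")
    case False
    have Cb: "C \<in> sets borel" "C \<subseteq> K" using C A by (auto simp: borel_compact)
    have CPN: "C \<in> sets ?P" "C \<in> sets ?N" using Cb Kb setsPN by (auto simp: sets_restrict_space_iff)
    have C0: "measure lebesgue C = 0"
    proof -
      have "emeasure lborel C \<le> emeasure lborel A" using C A by (intro emeasure_mono) auto
      then show ?thesis using A Cb by (simp add: measure_def)
    qed
    \<comment> \<open>Here \<open>t\<close> is an arbitrary real of either sign, while
      \<open>D\<close> is fixed.\<close>
    have "t * \<sigma> C \<le> D" for t
    proof -
      define \<phi> where "\<phi> n x = t * max 0 (1 - real n * infdist x C)" for n x
      have \<phi>c: "continuous_on UNIV (\<phi> n)" for n unfolding \<phi>_def by (intro continuous_intros)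
      have lim: "(\<lambda>n. \<phi> n x) \<longlonglongrightarrow> t * indicator C x" for x
        unfolding \<phi>_def by (intro tendsto_intros compact_indicator_limit C False)
      have b: "\<bar>\<phi> n x\<bar> \<le> \<bar>t\<bar>" for n x
        using infdist_nonneg[of x C] by (auto simp: \<phi>_def abs_mult intro!: mult_left_le)
      have 1: "(\<lambda>n. LINT x|?P. \<phi> n x) \<longlonglongrightarrow> (LINT x|?P. t * indicator C x)"
        by (rule integral_dominated_convergence[where w="\<lambda>_. \<bar>t\<bar>"])
          (use CPN lim b measPN[OF \<phi>c] in \<open>auto intro!: AE_I2\<close>)
      have 2: "(\<lambda>n. LINT x|?N. \<phi> n x) \<longlonglongrightarrow> (LINT x|?N. t * indicator C x)"
        by (rule integral_dominated_convergence[where w="\<lambda>_. \<bar>t\<bar>"])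
          (use CPN lim b measPN[OF \<phi>c] in \<open>auto intro!: AE_I2\<close>)
      have CM: "C \<in> sets (lebesgue_on K)" using Cb Kb by (auto simp: sets_restrict_space_iff)
      have 3: "(\<lambda>n. LINT x|lebesgue_on K. \<bar>\<phi> n x\<bar> powr p) \<longlonglongrightarrow> (LINT x|lebesgue_on K. \<bar>t * indicator C x\<bar> powr p)"
      proof (rule integral_dominated_convergence[where w="\<lambda>_. \<bar>t\<bar> powr p"])
        show "AE x in lebesgue_on K. (\<lambda>n. \<bar>\<phi> n x\<bar> powr p) \<longlonglongrightarrow> \<bar>t * indicator C x\<bar> powr p"
          using p lim by (intro AE_I2 tendsto_powr' tendsto_intros) auto
        show "AE x in lebesgue_on K. norm (\<bar>\<phi> n x\<bar> powr p) \<le> \<bar>t\<bar> powr p" for n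
          using p b by (intro AE_I2) (auto intro!: powr_mono2)
        show "(\<lambda>x. \<bar>\<phi> n x\<bar> powr p) \<in> borel_measurable (lebesgue_on K)" for n
          using borel_measurable_lebesgue_on_continuous[OF \<phi>c[of n], of K] by measurable
        show "(\<lambda>x. \<bar>t * indicator C x\<bar> powr p) \<in> borel_measurable (lebesgue_on K)"
          using CM by measurable
      qed simp
      have "(LINT x|lebesgue_on K. \<bar>t * indicator C x\<bar> powr p) = (LINT x|lebesgue_on K. \<bar>t\<bar> powr p * indicator C x)"
        using p by (intro Bochner_Integration.integral_cong) (auto simp: indicator_def)
      also have "\<dots> = 0"
        using Cb Kb C0 by (simp add: measure_restrict_space Int_absorb2)
      finally have I0: "(LINT x|lebesgue_on K. \<bar>t * indicator C x\<bar> powr p) = 0" .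
      have "(LINT x|?P. t * indicator C x) - (LINT x|?N. t * indicator C x) = t * \<sigma> C"
        using Cb setsPN measure_pos_part_diff[OF \<sigma> Kb(1) Cb] by (simp add: Int_absorb2 right_diff_distrib)
      then have "(\<lambda>n. signed_integral K \<sigma> (\<phi> n)) \<longlonglongrightarrow> t * \<sigma> C"
        unfolding signed_integral_def using tendsto_diff[OF 1 2] by simp
      moreover have "(\<lambda>n. D + c * (LINT x|lebesgue_on K. \<bar>\<phi> n x\<bar> powr p)) \<longlonglongrightarrow> D + c * 0"
        using 3 unfolding I0 by (intro tendsto_intros)
      ultimately show ?thesis
        using test[OF \<phi>c] by (auto intro: LIMSEQ_le)
    qed
    \<comment> \<open>For nonzero \<open>\<sigma> C\<close> this multiple would give
      \<open>D + 1 \<le> D\<close>.\<close>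
    from this[of "(D + 1) / \<sigma> C"] show ?thesis by (cases "\<sigma> C = 0") auto
  qed (use signed_on_empty[OF \<sigma>] in simp)
  have "\<bar>\<sigma> A\<bar> \<le> e + e" if e: "0 < e" for e :: real
  proof -
    \<comment> \<open>Inner regularity is available for measures on all Borel sets, so the
      variations, which live on subsets of \<open>K\<close>, are pushed forward along the
      identity.\<close>
    have idP: "(\<lambda>x. x) \<in> measurable ?P borel" "(\<lambda>x. x) \<in> measurable ?N borel"
      unfolding measurable_cong_sets[OF setsPN(1) refl] measurable_cong_sets[OF setsPN(2) refl]
      by (auto intro: measurable_restrict_space1)
    obtain C1 where C1: "compact C1" "C1 \<subseteq> A" "measure (distr ?P borel (\<lambda>x. x)) (A - C1) < e"
      using finite_borel_inner_compact[OF P.finite_measure_distr[OF idP(1)] _ A(1) e] by auto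
    obtain C2 where C2: "compact C2" "C2 \<subseteq> A" "measure (distr ?N borel (\<lambda>x. x)) (A - C2) < e"
      using finite_borel_inner_compact[OF N.finite_measure_distr[OF idP(2)] _ A(1) e] by auto
    have b: "C1 \<in> sets borel" "C2 \<in> sets borel" using C1 C2 by (auto simp: borel_compact)
    have PN: "X \<in> sets ?P" "X \<in> sets ?N" if "X \<in> sets borel" "X \<subseteq> K" for X
      using that setsPN Kb by (auto simp: sets_restrict_space_iff)
    have C1': "measure ?P (A - C1) < e"
      using C1 A b setsPN by (subst (asm) measure_distr[OF idP(1)]) (auto simp: Int_absorb2[OF order_trans[OF Diff_subset A(2)]])
    have C2': "measure ?N (A - C2) < e"
      using C2 A b setsPN by (subst (asm) measure_distr[OF idP(2)]) (auto simp: Int_absorb2[OF order_trans[OF Diff_subset A(2)]])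
    \<comment> \<open>The union of the two compact sets is a compact subset of the null set
      \<open>A\<close> and has content 0, so \<open>?X\<close> carries all of
      \<open>\<sigma> A\<close>; each variation of \<open>?X\<close> is below
      \<open>e\<close>.\<close>
    let ?X = "A - (C1 \<union> C2)"
    have X: "?X \<in> sets borel" "?X \<subseteq> K" using A b by auto
    have "\<sigma> ?X = \<sigma> A - \<sigma> (C1 \<union> C2)"
      using A b C1 C2 by (intro signed_on_Diff[OF \<sigma>]) auto
    moreover have "\<sigma> (C1 \<union> C2) = 0" using C1 C2 by (intro zero compact_Un) auto
    moreover have "\<sigma> ?X = measure ?P ?X - measure ?N ?X"
      by (rule measure_pos_part_diff[OF \<sigma> Kb(1) X])
    moreover have "measure ?P ?X \<le> measure ?P (A - C1)"
      using A b by (intro P.finite_measure_mono PN) auto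
    moreover have "measure ?N ?X \<le> measure ?N (A - C2)"
      using A b by (intro N.finite_measure_mono PN) auto
    moreover have "0 \<le> measure ?P ?X" "0 \<le> measure ?N ?X" by auto
    ultimately show ?thesis using C1' C2' by linarith
  qed
  from this[of "\<bar>\<sigma> A\<bar> / 4"] show ?thesis by (cases "\<sigma> A = 0") auto
qed

section \<open>Classical gradients are weak gradients\<close>

lemma GDERIV_unique: "GDERIV f x :> D \<Longrightarrow> GDERIV f x :> D' \<Longrightarrow> D = D'"
  unfolding gderiv_def by (metis has_derivative_unique inner_commute vector_eq_rdot)

lemma gradient_eq: "GDERIV f x :> D \<Longrightarrow> gradient f x = D"
  unfolding gradient_def by (blast intro: the_equality GDERIV_unique)

lemma GDERIV_gradient:
  fixes f :: "'a::euclidean_space \<Rightarrow> real"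
  assumes "f differentiable (at x)"
  shows "GDERIV f x :> gradient f x"
proof -
  obtain F where F: "(f has_derivative F) (at x)" using assms by (auto simp: differentiable_def)
  interpret F: bounded_linear F by (rule has_derivative_bounded_linear[OF F])
  define D where "D = (\<Sum>b\<in>Basis. F b *\<^sub>R b)"
  have "F = (\<lambda>h. h \<bullet> D)"
  proof
    fix h
    have "F h = F (\<Sum>b\<in>Basis. (h \<bullet> b) *\<^sub>R b)" by (simp add: euclidean_representation)
    also have "\<dots> = (\<Sum>b\<in>Basis. (h \<bullet> b) * F b)" by (simp add: F.sum F.scaleR)
    also have "\<dots> = h \<bullet> D" by (simp add: D_def inner_sum_right mult.commute)
    finally show "F h = h \<bullet> D" .
  qed
  with F have "GDERIV f x :> D" by (simp add: gderiv_def)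
  then show ?thesis using gradient_eq by metis
qed

lemma GDERIV_shift: "GDERIV f (y - c) :> D \<Longrightarrow> GDERIV (\<lambda>y. f (y - c)) y :> D"
  unfolding gderiv_def
  by (rule has_derivative_compose[of "\<lambda>y. y - c" "\<lambda>h. h"]) (auto intro!: derivative_eq_intros)

text \<open>With an equivalence, the definite descriptions behind the two gradients coincide by
  rewriting.\<close>

lemma GDERIV_shift_iff: "GDERIV (\<lambda>y. f (y - c)) y :> D \<longleftrightarrow> GDERIV f (y - c) :> D"
  using GDERIV_shift[of "\<lambda>y. f (y - c)" "y - c" "- c" D] GDERIV_shift[of f y c D] by auto

lemma C_k_shift:
  fixes f :: "'a::euclidean_space \<Rightarrow> real"
  shows "C_k k f \<Longrightarrow> C_k k (\<lambda>y. f (y - c))"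
proof (induction k arbitrary: f)
  case 0
  then show ?case by (auto intro!: continuous_intros intro: continuous_on_compose2)
next
  case (Suc k)
  have g: "gradient (\<lambda>y. f (y - c)) y = gradient f (y - c)" for y
    unfolding gradient_def GDERIV_shift_iff ..
  have "(\<lambda>y. f (y - c)) differentiable (at y)" for y
    using GDERIV_shift[OF GDERIV_gradient[of f "y - c"]] Suc.prems
    by (auto simp: differentiable_def gderiv_def)
  moreover have "C_k k (\<lambda>y. gradient f (y - c) \<bullet> b)" if "b \<in> Basis" for b
    using Suc.IH[of "\<lambda>y. gradient f y \<bullet> b"] Suc.prems that by simp
  ultimately show ?case by (simp add: g)
qed

lemma supp_shift: "supp (\<lambda>y. f (y - c)) = (+) c ` supp f"
proof -
  have "{y. f (y - c) \<noteq> 0} = (+) c ` {y. f y \<noteq> 0}"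
    by (auto simp: image_iff intro!: exI[of _ "_ - c"])
  then show ?thesis by (simp add: supp_def closure_translation)
qed

lemma Cc_infty_shift:
  assumes "f \<in> Cc_infty UNIV" "(+) c ` supp f \<subseteq> U"
  shows "(\<lambda>y. f (y - c)) \<in> Cc_infty U"
  using assms unfolding Cc_infty_def by (auto simp: supp_shift intro: C_k_shift compact_translation)

lemma not_in_supp: "x \<notin> supp f \<Longrightarrow> f x = 0"
  unfolding supp_def using closure_subset[of "{x. f x \<noteq> 0}"] by auto

lemma
  assumes "\<psi> \<in> Cc_infty U"
  shows Cc_infty_GDERIV: "GDERIV \<psi> x :> gradient \<psi> x"
    and Cc_infty_continuous: "continuous_on S \<psi>"
    and Cc_infty_continuous_gradient: "continuous_on S (gradient \<psi>)"
    and Cc_infty_supp: "compact (supp \<psi>)" "supp \<psi> \<subseteq> U"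
    and Cc_infty_bounded: "\<exists>B. \<forall>x. \<bar>\<psi> x\<bar> \<le> B" "\<exists>B. \<forall>x. norm (gradient \<psi> x) \<le> B"
proof -
  have k: "C_k (Suc 0) \<psi>" "C_k 0 \<psi>" using assms unfolding Cc_infty_def by blast+
  show s: "compact (supp \<psi>)" "supp \<psi> \<subseteq> U" using assms unfolding Cc_infty_def by auto
  show "GDERIV \<psi> x :> gradient \<psi> x" for x using k by (intro GDERIV_gradient) simp
  show c: "continuous_on S \<psi>" for S using k by (auto intro: continuous_on_subset)
  show g: "continuous_on S (gradient \<psi>)" for S
  proof -
    have "continuous_on UNIV (gradient \<psi>)"
      using k by (intro continuous_on_componentwise[THEN iffD2]) simp
    then show ?thesis by (rule continuous_on_subset) simp
  qed
  \<comment> \<open>The complement of the support is open and the function vanishes on it; hence its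
    gradient is bounded globally and not only on the support.\<close>
  have z: "gradient \<psi> x = 0" if "x \<notin> supp \<psi>" for x
  proof (rule gradient_eq)
    have "open (- supp \<psi>)" using s by (simp add: compact_imp_closed open_Compl)
    then show "GDERIV \<psi> x :> 0"
      unfolding gderiv_def inner_zero_right
      by (rule has_derivative_transform_within_open[OF has_derivative_const])
        (use that not_in_supp[of _ \<psi>] in auto)
  qed
  obtain B where B: "\<And>x. x \<in> supp \<psi> \<Longrightarrow> \<bar>\<psi> x\<bar> \<le> B"
    using compact_imp_bounded[OF compact_continuous_image[OF c s(1)]] by (auto simp: bounded_iff)
  have "\<bar>\<psi> x\<bar> \<le> max B 0" for x
    using B[of x] not_in_supp[of x \<psi>] by (cases "x \<in> supp \<psi>") auto
  then show "\<exists>B. \<forall>x. \<bar>\<psi> x\<bar> \<le> B" by blast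
  obtain B where B: "\<And>x. x \<in> supp \<psi> \<Longrightarrow> norm (gradient \<psi> x) \<le> B"
    using compact_imp_bounded[OF compact_continuous_image[OF g s(1)]] by (auto simp: bounded_iff)
  have "norm (gradient \<psi> x) \<le> max B 0" for x
    using B[of x] z[of x] by (cases "x \<in> supp \<psi>") auto
  then show "\<exists>B. \<forall>x. norm (gradient \<psi> x) \<le> B" by blast
qed

section \<open>Translation invariance and integration by parts\<close>

lemma
  fixes f :: "'a::euclidean_space \<Rightarrow> real"
  assumes "f \<in> borel_measurable borel"
  shows lborel_integral_shift: "(LINT x|lborel. f (c + x)) = (LINT x|lborel. f x)"
    and lborel_integrable_shift: "integrable lborel f \<Longrightarrow> integrable lborel (\<lambda>x. f (c + x))"
proof -
  have "(LINT x|distr lborel borel ((+) c). f x) = (LINT x|lborel. f (c + x))"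
    using assms by (intro integral_distr) auto
  then show "(LINT x|lborel. f (c + x)) = (LINT x|lborel. f x)" by (simp add: lborel_distr_plus)
  have "integrable (distr lborel borel ((+) c)) f \<longleftrightarrow> integrable lborel (\<lambda>x. f (c + x))"
    using assms by (intro integrable_distr_eq) auto
  then show "integrable lborel f \<Longrightarrow> integrable lborel (\<lambda>x. f (c + x))" by (simp add: lborel_distr_plus)
qed

lemma GDERIV_line:
  assumes "GDERIV h (x + t *\<^sub>R b) :> D"
  shows "((\<lambda>t. h (x + t *\<^sub>R b)) has_real_derivative D \<bullet> b) (at t)"
  unfolding has_field_derivative_def
  by (rule has_derivative_eq_rhs,
      rule has_derivative_compose[of "\<lambda>t. x + t *\<^sub>R b" "\<lambda>t. t *\<^sub>R b", OF _ assms[unfolded gderiv_def]])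
    (auto intro!: derivative_eq_intros simp: inner_commute mult.commute)

lemma compactly_supported_integrable:
  fixes f :: "'a::euclidean_space \<Rightarrow> real"
  assumes "f \<in> borel_measurable borel" "compact C" "\<And>x. x \<notin> C \<Longrightarrow> f x = 0" "\<And>x. \<bar>f x\<bar> \<le> B"
  shows "integrable lborel f"
proof (rule Bochner_Integration.integrable_bound)
  have "emeasure lborel C < \<infinity>" using assms emeasure_bounded_finite compact_imp_bounded by auto
  then show "integrable lborel (\<lambda>x. B * indicator C x)"
    using assms(2) by (simp add: borel_compact)
  show "AE x in lborel. norm (f x) \<le> norm (B * indicator C x)"
  proof (intro AE_I2)
    fix x show "norm (f x) \<le> norm (B * indicator C x)"
      using assms(3)[of x] assms(4)[of x] by (auto simp: indicator_def)
  qed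
qed (use assms in auto)

text \<open>The difference quotients of \<open>h\<close> in direction \<open>b\<close> have integral 0 by translation invariance,
  and they converge boundedly to the directional derivative.\<close>

lemma integral_directional_derivative_zero:
  fixes h :: "'a::euclidean_space \<Rightarrow> real"
  assumes D: "\<And>x. GDERIV h x :> D x" and B: "\<And>x. norm (D x) \<le> B"
    and C: "compact C" "\<And>x. x \<notin> C \<Longrightarrow> h x = 0"
  shows "(LINT x|lborel. D x \<bullet> b) = 0" and "(\<lambda>x. D x \<bullet> b) \<in> borel_measurable borel"
proof -
  have B0: "0 \<le> B" using norm_ge_zero B order_trans by blast
  have hc: "continuous_on UNIV h"
    using D unfolding gderiv_def by (meson continuous_at_imp_continuous_on has_derivative_continuous)
  have hm[measurable]: "h \<in> borel_measurable borel" by (rule borel_measurable_continuous_onI[OF hc])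
  define t where "t n = inverse (real (Suc n))" for n
  have t: "0 < t n" "t n \<le> 1" for n by (auto simp: t_def inverse_le_1_iff)
  have t0: "t \<longlonglongrightarrow> 0" unfolding t_def by (rule LIMSEQ_inverse_real_of_nat)
  define q where "q n x = (h (x + t n *\<^sub>R b) - h x) / t n" for n x
  have qm[measurable]: "q n \<in> borel_measurable borel" for n unfolding q_def by measurable
  have qlim: "(\<lambda>n. q n x) \<longlonglongrightarrow> D x \<bullet> b" for x
  proof -
    have "((\<lambda>t. h (x + t *\<^sub>R b)) has_real_derivative D x \<bullet> b) (at 0)"
      using D by (intro GDERIV_line) simp
    then have "((\<lambda>t. (h (x + t *\<^sub>R b) - h x) / t) \<longlongrightarrow> D x \<bullet> b) (at 0)"
      by (simp add: DERIV_def)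
    moreover have "filterlim t (at 0) sequentially"
      using t0 t(1) by (intro filterlim_atI) (auto intro: always_eventually simp: less_imp_neq[symmetric])
    ultimately show ?thesis unfolding q_def by (rule filterlim_compose)
  qed
  \<comment> \<open>The mean value theorem on the segment turns the bound on the gradient into a
    bound on all difference quotients, independent of \<open>n\<close>.\<close>
  have qb: "\<bar>q n x\<bar> \<le> B * norm b" for n x
  proof -
    have "\<exists>z>0. z < t n \<and> h (x + t n *\<^sub>R b) - h (x + 0 *\<^sub>R b) = (t n - 0) * (D (x + z *\<^sub>R b) \<bullet> b)"
      using D t(1) by (intro MVT2 GDERIV_line) auto
    then obtain z where "q n x = D (x + z *\<^sub>R b) \<bullet> b" using t(1)[of n] by (auto simp: q_def)
    also have "\<bar>\<dots>\<bar> \<le> norm (D (x + z *\<^sub>R b)) * norm b" by (rule Cauchy_Schwarz_ineq2)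
    also have "\<dots> \<le> B * norm b" using B by (intro mult_right_mono) auto
    finally show ?thesis .
  qed
  obtain R where R: "\<And>x. x \<in> C \<Longrightarrow> norm x \<le> R"
    using compact_imp_bounded[OF C(1)] by (auto simp: bounded_iff)
  \<comment> \<open>Since \<open>t n \<le> 1\<close>, a shift by \<open>t n *\<^sub>R b\<close>
    moves points by at most \<open>norm b\<close>; this ball contains the supports of all difference
    quotients.\<close>
  let ?C = "cball (0::'a) (R + norm b)"
  have h0: "h y = 0" if "R < norm y" for y using C(2) R that by force
  have q0: "q n x = 0" if "x \<notin> ?C" for n x
  proof -
    have x: "R + norm b < norm x" using that by simp
    have "norm x \<le> norm (x + t n *\<^sub>R b) + norm (t n *\<^sub>R b)" using norm_triangle_ineq4[of "x + t n *\<^sub>R b" "t n *\<^sub>R b"] by simp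
    moreover have "norm (t n *\<^sub>R b) \<le> norm b" using t[of n] by (simp add: mult_left_le_one_le)
    ultimately have "h (x + t n *\<^sub>R b) = 0" using x by (intro h0) auto
    moreover have "h x = 0" using x norm_ge_zero[of b] by (intro h0) linarith
    ultimately show ?thesis by (simp add: q_def)
  qed
  obtain Bh where Bh: "\<And>x. x \<in> C \<Longrightarrow> \<bar>h x\<bar> \<le> Bh"
    using compact_imp_bounded[OF compact_continuous_image[OF continuous_on_subset[OF hc] C(1)]]
    by (auto simp: bounded_iff)
  have hint: "integrable lborel h"
  proof (rule compactly_supported_integrable[OF hm C])
    show "\<bar>h x\<bar> \<le> max Bh 0" for x using Bh[of x] C(2)[of x] by (cases "x \<in> C") auto
  qed
  have qint: "(LINT x|lborel. q n x) = 0" for n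
  proof -
    have "(LINT x|lborel. q n x) = (LINT x|lborel. h (t n *\<^sub>R b + x) - h x) / t n"
      by (simp add: q_def add.commute)
    also have "(LINT x|lborel. h (t n *\<^sub>R b + x) - h x) = (LINT x|lborel. h (t n *\<^sub>R b + x)) - (LINT x|lborel. h x)"
      using hint lborel_integrable_shift[OF hm hint] by (intro Bochner_Integration.integral_diff)
    also have "\<dots> = 0" by (simp add: lborel_integral_shift[OF hm])
    finally show ?thesis by simp
  qed
  show m: "(\<lambda>x. D x \<bullet> b) \<in> borel_measurable borel"
    by (rule borel_measurable_LIMSEQ_real[OF qlim qm])
  have "emeasure lborel ?C < \<infinity>" by (intro emeasure_bounded_finite) auto
  then have wi: "integrable lborel (\<lambda>x. B * norm b * indicator ?C x)"
    by (intro integrable_mult_right) (simp add: integrable_indicator_iff)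
  have "(\<lambda>n. LINT x|lborel. q n x) \<longlonglongrightarrow> (LINT x|lborel. D x \<bullet> b)"
  proof (rule integral_dominated_convergence[OF _ _ wi])
    show "AE x in lborel. norm (q n x) \<le> B * norm b * indicator ?C x" for n
    proof (intro AE_I2)
      fix x show "norm (q n x) \<le> B * norm b * indicator ?C x"
        using qb[of n x] q0[of x n] by (cases "x \<in> ?C") auto
    qed
  qed (use m qlim in \<open>auto intro: AE_I2\<close>)
  then show "(LINT x|lborel. D x \<bullet> b) = 0"
    by (simp add: qint LIMSEQ_const_iff)
qed

text \<open>The product with a test function, extended by 0, is differentiable everywhere because
  the support stays away from the frontier. Its directional derivatives therefore integrate to 0,
  and the product rule splits them into the two sides of the formula.\<close>

lemma C1_is_weak_gradient:
  fixes K :: "'a::euclidean_space set"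
  assumes K: "compact K" and \<phi>: "continuous_on K \<phi>" and g: "continuous_on K g"
    and D: "\<And>x. x \<in> interior K \<Longrightarrow> GDERIV \<phi> x :> g x"
  shows "is_weak_gradient (interior K) \<phi> g"
proof -
  let ?U = "interior K"
  have U: "open ?U" "?U \<subseteq> K" "bounded ?U" "?U \<in> sets lebesgue"
    using K by (auto simp: interior_subset compact_imp_bounded intro: bounded_subset)
  obtain B1 where B1: "\<And>x. x \<in> K \<Longrightarrow> \<bar>\<phi> x\<bar> \<le> B1"
    using compact_imp_bounded[OF compact_continuous_image[OF \<phi> K]] by (auto simp: bounded_iff)
  obtain B2 where B2: "\<And>x. x \<in> K \<Longrightarrow> norm (g x) \<le> B2"
    using compact_imp_bounded[OF compact_continuous_image[OF g K]] by (auto simp: bounded_iff)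
  have loc: "locally_integrable ?U f" if f: "continuous_on K f" for f :: "'a \<Rightarrow> 'c::euclidean_space"
    unfolding locally_integrable_def
  proof (intro allI impI)
    fix C assume C: "compact C \<and> C \<subseteq> ?U"
    then have Cs: "C \<in> sets lebesgue" "bounded C" "C \<subseteq> K"
      using U by (auto simp: borel_compact compact_imp_bounded)
    have cf: "continuous_on C f" by (rule continuous_on_subset[OF f Cs(3)])
    obtain B where "\<And>x. x \<in> C \<Longrightarrow> norm (f x) \<le> B"
      using compact_imp_bounded[OF compact_continuous_image[OF cf]] C by (auto simp: bounded_iff)
    then show "integrable (lebesgue_on C) f"
      by (rule integrable_bounded_lebesgue_on[OF Cs(1,2) continuous_imp_measurable_on_sets_lebesgue[OF cf Cs(1)]])
  qed
  have parts: "(LINT x|lebesgue_on ?U. \<phi> x *\<^sub>R gradient \<psi> x) = - (LINT x|lebesgue_on ?U. \<psi> x *\<^sub>R g x)"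
    if \<psi>: "\<psi> \<in> Cc_infty ?U" for \<psi>
  proof -
    obtain P1 P2 where P: "\<And>x. \<bar>\<psi> x\<bar> \<le> P1" "\<And>x. norm (gradient \<psi> x) \<le> P2"
      using Cc_infty_bounded[OF \<psi>] by blast
    define h where "h x = (if x \<in> ?U then \<phi> x * \<psi> x else 0)" for x
    define E where "E x = (if x \<in> ?U then \<phi> x *\<^sub>R gradient \<psi> x + \<psi> x *\<^sub>R g x else 0)" for x
    have hE: "GDERIV h x :> E x" for x
    proof (cases "x \<in> ?U")
      case True
      have "GDERIV (\<lambda>x. \<phi> x * \<psi> x) x :> E x"
        using GDERIV_mult[OF D[OF True] Cc_infty_GDERIV[OF \<psi>, of x]] True by (simp add: E_def)
      then show ?thesis unfolding gderiv_def
        by (rule has_derivative_transform_within_open[OF _ U(1) True]) (simp add: h_def)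
    next
      case False
      have "open (- supp \<psi>)" using Cc_infty_supp[OF \<psi>] by (simp add: compact_imp_closed open_Compl)
      moreover have "x \<in> - supp \<psi>" using False Cc_infty_supp[OF \<psi>] by auto
      moreover have "0 = h y" if "y \<in> - supp \<psi>" for y
        using that not_in_supp[of y \<psi>] by (simp add: h_def)
      ultimately have "(h has_derivative (\<lambda>_. 0)) (at x)"
        by (rule has_derivative_transform_within_open[OF has_derivative_const])
      then show ?thesis using False by (simp add: gderiv_def E_def)
    qed
    have EB: "norm (E x) \<le> \<bar>B1\<bar> * \<bar>P2\<bar> + \<bar>P1\<bar> * \<bar>B2\<bar>" for x
    proof (cases "x \<in> ?U")
      case True
      then have x: "x \<in> K" using U by auto
      have "norm (E x) \<le> \<bar>\<phi> x\<bar> * norm (gradient \<psi> x) + \<bar>\<psi> x\<bar> * norm (g x)"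
        using True norm_triangle_ineq[of "\<phi> x *\<^sub>R gradient \<psi> x" "\<psi> x *\<^sub>R g x"] by (simp add: E_def)
      also have "\<dots> \<le> \<bar>B1\<bar> * \<bar>P2\<bar> + \<bar>P1\<bar> * \<bar>B2\<bar>"
        using B1[OF x] B2[OF x] P[of x] by (intro add_mono mult_mono) auto
      finally show ?thesis .
    qed (simp add: E_def)
    have h0: "h x = 0" if "x \<notin> supp \<psi>" for x using not_in_supp[OF that] by (simp add: h_def)
    note zero = integral_directional_derivative_zero[OF hE EB Cc_infty_supp(1)[OF \<psi>] h0]
    have m: "\<phi> \<in> borel_measurable (lebesgue_on ?U)" "g \<in> borel_measurable (lebesgue_on ?U)"
       "\<psi> \<in> borel_measurable (lebesgue_on ?U)" "gradient \<psi> \<in> borel_measurable (lebesgue_on ?U)"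
      using continuous_on_subset[OF \<phi> U(2)] continuous_on_subset[OF g U(2)] U(4)
        Cc_infty_continuous[OF \<psi>] Cc_infty_continuous_gradient[OF \<psi>]
      by (simp_all add: continuous_imp_measurable_on_sets_lebesgue)
    have i1: "integrable (lebesgue_on ?U) (\<lambda>x. \<phi> x *\<^sub>R gradient \<psi> x)"
    proof (rule integrable_bounded_lebesgue_on[OF U(4,3)])
      show "norm (\<phi> x *\<^sub>R gradient \<psi> x) \<le> \<bar>B1\<bar> * \<bar>P2\<bar>" if "x \<in> ?U" for x
        using B1[of x] P(2)[of x] U(2) that by (auto intro!: mult_mono)
    qed (use m in measurable)
    have i2: "integrable (lebesgue_on ?U) (\<lambda>x. \<psi> x *\<^sub>R g x)"
    proof (rule integrable_bounded_lebesgue_on[OF U(4,3)])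
      show "norm (\<psi> x *\<^sub>R g x) \<le> \<bar>P1\<bar> * \<bar>B2\<bar>" if "x \<in> ?U" for x
        using B2[of x] P(1)[of x] U(2) that by (auto intro!: mult_mono)
    qed (use m in measurable)
    have "(LINT x|lebesgue_on ?U. \<phi> x *\<^sub>R gradient \<psi> x) + (LINT x|lebesgue_on ?U. \<psi> x *\<^sub>R g x) = 0"
    proof (rule euclidean_eqI)
      fix b :: 'a
      have "(LINT x|lebesgue_on ?U. \<phi> x *\<^sub>R gradient \<psi> x + \<psi> x *\<^sub>R g x) \<bullet> b
          = (LINT x|lebesgue_on ?U. (\<phi> x *\<^sub>R gradient \<psi> x + \<psi> x *\<^sub>R g x) \<bullet> b)"
        using i1 i2 by simp
      also have "\<dots> = (LINT x|lebesgue. E x \<bullet> b)"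
        using U(4) by (subst Lebesgue_Measure.integral_restrict_UNIV[symmetric])
          (auto intro!: Bochner_Integration.integral_cong simp: E_def)
      also have "\<dots> = 0" using zero by (subst integral_completion) auto
      finally show "((LINT x|lebesgue_on ?U. \<phi> x *\<^sub>R gradient \<psi> x) + (LINT x|lebesgue_on ?U. \<psi> x *\<^sub>R g x)) \<bullet> b = 0 \<bullet> b"
        using i1 i2 by simp
    qed
    then show ?thesis by (simp add: eq_neg_iff_add_eq_0)
  qed
  show ?thesis unfolding is_weak_gradient_def using loc[OF \<phi>] loc[OF g] parts by blast
qed

section \<open>Uniqueness of weak gradients\<close>

definition approx_identity :: "(nat \<Rightarrow> 'a::euclidean_space \<Rightarrow> real) \<Rightarrow> bool" where
  "approx_identity m \<longleftrightarrow>
     (\<forall>k. m k \<in> Cc_infty UNIV \<and> (\<forall>x. 0 \<le> m k x) \<and> (LINT x|lborel. m k x) = 1) \<and>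
     (\<forall>r>0. \<forall>\<^sub>F k in sequentially. supp (m k) \<subseteq> ball 0 r)"

text \<open>After the substitution \<open>z = y - x\<close>, the kernel has mass 1 near 0 and
  continuity of \<open>\<xi>\<close> at \<open>y\<close> applies. The bound uniform in
  \<open>k\<close> and \<open>y\<close> serves as domination in
  \<open>fundamental_lemma_compact\<close>.\<close>

lemma mollified_limit:
  fixes \<xi> :: "'a::euclidean_space \<Rightarrow> real"
  assumes m: "approx_identity m" and \<xi>: "continuous_on UNIV \<xi>" and B: "\<And>x. \<bar>\<xi> x\<bar> \<le> B"
  shows "(\<lambda>k. LINT x|lborel. \<xi> x * m k (y - x)) \<longlonglongrightarrow> \<xi> y"
    and "\<bar>LINT x|lborel. \<xi> x * m k (y - x)\<bar> \<le> B"
proof -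
  have \<xi>m[measurable]: "\<xi> \<in> borel_measurable borel" by (rule borel_measurable_continuous_onI[OF \<xi>])
  have mC: "m k \<in> Cc_infty UNIV" "0 \<le> m k x" "(LINT x|lborel. m k x) = 1" for k x
    using m by (auto simp: approx_identity_def)
  have mm[measurable]: "m k \<in> borel_measurable borel" for k
    by (rule borel_measurable_continuous_onI[OF Cc_infty_continuous[OF mC(1)]])
  have mi: "integrable lborel (m k)" for k
  proof -
    obtain B where "\<And>x. \<bar>m k x\<bar> \<le> B" using Cc_infty_bounded(1)[OF mC(1)] by blast
    then show ?thesis
      using not_in_supp by (intro compactly_supported_integrable[OF mm Cc_infty_supp(1)[OF mC(1)]])
  qed
  have subst: "(LINT x|lborel. \<xi> x * m k (y - x)) = (LINT z|lborel. \<xi> (y - z) * m k z)" for k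
  proof -
    \<comment> \<open>A reflection followed by a translation: the affine change of variables with
      factor -1.\<close>
    have "lborel = distr lborel borel (\<lambda>z. y - z)"
      using lborel_affine[of "-1" y] by (simp add: density_1)
    then have "(LINT x|lborel. \<xi> x * m k (y - x)) = (LINT x|distr lborel borel (\<lambda>z. y - z). \<xi> x * m k (y - x))"
      by simp
    also have "\<dots> = (LINT z|lborel. \<xi> (y - z) * m k z)"
      by (subst integral_distr) auto
    finally show ?thesis .
  qed
  have i: "integrable lborel (\<lambda>z. \<xi> (y - z) * m k z)" for k
  proof (rule Bochner_Integration.integrable_bound)
    show "integrable lborel (\<lambda>z. B * m k z)" using mi by simp
    show "AE z in lborel. norm (\<xi> (y - z) * m k z) \<le> norm (B * m k z)"
      using B order_trans[OF B abs_ge_self] by (intro AE_I2) (auto simp: abs_mult intro!: mult_right_mono)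
  qed measurable
  have "\<bar>LINT z|lborel. \<xi> (y - z) * m k z\<bar> \<le> (LINT z|lborel. \<bar>\<xi> (y - z) * m k z\<bar>)"
    by (rule integral_abs_bound)
  also have "\<dots> \<le> (LINT z|lborel. B * m k z)"
    using B mC(2) by (intro integral_mono integrable_abs[OF i] integrable_mult_right[OF mi])
      (simp add: abs_mult mult_right_mono)
  finally show "\<bar>LINT x|lborel. \<xi> x * m k (y - x)\<bar> \<le> B" by (simp add: subst mC(3))
  show "(\<lambda>k. LINT x|lborel. \<xi> x * m k (y - x)) \<longlonglongrightarrow> \<xi> y"
    unfolding subst
  proof (rule metric_LIMSEQ_I)
    fix e :: real assume e: "0 < e"
    have "isCont \<xi> y" using \<xi> by (simp add: continuous_on_eq_continuous_at)
    then obtain r where r: "0 < r" "\<And>x. dist x y < r \<Longrightarrow> dist (\<xi> x) (\<xi> y) < e / 2"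
      using e unfolding continuous_at_eps_delta by (metis half_gt_zero)
    have "\<forall>\<^sub>F k in sequentially. supp (m k) \<subseteq> ball 0 r"
      using m r(1) by (simp add: approx_identity_def)
    moreover have "dist (LINT z|lborel. \<xi> (y - z) * m k z) (\<xi> y) < e" if k: "supp (m k) \<subseteq> ball 0 r" for k
    proof -
      have le: "\<bar>\<xi> (y - z) * m k z - \<xi> y * m k z\<bar> \<le> e / 2 * m k z" for z
      proof (cases "z \<in> supp (m k)")
        case True
        then have "dist (y - z) y < r" using k by (auto simp: dist_norm)
        then have "\<bar>\<xi> (y - z) - \<xi> y\<bar> \<le> e / 2" using r(2) by (fastforce simp: dist_real_def)
        then have "\<bar>\<xi> (y - z) - \<xi> y\<bar> * m k z \<le> e / 2 * m k z" using mC(2) by (rule mult_right_mono)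
        then show ?thesis by (metis abs_mult abs_of_nonneg left_diff_distrib mC(2))
      qed (simp add: not_in_supp)
      have "(LINT z|lborel. \<xi> (y - z) * m k z) - \<xi> y = (LINT z|lborel. \<xi> (y - z) * m k z - \<xi> y * m k z)"
        using i mi by (simp add: mC(3))
      also have "\<bar>\<dots>\<bar> \<le> (LINT z|lborel. \<bar>\<xi> (y - z) * m k z - \<xi> y * m k z\<bar>)" by (rule integral_abs_bound)
      also have "\<dots> \<le> (LINT z|lborel. e / 2 * m k z)"
        using i mi le by (intro integral_mono) auto
      finally show ?thesis using e by (simp add: mC(3) dist_real_def)
    qed
    ultimately show "\<exists>N. \<forall>k\<ge>N. dist (LINT z|lborel. \<xi> (y - z) * m k z) (\<xi> y) < e"
      unfolding eventually_sequentially by blast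
  qed
qed

text \<open>By Fubini, integrating \<open>u\<close> against a mollified continuous
  \<open>\<xi>\<close> amounts to integrating \<open>\<xi> x\<close> times the integral of
  \<open>u\<close> against the kernel translated to \<open>x\<close>. For \<open>x\<close> close to
  \<open>C\<close> that translate is an admissible test function, so the result is 0. Letting the
  kernels shrink and then \<open>\<xi>\<close> tend to the indicator of \<open>C\<close> gives the
  claim.\<close>

lemma fundamental_lemma_compact:
  fixes m :: "nat \<Rightarrow> 'a::euclidean_space \<Rightarrow> real"
    and u :: "'a::euclidean_space \<Rightarrow> real"
  assumes m: "approx_identity m" and U: "open U" and u: "locally_integrable U u"
    and zero: "\<And>\<psi>. \<psi> \<in> Cc_infty U \<Longrightarrow> (LINT x|lebesgue_on U. \<psi> x * u x) = 0"
    and C: "compact C" "C \<subseteq> U"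
  shows "(LINT x|lebesgue_on C. u x) = 0"
proof (cases "C = {}")
  case False
  obtain r where r: "0 < r" "(\<Union>x\<in>C. ball x r) \<subseteq> U"
    using compact_subset_open_imp_ball_epsilon_subset[OF C(1) U C(2)] by blast
  define N where "N d = {x. infdist x C \<le> d}" for d
  have Nc: "compact (N d)" if "0 < d" for d
    unfolding N_def by (rule compact_infdist_le[OF False C(1) that])
  have NU: "N d \<subseteq> U" if "d < r" for d
  proof
    fix x assume "x \<in> N d"
    then have "infdist x C < r" using that by (simp add: N_def)
    moreover obtain c where "c \<in> C" "infdist x C = dist x c"
      using infdist_attains_inf[of C x] C(1) False compact_imp_closed by blast
    ultimately have "c \<in> C" "x \<in> ball c r" by (auto simp: dist_commute)
    then show "x \<in> U" using r(2) by blast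
  qed
  have Nadd: "x + z \<in> N (a + b)" if "x \<in> N a" "norm z \<le> b" for x z a b
    using that infdist_triangle[of "x + z" C x] by (simp add: N_def dist_norm)
  \<comment> \<open>The functions \<open>\<xi>\<close> live on \<open>C1\<close>; kernels of radius
    \<open>r / 3\<close> translated to points of \<open>C1\<close> are supported in
    \<open>C2\<close>, which is compact and still inside \<open>U\<close>.\<close>
  define C1 where "C1 = N (r / 3)"
  define C2 where "C2 = N (r / 3 + r / 3)"
  have C12: "compact C1" "compact C2" "C2 \<subseteq> U" "C1 \<subseteq> C2"
    using r(1) by (auto simp: C1_def C2_def intro!: Nc NU) (auto simp: N_def)
  have CC2: "C \<subseteq> C2" using r(1) by (auto simp: C2_def N_def)
  have Us: "U \<in> sets lebesgue" "C2 \<in> sets lebesgue" "C \<in> sets lebesgue"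
    using U C12 C by (auto simp: borel_compact)
  have uC2: "integrable lebesgue (\<lambda>x. if x \<in> C2 then u x else 0)"
    using u C12 by (intro Lebesgue_Measure.integrable_restrict_UNIV[OF Us(2), THEN iffD2])
      (simp add: locally_integrable_def)
  \<comment> \<open>A Borel version of \<open>u\<close> cut off at \<open>C2\<close>, so that Fubini
    can be used on the product of the Borel measures.\<close>
  then obtain v where v: "v \<in> borel_measurable lborel"
    "AE x in lborel. (if x \<in> C2 then u x else 0) = v x"
    using completion_ex_borel_measurable_real[of "\<lambda>x. if x \<in> C2 then u x else 0" lborel]
    by (auto dest: borel_measurable_integrable)
  have vm[measurable]: "v \<in> borel_measurable borel" using v(1) by simp
  have AEv: "AE x in lebesgue. (if x \<in> C2 then u x else 0) = v x"
    by (rule AE_completion[OF v(2)])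
  have "integrable lebesgue v"
    by (rule integrable_cong_AE_imp[OF uC2 measurable_completion[OF v(1)] AEv])
  then have vi: "integrable lborel v" using v(1) by (simp add: integrable_completion)
  have transfer: "(LINT x|lborel. f x * v x) = (LINT x|lebesgue. f x * (if x \<in> C2 then u x else 0))"
    if f: "f \<in> borel_measurable borel" for f
  proof -
    have fl: "f \<in> borel_measurable lebesgue" using f by (intro measurable_completion) simp
    have "(LINT x|lborel. f x * v x) = (LINT x|lebesgue. f x * v x)"
      using f by (intro integral_completion[symmetric]) auto
    also have "\<dots> = (LINT x|lebesgue. f x * (if x \<in> C2 then u x else 0))"
    proof (rule integral_cong_AE)
      show "AE x in lebesgue. f x * v x = f x * (if x \<in> C2 then u x else 0)"
        using AEv by eventually_elim simp
      show "(\<lambda>x. f x * v x) \<in> borel_measurable lebesgue"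
        using f by (intro measurable_completion) simp
      show "(\<lambda>x. f x * (if x \<in> C2 then u x else 0)) \<in> borel_measurable lebesgue"
        using fl borel_measurable_integrable[OF uC2] by simp
    qed
    finally show ?thesis .
  qed
  have moll0: "(LINT y|lborel. m k (y - x) * v y) = 0"
    if k: "supp (m k) \<subseteq> ball 0 (r / 3)" and x: "x \<in> C1" for k x
  proof -
    have mk: "m k \<in> Cc_infty UNIV" using m by (simp add: approx_identity_def)
    have s: "(+) x ` supp (m k) \<subseteq> C2"
    proof
      fix y assume "y \<in> (+) x ` supp (m k)"
      then obtain z where z: "z \<in> supp (m k)" "y = x + z" by auto
      then have "norm z \<le> r / 3" using k by (auto intro: less_imp_le)
      then show "y \<in> C2" using Nadd[of x "r / 3" z "r / 3"] x z by (simp add: C1_def C2_def)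
    qed
    have \<psi>: "(\<lambda>y. m k (y - x)) \<in> Cc_infty U"
      using s C12(3) by (intro Cc_infty_shift[OF mk]) auto
    have out: "m k (y - x) = 0" if "y \<notin> C2" for y
    proof (rule not_in_supp[of "y - x" "m k"])
      show "y - x \<notin> supp (m k)" using s that by (metis add_diff_cancel_left' diff_add_cancel image_subset_iff add.commute)
    qed
    have "(LINT y|lborel. m k (y - x) * v y) = (LINT y|lebesgue. m k (y - x) * (if y \<in> C2 then u y else 0))"
      by (rule transfer) (rule borel_measurable_continuous_onI[OF Cc_infty_continuous[OF \<psi>]])
    also have "\<dots> = (LINT y|lebesgue. (if y \<in> U then m k (y - x) * u y else 0))"
      using out C12(3) by (intro Bochner_Integration.integral_cong) auto
    also have "\<dots> = (LINT y|lebesgue_on U. m k (y - x) * u y)"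
      by (rule Lebesgue_Measure.integral_restrict_UNIV[OF Us(1)])
    finally show ?thesis using zero[OF \<psi>] by simp
  qed
  have \<xi>0: "(LINT x|lborel. \<xi> x * v x) = 0"
    if \<xi>: "continuous_on UNIV \<xi>" "\<And>x. \<bar>\<xi> x\<bar> \<le> 1" "\<And>x. x \<notin> C1 \<Longrightarrow> \<xi> x = 0" for \<xi> :: "'a \<Rightarrow> real"
  proof -
    have \<xi>m[measurable]: "\<xi> \<in> borel_measurable borel" by (rule borel_measurable_continuous_onI[OF \<xi>(1)])
    have \<xi>i: "integrable lborel \<xi>" by (rule compactly_supported_integrable[OF \<xi>m C12(1) \<xi>(3,2)])
    define V where "V k y = (LINT x|lborel. \<xi> x * m k (y - x))" for k y
    have Vlim: "(\<lambda>k. V k y) \<longlonglongrightarrow> \<xi> y" and Vb: "\<bar>V k y\<bar> \<le> 1" for y k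
      unfolding V_def by (rule mollified_limit[OF m \<xi>(1,2)])+
    have mm[measurable]: "m k \<in> borel_measurable borel" for k
      using m by (auto simp: approx_identity_def intro!: borel_measurable_continuous_onI[OF Cc_infty_continuous])
    have Vm[measurable]: "V k \<in> borel_measurable lborel" for k
      unfolding V_def by measurable
    have V0: "(LINT y|lborel. V k y * v y) = 0" if k: "supp (m k) \<subseteq> ball 0 (r / 3)" for k
    proof -
      let ?F = "\<lambda>(x, y). \<xi> x * m k (y - x) * v y"
      have Gi: "integrable (lborel \<Otimes>\<^sub>M lborel) (\<lambda>(x, y). \<xi> x * v y)"
      proof (rule lborel_pair.Fubini_integrable)
        show "(\<lambda>(x, y). \<xi> x * v y) \<in> borel_measurable (lborel \<Otimes>\<^sub>M lborel)" by measurable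
        show "integrable lborel (\<lambda>x. LINT y|lborel. norm (case (x, y) of (x, y) \<Rightarrow> \<xi> x * v y))"
          using \<xi>i by (simp add: abs_mult)
        show "AE x in lborel. integrable lborel (\<lambda>y. case (x, y) of (x, y) \<Rightarrow> \<xi> x * v y)"
          using vi by (intro AE_I2) simp
      qed
      have mk: "m k \<in> Cc_infty UNIV" using m by (simp add: approx_identity_def)
      obtain B where B: "\<And>x. \<bar>m k x\<bar> \<le> B" using Cc_infty_bounded(1)[OF mk] by blast
      have Fi: "integrable (lborel \<Otimes>\<^sub>M lborel) ?F"
      proof (rule Bochner_Integration.integrable_bound)
        show "integrable (lborel \<Otimes>\<^sub>M lborel) (\<lambda>p. B * (case p of (x, y) \<Rightarrow> \<xi> x * v y))"
          using Gi by (rule integrable_mult_right)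
        show "?F \<in> borel_measurable (lborel \<Otimes>\<^sub>M lborel)" by measurable
        show "AE p in lborel \<Otimes>\<^sub>M lborel. norm (?F p) \<le> norm (B * (case p of (x, y) \<Rightarrow> \<xi> x * v y))"
        proof (intro AE_I2)
          fix p :: "'a \<times> 'a"
          obtain x y where p: "p = (x, y)" by (cases p)
          have "\<bar>\<xi> x\<bar> * \<bar>m k (y - x)\<bar> * \<bar>v y\<bar> \<le> \<bar>\<xi> x\<bar> * \<bar>B\<bar> * \<bar>v y\<bar>"
            using B[of "y - x"] by (intro mult_right_mono mult_left_mono) auto
          then show "norm (?F p) \<le> norm (B * (case p of (x, y) \<Rightarrow> \<xi> x * v y))"
            by (simp add: p abs_mult mult_ac)
        qed
      qed
      have "(LINT y|lborel. V k y * v y) = (LINT y|lborel. LINT x|lborel. \<xi> x * m k (y - x) * v y)"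
        by (simp add: V_def)
      also have "\<dots> = (LINT x|lborel. LINT y|lborel. \<xi> x * m k (y - x) * v y)"
        using lborel_pair.Fubini_integral[OF Fi] by simp
      also have "\<dots> = (LINT x|lborel. \<xi> x * (LINT y|lborel. m k (y - x) * v y))"
        by (simp add: mult.assoc)
      also have "(\<lambda>x. \<xi> x * (LINT y|lborel. m k (y - x) * v y)) = (\<lambda>x. 0)"
      proof
        fix x show "\<xi> x * (LINT y|lborel. m k (y - x) * v y) = 0"
          using moll0[OF k, of x] \<xi>(3)[of x] by (cases "x \<in> C1") auto
      qed
      finally show ?thesis by simp
    qed
    have "(\<lambda>k. LINT y|lborel. V k y * v y) \<longlonglongrightarrow> (LINT y|lborel. \<xi> y * v y)"
    proof (rule integral_dominated_convergence[where w="\<lambda>y. \<bar>v y\<bar>"])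
      show "AE y in lborel. (\<lambda>k. V k y * v y) \<longlonglongrightarrow> \<xi> y * v y"
        by (intro AE_I2 tendsto_intros Vlim)
      show "AE y in lborel. norm (V k y * v y) \<le> \<bar>v y\<bar>" for k
        using Vb by (intro AE_I2) (simp add: abs_mult mult_left_le_one_le)
    qed (use vi in auto)
    moreover have "\<forall>\<^sub>F k in sequentially. (LINT y|lborel. V k y * v y) = 0"
    proof -
      have "\<forall>\<^sub>F k in sequentially. supp (m k) \<subseteq> ball 0 (r / 3)"
        using m r(1) by (simp add: approx_identity_def)
      then show ?thesis by eventually_elim (rule V0)
    qed
    ultimately show ?thesis
      by (rule tendsto_unique[OF sequentially_bot _ tendsto_eventually])
  qed
  \<comment> \<open>The extra slope \<open>3 / r\<close> makes every member, including
    \<open>n = 0\<close>, vanish at distance \<open>r / 3\<close> from \<open>C\<close>, that is,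
    outside \<open>C1\<close>.\<close>
  define \<xi> where "\<xi> n x = max 0 (1 - (3 / r + real n) * infdist x C)" for n :: nat and x
  have lim: "(\<lambda>n. \<xi> n x) \<longlonglongrightarrow> indicator C x" for x
  proof -
    obtain n0 where n0: "3 / r \<le> real n0" using real_arch_simple by blast
    show ?thesis
    proof (cases "x \<in> C")
      case True then show ?thesis by (simp add: \<xi>_def)
    next
      case xC: False
      show ?thesis
      proof (rule tendsto_sandwich[OF _ _ tendsto_const compact_indicator_limit[OF C(1) False]])
        show "\<forall>\<^sub>F n in sequentially. indicator C x \<le> \<xi> n x" using xC by (simp add: \<xi>_def)
        show "\<forall>\<^sub>F n in sequentially. \<xi> n x \<le> max 0 (1 - real n * infdist x C)"
        proof (intro always_eventually allI)
          fix n
          have "real n * infdist x C \<le> (3 / r + real n) * infdist x C"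
            using r(1) infdist_nonneg[of x C] by (intro mult_right_mono) auto
          then show "\<xi> n x \<le> max 0 (1 - real n * infdist x C)" by (auto simp: \<xi>_def)
        qed
      qed
    qed
  qed
  have \<xi>b: "\<bar>\<xi> n x\<bar> \<le> 1" for n x
    using r(1) infdist_nonneg[of x C] by (auto simp: \<xi>_def)
  have \<xi>c: "continuous_on UNIV (\<xi> n)" for n unfolding \<xi>_def by (intro continuous_intros)
  have \<xi>C1: "\<xi> n x = 0" if "x \<notin> C1" for n x
  proof -
    have "r / 3 < infdist x C" using that by (simp add: C1_def N_def)
    then have "1 < 3 / r * infdist x C" using r(1) by (simp add: field_simps)
    also have "\<dots> \<le> (3 / r + real n) * infdist x C"
      using infdist_nonneg[of x C] by (intro mult_right_mono) auto
    finally show ?thesis by (simp add: \<xi>_def)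
  qed
  have Cb: "C \<in> sets borel" using C by (simp add: borel_compact)
  have "(\<lambda>n. LINT x|lborel. \<xi> n x * v x) \<longlonglongrightarrow> (LINT x|lborel. indicator C x * v x)"
  proof (rule integral_dominated_convergence[where w="\<lambda>y. \<bar>v y\<bar>"])
    show "AE x in lborel. (\<lambda>n. \<xi> n x * v x) \<longlonglongrightarrow> indicator C x * v x"
      by (intro AE_I2 tendsto_intros lim)
    show "AE x in lborel. norm (\<xi> n x * v x) \<le> \<bar>v x\<bar>" for n
      using \<xi>b by (intro AE_I2) (simp add: abs_mult mult_left_le_one_le)
    show "(\<lambda>x. \<xi> n x * v x) \<in> borel_measurable lborel" for n
      using borel_measurable_continuous_onI[OF \<xi>c] by measurable
    show "(\<lambda>x. indicator C x * v x) \<in> borel_measurable lborel" using Cb by measurable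
  qed (use vi in auto)
  then have "(LINT x|lborel. indicator C x * v x) = 0"
    by (simp add: \<xi>0[OF \<xi>c \<xi>b \<xi>C1] LIMSEQ_const_iff)
  then have "(LINT x|lebesgue. indicator C x * (if x \<in> C2 then u x else 0)) = 0"
    using transfer[of "indicator C"] Cb by simp
  moreover have "(\<lambda>x. indicator C x * (if x \<in> C2 then u x else 0)) = (\<lambda>x. if x \<in> C then u x else 0)"
    using CC2 by (intro ext) (auto simp: indicator_def)
  ultimately show ?thesis using Us(3) by (simp add: Lebesgue_Measure.integral_restrict_UNIV)
qed simp

text \<open>Local integrability gives measurability only on compact sets, so \<open>U\<close> is
  exhausted by countably many of them.\<close>

lemma locally_integrable_AE_zero:
  fixes u :: "'a::euclidean_space \<Rightarrow> real"
  assumes U: "open U" and u: "locally_integrable U u"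
    and zero: "\<And>C. compact C \<Longrightarrow> C \<subseteq> U \<Longrightarrow> (LINT x|lebesgue_on C. u x) = 0"
  shows "AE x in lebesgue_on U. u x = 0"
proof -
  obtain F :: "nat \<Rightarrow> 'a set" where F: "\<And>n. compact (F n)" "\<And>n. F n \<subseteq> U" "(\<Union>n. F n) = U"
    using open_Union_compact_subsets[OF U] by metis
  have "AE x in lebesgue. x \<in> F n \<longrightarrow> u x = 0" for n
  proof -
    have Fs: "F n \<in> sets lebesgue" using F(1) by (simp add: borel_compact)
    have "AE x in lebesgue_on (F n). u x = 0"
    proof (rule AE_zero_if_compact_integrals_zero[OF Fs])
      show "u \<in> borel_measurable (lebesgue_on (F n))"
        using u F by (auto simp: locally_integrable_def dest: borel_measurable_integrable)
      fix C assume C: "compact C" "C \<subseteq> F n"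
      then have "C \<subseteq> U" using F(2) by blast
      then show "integrable (lebesgue_on C) u" "(LINT x|lebesgue_on C. u x) = 0"
        using u zero C by (auto simp: locally_integrable_def)
    qed
    then show ?thesis using Fs by (simp add: AE_restrict_space_iff)
  qed
  then have "AE x in lebesgue. \<forall>n. x \<in> F n \<longrightarrow> u x = 0" by (subst AE_all_countable) blast
  then have "AE x in lebesgue. x \<in> U \<longrightarrow> u x = 0"
    by eventually_elim (use F(3) in blast)
  then show ?thesis using U by (simp add: AE_restrict_space_iff)
qed

lemma Cc_infty_scaleR_integrable:
  fixes f :: "'a::euclidean_space \<Rightarrow> 'b::euclidean_space"
  assumes \<psi>: "\<psi> \<in> Cc_infty U" and U: "open U" and f: "locally_integrable U f"
  shows "integrable (lebesgue_on U) (\<lambda>x. \<psi> x *\<^sub>R f x)"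
proof -
  let ?S = "supp \<psi>"
  have S: "compact ?S" "?S \<subseteq> U" using Cc_infty_supp[OF \<psi>] by auto
  have Ss: "?S \<in> sets lebesgue" "U \<in> sets lebesgue" using S U by (auto simp: borel_compact)
  have fS: "integrable (lebesgue_on ?S) f" using f S by (simp add: locally_integrable_def)
  obtain B where B: "\<And>x. \<bar>\<psi> x\<bar> \<le> B" using Cc_infty_bounded(1)[OF \<psi>] by blast
  have "integrable (lebesgue_on ?S) (\<lambda>x. \<psi> x *\<^sub>R f x)"
  proof (rule Bochner_Integration.integrable_bound)
    show "integrable (lebesgue_on ?S) (\<lambda>x. B *\<^sub>R f x)" using fS by simp
    have "\<psi> \<in> borel_measurable (lebesgue_on ?S)"
      using Cc_infty_continuous[OF \<psi>] by simp
    then show "(\<lambda>x. \<psi> x *\<^sub>R f x) \<in> borel_measurable (lebesgue_on ?S)"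
      using borel_measurable_integrable[OF fS] by measurable
    show "AE x in lebesgue_on ?S. norm (\<psi> x *\<^sub>R f x) \<le> norm (B *\<^sub>R f x)"
      using B order_trans[OF B abs_ge_self] by (intro AE_I2) (auto intro!: mult_right_mono)
  qed
  then have "integrable lebesgue (\<lambda>x. if x \<in> ?S then \<psi> x *\<^sub>R f x else 0)"
    by (rule Lebesgue_Measure.integrable_restrict_UNIV[OF Ss(1), THEN iffD2])
  moreover have "(\<lambda>x. if x \<in> ?S then \<psi> x *\<^sub>R f x else 0) = (\<lambda>x. if x \<in> U then \<psi> x *\<^sub>R f x else 0)"
    using S(2) not_in_supp[of _ \<psi>] by (intro ext) auto
  ultimately show ?thesis by (intro Lebesgue_Measure.integrable_restrict_UNIV[OF Ss(2), THEN iffD1]) simp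
qed

text \<open>The difference of two weak gradients is orthogonal to all test functions; each
  coordinate falls under the fundamental lemma.\<close>

lemma weak_gradient_unique:
  fixes m :: "nat \<Rightarrow> 'a::euclidean_space \<Rightarrow> real"
    and v :: "'a::euclidean_space \<Rightarrow> real"
  assumes m: "approx_identity m" and U: "open U"
    and g: "is_weak_gradient U v g" and g': "is_weak_gradient U v g'"
  shows "AE x in lebesgue_on U. g x = g' x"
proof -
  have loc: "locally_integrable U g" "locally_integrable U g'" using g g' by (auto simp: is_weak_gradient_def)
  have comp: "AE x in lebesgue_on U. (g x - g' x) \<bullet> b = 0" for b
  proof (rule locally_integrable_AE_zero[OF U])
    show l: "locally_integrable U (\<lambda>x. (g x - g' x) \<bullet> b)"
      using loc unfolding locally_integrable_def
      by (intro allI impI integrable_inner_left Bochner_Integration.integrable_diff) simp_all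
    fix C assume C: "compact C" "C \<subseteq> U"
    show "(LINT x|lebesgue_on C. (g x - g' x) \<bullet> b) = 0"
    proof (rule fundamental_lemma_compact[OF m U l _ C])
      fix \<psi> assume \<psi>: "\<psi> \<in> Cc_infty U"
      note i = Cc_infty_scaleR_integrable[OF \<psi> U loc(1)] Cc_infty_scaleR_integrable[OF \<psi> U loc(2)]
      have "(LINT x|lebesgue_on U. \<psi> x *\<^sub>R g x) = (LINT x|lebesgue_on U. \<psi> x *\<^sub>R g' x)"
        using g g' \<psi> unfolding is_weak_gradient_def by simp
      then have "(LINT x|lebesgue_on U. (\<psi> x *\<^sub>R g x - \<psi> x *\<^sub>R g' x) \<bullet> b) = 0"
        using i by simp
      then show "(LINT x|lebesgue_on U. \<psi> x * ((g x - g' x) \<bullet> b)) = 0"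
        by (simp add: inner_diff_left right_diff_distrib)
    qed
  qed
  have "AE x in lebesgue_on U. \<forall>b\<in>Basis. (g x - g' x) \<bullet> b = 0"
    using comp by (intro AE_finite_allI) auto
  then show ?thesis
    by eventually_elim (metis euclidean_all_zero_iff right_minus_eq)
qed

text \<open>Ties the choice made in \<open>weak_gradient\<close> to a field that is continuous on
  the compact set, hence bounded and usable as a dual test field.\<close>

lemma C1_weak_gradient:
  fixes m :: "nat \<Rightarrow> 'a::euclidean_space \<Rightarrow> real"
    and K :: "'a::euclidean_space set"
  assumes m: "approx_identity m" and K: "compact K" and \<phi>: "\<phi> \<in> C1 K"
  obtains g where "continuous_on K g"
    "AE x in lebesgue_on (interior K). weak_gradient (interior K) \<phi> x = g x"
proof -
  obtain g where g: "continuous_on K g" "\<And>x. x \<in> interior K \<Longrightarrow> GDERIV \<phi> x :> g x"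
    and c: "continuous_on K \<phi>"
    using \<phi> unfolding C1_def by blast
  have wg: "is_weak_gradient (interior K) \<phi> g" by (rule C1_is_weak_gradient[OF K c g])
  then have "is_weak_gradient (interior K) \<phi> (weak_gradient (interior K) \<phi>)"
    unfolding weak_gradient_def by (rule someI[of "is_weak_gradient (interior K) \<phi>"])
  from weak_gradient_unique[OF m open_interior this wg] show thesis using g(1) that by blast
qed

section \<open>Densities of vector measures and the integrand\<close>

lemma radon_signed_on: "q \<in> radon K \<Longrightarrow> signed_on K (\<lambda>A. q A \<bullet> b)"
  unfolding radon_def signed_on_def
  by (auto intro!: bounded_linear.sums[OF bounded_linear_inner_left])

text \<open>Coordinate densities assemble into a vector density, so the choice in
  \<open>density_of\<close> picks a genuine one.\<close>

lemma
  fixes K :: "'a::euclidean_space set"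
  assumes q: "q \<in> radon K" and K: "compact K" and ac: "abs_cont_lebesgue K q"
  shows density_of_integrable: "integrable (lebesgue_on K) (density_of K q)"
    and density_of_eq: "A \<in> sets borel \<Longrightarrow> A \<subseteq> K \<Longrightarrow> q A = (LINT x|lebesgue_on A. density_of K q x)"
proof -
  have Ks: "K \<in> sets lebesgue" using K by (simp add: borel_compact)
  have "\<exists>h. integrable (lebesgue_on K) h \<and>
    (\<forall>A. A \<in> sets borel \<and> A \<subseteq> K \<longrightarrow> q A \<bullet> b = (LINT x|lebesgue_on A. h x))" for b
  proof -
    have "q A \<bullet> b = 0" if "A \<in> sets borel" "A \<subseteq> K" "emeasure lborel A = 0" for A
      using ac that by (simp add: abs_cont_lebesgue_def)
    from signed_integral_density_exists[OF radon_signed_on[OF q] K this] show ?thesis by blast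
  qed
  then obtain h where h: "\<And>b. integrable (lebesgue_on K) (h b)"
    "\<And>b A. A \<in> sets borel \<Longrightarrow> A \<subseteq> K \<Longrightarrow> q A \<bullet> b = (LINT x|lebesgue_on A. h b x)"
    by metis
  define f where "f x = (\<Sum>b\<in>Basis. h b x *\<^sub>R b)" for x
  have "integrable (lebesgue_on K) f \<and>
    (\<forall>A. A \<in> sets borel \<and> A \<subseteq> K \<longrightarrow> q A = (LINT x|lebesgue_on A. f x))"
  proof (intro conjI allI impI)
    show "integrable (lebesgue_on K) f" unfolding f_def using h(1) by simp
    fix A assume A: "A \<in> sets borel \<and> A \<subseteq> K"
    have i: "integrable (lebesgue_on A) (h b)" for b
      using A Ks by (intro integrable_lebesgue_on_subset[OF h(1)]) auto
    have "(LINT x|lebesgue_on A. f x) = (\<Sum>b\<in>Basis. (LINT x|lebesgue_on A. h b x) *\<^sub>R b)"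
      unfolding f_def using i by (simp add: Bochner_Integration.integral_sum)
    also have "\<dots> = q A" using A h(2) by (simp add: h(2)[symmetric] euclidean_representation)
    finally show "q A = (LINT x|lebesgue_on A. f x)" ..
  qed
  then have "integrable (lebesgue_on K) (density_of K q) \<and>
    (\<forall>A. A \<in> sets borel \<and> A \<subseteq> K \<longrightarrow> q A = (LINT x|lebesgue_on A. density_of K q x))"
    unfolding density_of_def
    by (rule someI[where P="\<lambda>f. integrable (lebesgue_on K) f \<and>
      (\<forall>A. A \<in> sets borel \<and> A \<subseteq> K \<longrightarrow> q A = (LINT x|lebesgue_on A. f x))"])
  then show "integrable (lebesgue_on K) (density_of K q)"
    and "A \<in> sets borel \<Longrightarrow> A \<subseteq> K \<Longrightarrow> q A = (LINT x|lebesgue_on A. density_of K q x)" by auto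
qed

text \<open>Reduces weak-* convergence of vector measures to scalar statements, one coordinate at a
  time.\<close>

lemma vector_integral_component:
  assumes b: "b \<in> Basis"
  shows "vector_integral K q (\<lambda>x. \<phi> x *\<^sub>R b) = signed_integral K (\<lambda>A. q A \<bullet> b) \<phi>"
proof -
  have "vector_integral K q (\<lambda>x. \<phi> x *\<^sub>R b)
    = (\<Sum>b'\<in>Basis. if b' = b then signed_integral K (\<lambda>A. q A \<bullet> b) \<phi> else 0)"
    unfolding vector_integral_def
    by (rule sum.cong) (use b in \<open>auto simp: inner_Basis signed_integral_def\<close>)
  then show ?thesis using b by simp
qed

lemma signed_integral_density_of:
  fixes K :: "'a::euclidean_space set"
  assumes q: "q \<in> radon K" and K: "compact K" and ac: "abs_cont_lebesgue K q" and \<phi>: "continuous_on K \<phi>"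
  shows "signed_integral K (\<lambda>A. q A \<bullet> b) \<phi> = (LINT x|lebesgue_on K. \<phi> x * (density_of K q x \<bullet> b))"
proof (rule signed_integral_density[OF radon_signed_on[OF q] K _ _ \<phi>])
  show "integrable (lebesgue_on K) (\<lambda>x. density_of K q x \<bullet> b)"
    using density_of_integrable[OF q K ac] by simp
  fix A assume A: "A \<in> sets borel" "A \<subseteq> K"
  then have "integrable (lebesgue_on A) (density_of K q)"
    using K by (intro integrable_lebesgue_on_subset[OF density_of_integrable[OF q K ac]])
      (auto simp: borel_compact)
  then show "q A \<bullet> b = (LINT x|lebesgue_on A. density_of K q x \<bullet> b)"
    using density_of_eq[OF q K ac A] by simp
qed

text \<open>Completeness of \<open>lebesgue\<close>. It carries measurability on the whole interior
  from the classical gradient to the chosen weak one.\<close>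

lemma borel_measurable_lebesgue_on_AE:
  fixes f g :: "'a::euclidean_space \<Rightarrow> 'b::euclidean_space"
  assumes S: "S \<in> sets lebesgue" and f: "f \<in> borel_measurable (lebesgue_on S)"
    and ae: "AE x in lebesgue_on S. g x = f x"
  shows "g \<in> borel_measurable (lebesgue_on S)"
proof (rule borel_measurable_if_D, rule measurableI)
  let ?f = "\<lambda>x. if x \<in> S then f x else 0" and ?g = "\<lambda>x. if x \<in> S then g x else 0"
  fix B :: "'b set" assume B: "B \<in> sets borel"
  have "AE x in lebesgue. x \<in> ?f -` B \<longleftrightarrow> x \<in> ?g -` B"
    using ae S by (simp add: AE_restrict_space_iff) (auto elim!: eventually_mono)
  moreover have "?f -` B \<in> sets lebesgue"
    using measurable_sets[OF borel_measurable_if_I[OF f S] B] by simp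
  ultimately have "?g -` B \<in> sets lebesgue" by (rule completion.in_sets_AE) simp
  then show "?g -` B \<inter> space lebesgue \<in> sets lebesgue" by simp
qed simp

text \<open>Extending the gradient by 0 from the interior to \<open>K\<close> turns the divergence
  into a pairing over \<open>K\<close>, where weak convergence of the densities is known.\<close>

lemma divergence_eq:
  fixes K :: "'a::euclidean_space set"
  assumes K: "compact K" and f: "f \<in> borel_measurable (lebesgue_on K)" and g: "continuous_on K g"
    and ae: "AE x in lebesgue_on (interior K). weak_gradient (interior K) \<phi> x = g x"
  shows "divergence K f \<phi> = - (LINT x|lebesgue_on K. (indicator (interior K) x *\<^sub>R g x) \<bullet> f x)"
proof -
  let ?U = "interior K"
  have U: "?U \<in> sets lebesgue" "K \<in> sets lebesgue" "?U \<subseteq> K"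
    using K by (auto simp: borel_compact interior_subset)
  have gm: "g \<in> borel_measurable (lebesgue_on ?U)"
    using continuous_on_subset[OF g U(3)] U(1) by (rule continuous_imp_measurable_on_sets_lebesgue)
  have fm: "f \<in> borel_measurable (lebesgue_on ?U)"
    using measurable_restrict_mono[OF f U(3)] .
  have Wm: "weak_gradient ?U \<phi> \<in> borel_measurable (lebesgue_on ?U)"
    by (rule borel_measurable_lebesgue_on_AE[OF U(1) gm ae])
  have "(LINT x|lebesgue_on ?U. f x \<bullet> weak_gradient ?U \<phi> x) = (LINT x|lebesgue_on ?U. f x \<bullet> g x)"
  proof (rule integral_cong_AE)
    show "AE x in lebesgue_on ?U. f x \<bullet> weak_gradient ?U \<phi> x = f x \<bullet> g x"
      using ae by eventually_elim simp
  qed (use fm gm Wm in measurable)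
  also have "\<dots> = (LINT x|lebesgue_on K. indicator ?U x *\<^sub>R (f x \<bullet> g x))"
    by (rule integral_lebesgue_on_subset[OF U])
  also have "\<dots> = (LINT x|lebesgue_on K. (indicator ?U x *\<^sub>R g x) \<bullet> f x)"
    by (simp add: inner_commute)
  finally show ?thesis unfolding divergence_def by simp
qed

section \<open>Elementary inequalities for powers and for the integrand\<close>

lemma powr_tangent:
  fixes a b \<alpha> :: real
  assumes \<alpha>: "1 < \<alpha>" and "0 \<le> a" "0 \<le> b"
  shows "\<alpha> * (b * a powr (\<alpha> - 1)) \<le> b powr \<alpha> + (\<alpha> - 1) * a powr \<alpha>"
proof -
  note p = conj_exp_arith[OF \<alpha>]
  \<comment> \<open>Young's inequality for \<open>b\<close> and \<open>a powr (\<alpha> - 1)\<close>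
    amounts to convexity: the power at \<open>b\<close> lies above the tangent taken at
    \<open>a\<close>.\<close>
  have "b * a powr (\<alpha> - 1) \<le> b powr \<alpha> / \<alpha> + (a powr (\<alpha> - 1)) powr conj_exp \<alpha> / conj_exp \<alpha>"
    using assms p by (intro Youngs_inequality) auto
  also have "(a powr (\<alpha> - 1)) powr conj_exp \<alpha> = a powr \<alpha>" by (simp add: powr_powr p(3))
  also have "b powr \<alpha> / \<alpha> + a powr \<alpha> / conj_exp \<alpha> = (b powr \<alpha> + (\<alpha> - 1) * a powr \<alpha>) / \<alpha>"
    using \<alpha> by (simp add: conj_exp_def field_simps)
  finally show ?thesis using \<alpha> by (simp add: field_simps)
qed

lemma powr_pred_mult: "0 \<le> a \<Longrightarrow> a * a powr (\<alpha> - 1) = a powr \<alpha>" for a \<alpha> :: real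
  using powr_add[of a 1 "\<alpha> - 1"] by (cases "a = 0") auto

lemma powr_pred_le: "1 < \<alpha> \<Longrightarrow> 0 \<le> a \<Longrightarrow> a powr (\<alpha> - 1) \<le> 1 + a powr \<alpha>" for a \<alpha> :: real
proof (cases "a \<le> 1")
  case True
  assume "1 < \<alpha>" "0 \<le> a"
  then have "a powr (\<alpha> - 1) \<le> 1" using True by (intro powr_le1) auto
  then show ?thesis by (simp add: add_increasing2)
next
  case False
  assume "1 < \<alpha>" "0 \<le> a"
  then have "a powr (\<alpha> - 1) \<le> a powr \<alpha>" using False by (intro powr_mono) auto
  then show ?thesis by simp
qed

lemma le_one_plus_powr: "1 < \<alpha> \<Longrightarrow> 0 \<le> a \<Longrightarrow> a \<le> 1 + a powr \<alpha>" for a \<alpha> :: real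
proof (cases "a \<le> 1")
  case False
  assume "1 < \<alpha>" "0 \<le> a"
  then have "a powr 1 \<le> a powr \<alpha>" using False by (intro powr_mono) auto
  then show ?thesis using \<open>0 \<le> a\<close> by simp
qed (simp add: add_increasing2)

context
  fixes \<alpha> \<epsilon> :: real and w :: "'a::euclidean_space \<Rightarrow> real" and x :: 'a
  assumes \<alpha>: "1 < \<alpha>" and \<epsilon>: "0 < \<epsilon>" and w: "0 \<le> w x"
begin

text \<open>For \<open>norm v \<le> \<delta>\<close> the factor \<open>norm v / \<delta>\<close> is
  at most 1, so the quadratic term is below the linear one; otherwise the shift by
  \<open>\<delta>\<close> only lowers the power.\<close>

lemma G_star_le_G_star_0:
  assumes \<delta>: "0 < \<delta>"
  shows "G_star \<alpha> w \<epsilon> \<delta> x v \<le> G_star \<alpha> w \<epsilon> 0 x v"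
proof (cases "norm v \<le> \<delta>")
  case True
  have "(norm v)\<^sup>2 * (w x / (2 * \<delta>)) = norm v * (norm v / \<delta>) * w x / 2"
    using \<delta> by (simp add: power2_eq_square)
  also have "\<dots> \<le> norm v * 1 * w x / 2"
    using True \<delta> w by (intro divide_right_mono mult_right_mono mult_left_mono) auto
  also have "\<dots> \<le> norm v * w x" using w by simp
  finally have "(norm v)\<^sup>2 * (w x / (2 * \<delta>)) \<le> norm v * w x" .
  moreover have "0 \<le> \<delta> * w x" using \<delta> w by simp
  ultimately have "(norm v)\<^sup>2 * (w x / (2 * \<delta>)) - \<delta> * w x \<le> w x * norm v"
    unfolding mult.commute[of "w x" "norm v"] by linarith
  moreover have "0 \<le> \<epsilon> / \<alpha> * norm v powr \<alpha>" using \<alpha> \<epsilon> by simp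
  ultimately show ?thesis using True \<delta> by (simp add: G_star_def)
next
  case False
  have "\<epsilon> / \<alpha> * (norm v - \<delta>) powr \<alpha> \<le> \<epsilon> / \<alpha> * norm v powr \<alpha>"
    using False \<alpha> \<epsilon> \<delta> by (intro mult_left_mono powr_mono2) auto
  moreover have "0 \<le> 3 / 2 * \<delta> * w x" using \<delta> w by simp
  moreover have "G_star \<alpha> w \<epsilon> \<delta> x v = \<epsilon> / \<alpha> * (norm v - \<delta>) powr \<alpha> - 3 / 2 * \<delta> * w x + w x * norm v"
    "G_star \<alpha> w \<epsilon> 0 x v = w x * norm v + \<epsilon> / \<alpha> * norm v powr \<alpha>"
    using False \<delta> by (simp_all add: G_star_def)
  ultimately show ?thesis by linarith
qed

text \<open>The weight loses at most \<open>2 * \<delta> * w x\<close>, attained by the estimate in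
  the inner branch; the outer one loses \<open>3 / 2 * \<delta> * w x\<close>. The tangent
  inequality bounds the loss in the power by
  \<open>\<delta> * \<epsilon> * norm v powr (\<alpha> - 1)\<close>, and the power
  \<open>\<alpha>\<close> dominates that up to a constant.\<close>

lemma G_star_0_le:
  assumes \<delta>: "0 < \<delta>"
  shows "G_star \<alpha> w \<epsilon> 0 x v \<le> G_star \<alpha> w \<epsilon> \<delta> x v + \<delta> * (2 * w x + \<epsilon> * (1 + norm v powr \<alpha>))"
proof -
  have pl: "\<delta> * \<epsilon> * norm v powr (\<alpha> - 1) \<le> \<delta> * \<epsilon> * (1 + norm v powr \<alpha>)"
    using \<delta> \<epsilon> powr_pred_le[OF \<alpha>, of "norm v"] by (intro mult_left_mono) auto
  show ?thesis
  proof (cases "norm v \<le> \<delta>")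
    case True
    have "\<epsilon> / \<alpha> * norm v powr \<alpha> = \<epsilon> / \<alpha> * (norm v * norm v powr (\<alpha> - 1))"
      by (simp add: powr_pred_mult)
    also have "\<dots> \<le> \<epsilon> * (\<delta> * norm v powr (\<alpha> - 1))"
      using True \<alpha> \<epsilon> by (intro mult_mono mult_right_mono) (auto simp: divide_le_eq)
    finally have 1: "\<epsilon> / \<alpha> * norm v powr \<alpha> \<le> \<delta> * \<epsilon> * norm v powr (\<alpha> - 1)" by (simp add: mult_ac)
    have 2: "w x * norm v \<le> \<delta> * w x" using True w unfolding mult.commute[of \<delta>] by (intro mult_left_mono) auto
    have 3: "0 \<le> (norm v)\<^sup>2 * (w x / (2 * \<delta>))" using w \<delta> by simp
    have "G_star \<alpha> w \<epsilon> \<delta> x v = (norm v)\<^sup>2 * (w x / (2 * \<delta>)) - \<delta> * w x"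
      "G_star \<alpha> w \<epsilon> 0 x v = w x * norm v + \<epsilon> / \<alpha> * norm v powr \<alpha>"
      using True \<delta> by (simp_all add: G_star_def)
    then show ?thesis using 1 2 3 pl by (simp add: algebra_simps)
  next
    case False
    have "\<alpha> * ((norm v - \<delta>) * norm v powr (\<alpha> - 1)) \<le> (norm v - \<delta>) powr \<alpha> + (\<alpha> - 1) * norm v powr \<alpha>"
      using False by (intro powr_tangent \<alpha>) auto
    moreover have "(norm v - \<delta>) * norm v powr (\<alpha> - 1) = norm v powr \<alpha> - \<delta> * norm v powr (\<alpha> - 1)"
      by (simp add: left_diff_distrib powr_pred_mult)
    ultimately have "norm v powr \<alpha> \<le> (norm v - \<delta>) powr \<alpha> + \<alpha> * (\<delta> * norm v powr (\<alpha> - 1))"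
      by (simp add: algebra_simps)
    then have "\<epsilon> / \<alpha> * norm v powr \<alpha> \<le> \<epsilon> / \<alpha> * ((norm v - \<delta>) powr \<alpha> + \<alpha> * (\<delta> * norm v powr (\<alpha> - 1)))"
      using \<alpha> \<epsilon> by (intro mult_left_mono) auto
    also have "\<dots> = \<epsilon> / \<alpha> * (norm v - \<delta>) powr \<alpha> + \<delta> * \<epsilon> * norm v powr (\<alpha> - 1)"
      using \<alpha> by (simp add: distrib_left)
    finally have 1: "\<epsilon> / \<alpha> * norm v powr \<alpha> \<le> \<epsilon> / \<alpha> * (norm v - \<delta>) powr \<alpha> + \<delta> * \<epsilon> * norm v powr (\<alpha> - 1)" .
    have "G_star \<alpha> w \<epsilon> \<delta> x v = \<epsilon> / \<alpha> * (norm v - \<delta>) powr \<alpha> - 3 / 2 * \<delta> * w x + norm v * w x"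
      "G_star \<alpha> w \<epsilon> 0 x v = w x * norm v + \<epsilon> / \<alpha> * norm v powr \<alpha>"
      using False \<delta> by (simp_all add: G_star_def)
    moreover have "0 \<le> \<delta> * w x" using \<delta> w by simp
    ultimately show ?thesis using 1 pl by (simp add: algebra_simps)
  qed
qed

text \<open>The slope is the gradient of the integrand at \<open>u \<noteq> 0\<close>. Since
  \<open>sgn 0 = 0\<close>, it is 0 at the origin, where the integrand has its minimum and 0 is a
  subgradient.\<close>

lemma G_star_0_subgradient:
  "G_star \<alpha> w \<epsilon> 0 x u + ((w x + \<epsilon> * norm u powr (\<alpha> - 1)) *\<^sub>R sgn u) \<bullet> (v - u) \<le> G_star \<alpha> w \<epsilon> 0 x v"
proof -
  have su: "sgn u \<bullet> u = norm u"
    by (cases "u = 0") (auto simp: sgn_div_norm dot_square_norm power2_eq_square)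
  have sv: "sgn u \<bullet> v \<le> norm v"
    using norm_cauchy_schwarz[of "sgn u" v] by (cases "u = 0") (auto simp: norm_sgn)
  have "\<alpha> * (norm v * norm u powr (\<alpha> - 1)) \<le> norm v powr \<alpha> + (\<alpha> - 1) * norm u powr \<alpha>"
    by (intro powr_tangent \<alpha>) auto
  then have *: "\<epsilon> / \<alpha> * (\<alpha> * (norm v * norm u powr (\<alpha> - 1))) \<le> \<epsilon> / \<alpha> * (norm v powr \<alpha> + (\<alpha> - 1) * norm u powr \<alpha>)"
    using \<alpha> \<epsilon> by (intro mult_left_mono) auto
  have "\<epsilon> * norm u powr (\<alpha> - 1) * norm v \<le> \<epsilon> / \<alpha> * norm v powr \<alpha> + \<epsilon> * norm u powr \<alpha> - \<epsilon> / \<alpha> * norm u powr \<alpha>"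
  proof -
    have "\<epsilon> / \<alpha> * (\<alpha> * (norm v * norm u powr (\<alpha> - 1))) = \<epsilon> * norm u powr (\<alpha> - 1) * norm v"
      using \<alpha> by simp
    moreover have "\<epsilon> / \<alpha> * (norm v powr \<alpha> + (\<alpha> - 1) * norm u powr \<alpha>)
      = \<epsilon> / \<alpha> * norm v powr \<alpha> + \<epsilon> * norm u powr \<alpha> - \<epsilon> / \<alpha> * norm u powr \<alpha>"
      using \<alpha> by (simp add: field_simps)
    ultimately show ?thesis using * by simp
  qed
  moreover have "(w x + \<epsilon> * norm u powr (\<alpha> - 1)) * (sgn u \<bullet> v) \<le> (w x + \<epsilon> * norm u powr (\<alpha> - 1)) * norm v"
    using sv w \<epsilon> by (intro mult_left_mono) auto
  moreover have "((w x + \<epsilon> * norm u powr (\<alpha> - 1)) *\<^sub>R sgn u) \<bullet> (v - u)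
    = (w x + \<epsilon> * norm u powr (\<alpha> - 1)) * (sgn u \<bullet> v) - w x * norm u - \<epsilon> * norm u powr \<alpha>"
    using powr_pred_mult[of "norm u" \<alpha>] by (simp add: inner_diff_right su algebra_simps)
  ultimately show ?thesis by (simp add: G_star_def algebra_simps)
qed

end

section \<open>Vector fields in Lebesgue spaces, coordinate by coordinate\<close>

lemma sum_powr_le:
  fixes a :: "'i \<Rightarrow> real"
  assumes S: "finite S" and a: "\<And>i. i \<in> S \<Longrightarrow> 0 \<le> a i" and \<alpha>: "0 < \<alpha>"
  shows "(\<Sum>i\<in>S. a i) powr \<alpha> \<le> real (card S) powr \<alpha> * (\<Sum>i\<in>S. a i powr \<alpha>)"
proof (cases "S = {}")
  case False
  \<comment> \<open>Every summand is compared with the largest. The crude constant suffices because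
    \<open>LpI_components\<close> draws only integrability from it.\<close>
  have "Max (a ` S) \<in> a ` S" using S False by (intro Max_in) auto
  then obtain j where j: "j \<in> S" "Max (a ` S) = a j" by auto
  have "a i \<le> a j" if "i \<in> S" for i using Max_ge[of "a ` S" "a i"] S that j by auto
  then have "(\<Sum>i\<in>S. a i) \<le> real (card S) * a j" by (rule sum_bounded_above)
  then have "(\<Sum>i\<in>S. a i) powr \<alpha> \<le> (real (card S) * a j) powr \<alpha>"
    using \<alpha> a by (intro powr_mono2) (auto intro: sum_nonneg)
  also have "\<dots> = real (card S) powr \<alpha> * a j powr \<alpha>" using a j by (intro powr_mult) 
  also have "\<dots> \<le> real (card S) powr \<alpha> * (\<Sum>i\<in>S. a i powr \<alpha>)"
    using S j by (intro mult_left_mono member_le_sum) auto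
  finally show ?thesis .
qed simp

lemma norm_powr_le_components:
  fixes v :: "'a::euclidean_space"
  assumes "0 < \<alpha>"
  shows "norm v powr \<alpha> \<le> real DIM('a) powr \<alpha> * (\<Sum>b\<in>Basis. \<bar>v \<bullet> b\<bar> powr \<alpha>)"
proof -
  have "norm v powr \<alpha> \<le> (\<Sum>b\<in>Basis. \<bar>v \<bullet> b\<bar>) powr \<alpha>"
    using assms norm_le_l1[of v] by (intro powr_mono2) auto
  also have "\<dots> \<le> real DIM('a) powr \<alpha> * (\<Sum>b\<in>Basis. \<bar>v \<bullet> b\<bar> powr \<alpha>)"
    using assms by (intro sum_powr_le) auto
  finally show ?thesis .
qed

lemma Lp_component:
  fixes f :: "'a::euclidean_space \<Rightarrow> 'b::euclidean_space"
  assumes f: "f \<in> Lp \<alpha> S" and b: "b \<in> Basis" and \<alpha>: "0 < \<alpha>"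
  shows "(\<lambda>x. f x \<bullet> b) \<in> borel_measurable (lebesgue_on S)"
    and "integrable (lebesgue_on S) (\<lambda>x. \<bar>f x \<bullet> b\<bar> powr \<alpha>)"
    and "(LINT x|lebesgue_on S. \<bar>f x \<bullet> b\<bar> powr \<alpha>) \<le> (LINT x|lebesgue_on S. norm (f x) powr \<alpha>)"
proof -
  have fm[measurable]: "f \<in> borel_measurable (lebesgue_on S)"
    and fi: "integrable (lebesgue_on S) (\<lambda>x. norm (f x) powr \<alpha>)"
    using f by (auto simp: Lp_def)
  show "(\<lambda>x. f x \<bullet> b) \<in> borel_measurable (lebesgue_on S)" by measurable
  have le: "\<bar>f x \<bullet> b\<bar> powr \<alpha> \<le> norm (f x) powr \<alpha>" for x
    using \<alpha> Basis_le_norm[OF b] by (intro powr_mono2) auto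
  show i: "integrable (lebesgue_on S) (\<lambda>x. \<bar>f x \<bullet> b\<bar> powr \<alpha>)"
    by (rule Bochner_Integration.integrable_bound[OF fi]) (use le in auto)
  show "(LINT x|lebesgue_on S. \<bar>f x \<bullet> b\<bar> powr \<alpha>) \<le> (LINT x|lebesgue_on S. norm (f x) powr \<alpha>)"
    by (rule integral_mono[OF i fi le])
qed

lemma LpI_components:
  fixes f :: "'a::euclidean_space \<Rightarrow> 'b::euclidean_space"
  assumes fm: "f \<in> borel_measurable (lebesgue_on S)" and \<alpha>: "0 < \<alpha>"
    and i: "\<And>b. b \<in> Basis \<Longrightarrow> integrable (lebesgue_on S) (\<lambda>x. \<bar>f x \<bullet> b\<bar> powr \<alpha>)"
  shows "f \<in> Lp \<alpha> S"
  unfolding Lp_def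
proof (intro CollectI conjI fm)
  show "integrable (lebesgue_on S) (\<lambda>x. norm (f x) powr \<alpha>)"
  proof (rule Bochner_Integration.integrable_bound)
    show "integrable (lebesgue_on S) (\<lambda>x. real DIM('b) powr \<alpha> * (\<Sum>b\<in>Basis. \<bar>f x \<bullet> b\<bar> powr \<alpha>))"
      using i by (intro integrable_mult_right Bochner_Integration.integrable_sum)
    show "AE x in lebesgue_on S. norm (norm (f x) powr \<alpha>)
      \<le> norm (real DIM('b) powr \<alpha> * (\<Sum>b\<in>Basis. \<bar>f x \<bullet> b\<bar> powr \<alpha>))"
      by (intro AE_I2) (simp add: order_trans[OF norm_powr_le_components[OF \<alpha>]])
  qed (use fm in measurable)
qed

lemma Lp_integrals:
  fixes f :: "'a::euclidean_space \<Rightarrow> 'b::euclidean_space"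
  assumes \<alpha>: "1 < \<alpha>" and f: "f \<in> Lp \<alpha> S" and P: "P \<in> Lp (conj_exp \<alpha>) S"
  shows "integrable (lebesgue_on S) (\<lambda>x. P x \<bullet> f x)"
    and "(LINT x|lebesgue_on S. P x \<bullet> f x) = (\<Sum>b\<in>Basis. LINT x|lebesgue_on S. (P x \<bullet> b) * (f x \<bullet> b))"
proof -
  have i: "integrable (lebesgue_on S) (\<lambda>x. (P x \<bullet> b) * (f x \<bullet> b))" if "b \<in> Basis" for b
  proof -
    have \<alpha>0: "0 < \<alpha>" using \<alpha> by simp
    show ?thesis
      by (rule powr_mult_integrable(1)[OF \<alpha> Lp_component(1,2)[OF f that \<alpha>0]
            Lp_component(1,2)[OF P that conj_exp_arith(4)[OF \<alpha>]] zero_less_one])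
  qed
  have eq: "(\<lambda>x. P x \<bullet> f x) = (\<lambda>x. \<Sum>b\<in>Basis. (P x \<bullet> b) * (f x \<bullet> b))"
    by (intro ext euclidean_inner)
  show "integrable (lebesgue_on S) (\<lambda>x. P x \<bullet> f x)"
    unfolding eq using i by (intro Bochner_Integration.integrable_sum)
  show "(LINT x|lebesgue_on S. P x \<bullet> f x) = (\<Sum>b\<in>Basis. LINT x|lebesgue_on S. (P x \<bullet> b) * (f x \<bullet> b))"
    unfolding eq using i by (intro Bochner_Integration.integral_sum)
qed

text \<open>For \<open>\<delta> = 0\<close> the growth of the integrand is enough; for positive
  \<open>\<delta>\<close> the two comparisons with \<open>\<delta> = 0\<close> enclose it.\<close>

lemma G_star_integrable:
  fixes K :: "'a::euclidean_space set"
  assumes \<alpha>: "1 < \<alpha>" and \<epsilon>: "0 < \<epsilon>" and K: "compact K" and w: "continuous_on K w" "\<And>x. x \<in> K \<Longrightarrow> 0 \<le> w x"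
    and \<delta>: "0 \<le> \<delta>" and f: "f \<in> Lp \<alpha> K"
  shows "integrable (lebesgue_on K) (\<lambda>x. G_star \<alpha> w \<epsilon> \<delta> x (f x))"
proof -
  let ?M = "lebesgue_on K"
  have Ks: "K \<in> sets lebesgue" "bounded K" using K by (auto simp: borel_compact compact_imp_bounded)
  interpret finite_measure ?M by (rule finite_measure_lebesgue_on_bounded[OF Ks])
  have fm[measurable]: "f \<in> borel_measurable ?M" and fi: "integrable ?M (\<lambda>x. norm (f x) powr \<alpha>)"
    using f by (auto simp: Lp_def)
  have wm[measurable]: "w \<in> borel_measurable ?M"
    by (rule continuous_imp_measurable_on_sets_lebesgue[OF w(1) Ks(1)])
  obtain W where W: "\<And>x. x \<in> K \<Longrightarrow> \<bar>w x\<bar> \<le> W"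
    using compact_imp_bounded[OF compact_continuous_image[OF w(1) K]] by (auto simp: bounded_iff)
  have i0: "integrable ?M (\<lambda>x. G_star \<alpha> w \<epsilon> 0 x (f x))"
  proof (rule Bochner_Integration.integrable_bound)
    show "integrable ?M (\<lambda>x. W * (1 + norm (f x) powr \<alpha>) + \<epsilon> / \<alpha> * norm (f x) powr \<alpha>)"
      using fi by simp
    show "(\<lambda>x. G_star \<alpha> w \<epsilon> 0 x (f x)) \<in> borel_measurable ?M" unfolding G_star_def by measurable
    show "AE x in ?M. norm (G_star \<alpha> w \<epsilon> 0 x (f x)) \<le> norm (W * (1 + norm (f x) powr \<alpha>) + \<epsilon> / \<alpha> * norm (f x) powr \<alpha>)"
    proof (intro AE_I2)
      fix x assume "x \<in> space ?M"
      then have x: "x \<in> K" by simp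
      have "w x * norm (f x) \<le> W * (1 + norm (f x) powr \<alpha>)"
        using w(2)[OF x] W[OF x] le_one_plus_powr[OF \<alpha>, of "norm (f x)"] by (intro mult_mono) auto
      moreover have "0 \<le> w x * norm (f x)" "0 \<le> \<epsilon> / \<alpha> * norm (f x) powr \<alpha>" using w(2)[OF x] \<alpha> \<epsilon> by auto
      ultimately show "norm (G_star \<alpha> w \<epsilon> 0 x (f x)) \<le> norm (W * (1 + norm (f x) powr \<alpha>) + \<epsilon> / \<alpha> * norm (f x) powr \<alpha>)"
        by (simp add: G_star_def)
    qed
  qed
  show ?thesis
  proof (cases "\<delta> = 0")
    case False
    then have \<delta>: "0 < \<delta>" using \<delta> by simp
    show ?thesis
    proof (rule Bochner_Integration.integrable_bound)
      show "integrable ?M (\<lambda>x. \<bar>G_star \<alpha> w \<epsilon> 0 x (f x)\<bar> + \<delta> * (2 * W + \<epsilon> * (1 + norm (f x) powr \<alpha>)))"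
        using fi i0 by simp
      show "(\<lambda>x. G_star \<alpha> w \<epsilon> \<delta> x (f x)) \<in> borel_measurable ?M" unfolding G_star_def by measurable
      show "AE x in ?M. norm (G_star \<alpha> w \<epsilon> \<delta> x (f x))
        \<le> norm (\<bar>G_star \<alpha> w \<epsilon> 0 x (f x)\<bar> + \<delta> * (2 * W + \<epsilon> * (1 + norm (f x) powr \<alpha>)))"
      proof (intro AE_I2)
        fix x assume "x \<in> space ?M"
        then have x: "x \<in> K" by simp
        have "\<delta> * (2 * w x + \<epsilon> * (1 + norm (f x) powr \<alpha>)) \<le> \<delta> * (2 * W + \<epsilon> * (1 + norm (f x) powr \<alpha>))"
          using W[OF x] \<delta> by (intro mult_left_mono) auto
        moreover have "0 \<le> \<delta> * (2 * w x + \<epsilon> * (1 + norm (f x) powr \<alpha>))" using w(2)[OF x] \<delta> \<epsilon> by auto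
        ultimately show "norm (G_star \<alpha> w \<epsilon> \<delta> x (f x))
          \<le> norm (\<bar>G_star \<alpha> w \<epsilon> 0 x (f x)\<bar> + \<delta> * (2 * W + \<epsilon> * (1 + norm (f x) powr \<alpha>)))"
          using G_star_le_G_star_0[where v="f x" and w=w, OF \<alpha> \<epsilon> w(2)[OF x] \<delta>]
            G_star_0_le[where v="f x" and w=w, OF \<alpha> \<epsilon> w(2)[OF x] \<delta>]
          unfolding real_norm_def by linarith
      qed
    qed
  qed (use i0 in simp)
qed

section \<open>Limits of the functionals\<close>

text \<open>For each coordinate the test inequality with constant \<open>C / \<alpha>\<close> holds
  along the sequence uniformly, so it passes to the limit. From there it yields first absolute
  continuity and then the power bound for the density, which must exist before it can be
  estimated.\<close>

lemma abs_cont_and_Lp_of_limit: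
  fixes K :: "'a::euclidean_space set"
  assumes K: "compact K" and \<alpha>: "1 < \<alpha>" and q: "q \<in> radon K"
    and Q: "\<And>n. Q n \<in> radon K" "\<And>n. abs_cont_lebesgue K (Q n)" "\<And>n. density_of K (Q n) \<in> Lp \<alpha> K"
      "\<And>n. (LINT x|lebesgue_on K. norm (density_of K (Q n) x) powr \<alpha>) \<le> C"
    and conv: "weak_star_conv K Q q"
  shows "abs_cont_lebesgue K q" and "density_of K q \<in> Lp \<alpha> K"
    and "P \<in> Lp (conj_exp \<alpha>) K \<Longrightarrow>
      (\<lambda>n. LINT x|lebesgue_on K. P x \<bullet> density_of K (Q n) x) \<longlonglongrightarrow> (LINT x|lebesgue_on K. P x \<bullet> density_of K q x)"
proof -
  let ?M = "lebesgue_on K" and ?p = "conj_exp \<alpha>"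
  have Ks: "K \<in> sets lebesgue" "bounded K" using K by (auto simp: borel_compact compact_imp_bounded)
  interpret finite_measure ?M by (rule finite_measure_lebesgue_on_bounded[OF Ks])
  note p = conj_exp_arith[OF \<alpha>]
  have \<alpha>0: "0 < \<alpha>" using \<alpha> by simp
  define f where "f n = density_of K (Q n)" for n
  have Qf: "f n \<in> Lp \<alpha> K" "(LINT x|?M. norm (f n x) powr \<alpha>) \<le> C" for n
    using Q by (simp_all add: f_def)
  have contK: "continuous_on K \<phi>" if "continuous_on UNIV \<phi>" for \<phi> :: "'a \<Rightarrow> real"
    using that by (rule continuous_on_subset) simp
  have conv_b: "(\<lambda>n. LINT x|?M. \<phi> x * (f n x \<bullet> b)) \<longlonglongrightarrow> signed_integral K (\<lambda>A. q A \<bullet> b) \<phi>"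
    if b: "b \<in> Basis" and \<phi>: "continuous_on UNIV \<phi>" for b \<phi>
  proof -
    have "continuous_on K (\<lambda>x. \<phi> x *\<^sub>R b)" using contK[OF \<phi>] by (intro continuous_intros)
    then have "(\<lambda>n. vector_integral K (Q n) (\<lambda>x. \<phi> x *\<^sub>R b)) \<longlonglongrightarrow> vector_integral K q (\<lambda>x. \<phi> x *\<^sub>R b)"
      using conv by (simp add: weak_star_conv_def)
    then show ?thesis
      unfolding vector_integral_component[OF b] f_def
        signed_integral_density_of[OF Q(1) K Q(2) contK[OF \<phi>]] .
  qed
  have test: "signed_integral K (\<lambda>A. q A \<bullet> b) \<phi> \<le> C / \<alpha> + 1 / ?p * (LINT x|?M. \<bar>\<phi> x\<bar> powr ?p)"
    if b: "b \<in> Basis" and \<phi>: "continuous_on UNIV \<phi>" for b \<phi>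
  proof (rule LIMSEQ_le_const2[OF conv_b[OF that]], intro exI allI impI)
    fix n
    have \<phi>m: "\<phi> \<in> borel_measurable ?M" using \<phi> by simp
    obtain B where B: "\<And>x. x \<in> K \<Longrightarrow> \<bar>\<phi> x\<bar> \<le> B"
      using compact_imp_bounded[OF compact_continuous_image[OF contK[OF \<phi>] K]] by (auto simp: bounded_iff)
    have \<phi>i: "integrable ?M (\<lambda>x. \<bar>\<phi> x\<bar> powr ?p)"
      using B p(4) \<phi>m by (intro integrable_bounded_real[OF Ks, where B="B powr ?p"])
        (auto intro!: powr_mono2)
    note c = Lp_component[OF Qf(1)[of n] b \<alpha>0]
    have "(LINT x|?M. \<phi> x * (f n x \<bullet> b))
      \<le> (LINT x|?M. 1 / \<alpha> * \<bar>f n x \<bullet> b\<bar> powr \<alpha> + 1 / ?p * \<bar>\<phi> x\<bar> powr ?p)"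
    proof (rule integral_mono)
      show "integrable ?M (\<lambda>x. \<phi> x * (f n x \<bullet> b))"
        by (rule powr_mult_integrable(1)[OF \<alpha> c(1,2) \<phi>m \<phi>i zero_less_one])
      show "integrable ?M (\<lambda>x. 1 / \<alpha> * \<bar>f n x \<bullet> b\<bar> powr \<alpha> + 1 / ?p * \<bar>\<phi> x\<bar> powr ?p)"
        using c(2) \<phi>i by simp
      fix x
      have "\<phi> x * (f n x \<bullet> b) \<le> \<bar>f n x \<bullet> b\<bar> * \<bar>\<phi> x\<bar>"
        using abs_ge_self[of "\<phi> x * (f n x \<bullet> b)"] by (simp add: abs_mult mult.commute)
      also have "\<dots> \<le> \<bar>f n x \<bullet> b\<bar> powr \<alpha> / \<alpha> + \<bar>\<phi> x\<bar> powr ?p / ?p"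
        using \<alpha> p by (intro Youngs_inequality) auto
      finally show "\<phi> x * (f n x \<bullet> b) \<le> 1 / \<alpha> * \<bar>f n x \<bullet> b\<bar> powr \<alpha> + 1 / ?p * \<bar>\<phi> x\<bar> powr ?p" by simp
    qed
    also have "\<dots> = 1 / \<alpha> * (LINT x|?M. \<bar>f n x \<bullet> b\<bar> powr \<alpha>) + 1 / ?p * (LINT x|?M. \<bar>\<phi> x\<bar> powr ?p)"
      using c(2) \<phi>i by simp
    also have "\<dots> \<le> C / \<alpha> + 1 / ?p * (LINT x|?M. \<bar>\<phi> x\<bar> powr ?p)"
      using order_trans[OF c(3) Qf(2)] \<alpha> by (simp add: divide_right_mono)
    finally show "(LINT x|?M. \<phi> x * (f n x \<bullet> b)) \<le> C / \<alpha> + 1 / ?p * (LINT x|?M. \<bar>\<phi> x\<bar> powr ?p)" .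
  qed
  show ac: "abs_cont_lebesgue K q"
    unfolding abs_cont_lebesgue_def
  proof (intro allI impI, elim conjE)
    fix A assume A: "A \<in> sets borel" "A \<subseteq> K" "emeasure lborel A = 0"
    have "q A \<bullet> b = 0" if b: "b \<in> Basis" for b
      by (rule signed_abs_cont_if_test_inequality[OF radon_signed_on[OF q] K p(4) test[OF b] A])
    then show "q A = 0" using euclidean_all_zero_iff by blast
  qed
  define g where "g = density_of K q"
  have gi: "integrable ?M g" unfolding g_def by (rule density_of_integrable[OF q K ac])
  have sg: "signed_integral K (\<lambda>A. q A \<bullet> b) \<phi> = (LINT x|?M. \<phi> x * (g x \<bullet> b))"
    if "continuous_on UNIV \<phi>" for b \<phi>
    unfolding g_def by (rule signed_integral_density_of[OF q K ac contK[OF that]])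
  have gb: "integrable ?M (\<lambda>x. \<bar>g x \<bullet> b\<bar> powr \<alpha>)" if b: "b \<in> Basis" for b
  proof (rule powr_integrable_if_test_inequality[OF Ks _ \<alpha>])
    show "integrable ?M (\<lambda>x. g x \<bullet> b)" using gi by simp
    show "(LINT x|?M. \<phi> x * (g x \<bullet> b)) \<le> C / \<alpha> + 1 / ?p * (LINT x|?M. \<bar>\<phi> x\<bar> powr ?p)"
      if "continuous_on UNIV \<phi>" for \<phi>
      using test[OF b that] unfolding sg[OF that] .
  qed
  have gL: "g \<in> Lp \<alpha> K" by (rule LpI_components[OF borel_measurable_integrable[OF gi] \<alpha>0 gb])
  then show "density_of K q \<in> Lp \<alpha> K" by (simp add: g_def)
  assume P: "P \<in> Lp ?p K"
  have "(\<lambda>n. \<Sum>b\<in>Basis. LINT x|?M. (P x \<bullet> b) * (f n x \<bullet> b))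
      \<longlonglongrightarrow> (\<Sum>b\<in>Basis. LINT x|?M. (P x \<bullet> b) * (g x \<bullet> b))"
  proof (rule tendsto_sum)
    fix b :: 'a assume b: "b \<in> Basis"
    have fC: "(LINT x|?M. \<bar>f n x \<bullet> b\<bar> powr \<alpha>) \<le> C" for n
      by (rule order_trans[OF Lp_component(3)[OF Qf(1) b \<alpha>0] Qf(2)])
    show "(\<lambda>n. LINT x|?M. (P x \<bullet> b) * (f n x \<bullet> b)) \<longlonglongrightarrow> (LINT x|?M. (P x \<bullet> b) * (g x \<bullet> b))"
    proof (rule weak_convergence_powr[OF Ks \<alpha> Lp_component(1,2)[OF Qf(1) b \<alpha>0] fC
          Lp_component(1,2)[OF gL b \<alpha>0] _ Lp_component(1,2)[OF P b p(4)]])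
      show "(\<lambda>n. LINT x|?M. \<phi> x * (f n x \<bullet> b)) \<longlonglongrightarrow> (LINT x|?M. \<phi> x * (g x \<bullet> b))"
        if "continuous_on UNIV \<phi>" for \<phi>
        using conv_b[OF b that] unfolding sg[OF that] .
    qed
  qed
  then show "(\<lambda>n. LINT x|?M. P x \<bullet> density_of K (Q n) x) \<longlonglongrightarrow> (LINT x|?M. P x \<bullet> density_of K q x)"
    unfolding Lp_integrals(2)[OF \<alpha> Qf(1) P, symmetric] Lp_integrals(2)[OF \<alpha> gL P, symmetric]
    by (simp add: f_def g_def)
qed

lemma bounded_in_Lp:
  fixes g :: "'a::euclidean_space \<Rightarrow> 'b::euclidean_space"
  assumes "S \<in> sets lebesgue" "bounded S" "g \<in> borel_measurable (lebesgue_on S)"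
    "\<And>x. x \<in> S \<Longrightarrow> norm (g x) \<le> B" "0 < p"
  shows "g \<in> Lp p S"
proof -
  have "\<bar>norm (g x) powr p\<bar> \<le> B powr p" if "x \<in> S" for x
    using assms(4)[OF that] assms(5) by (auto intro: powr_mono2)
  moreover have "(\<lambda>x. norm (g x) powr p) \<in> borel_measurable (lebesgue_on S)"
    using assms(3) by measurable
  ultimately have "integrable (lebesgue_on S) (\<lambda>x. norm (g x) powr p)"
    by (intro integrable_bounded_real[OF assms(1,2)])
  then show ?thesis using assms(3) by (simp add: Lp_def)
qed

text \<open>The lower bound in terms of a real level \<open>c\<close>. A value at most
  \<open>c\<close> is finite, so every \<open>Q n\<close> satisfies the constraints built into
  \<open>H_fun\<close>; the bound on \<open>\<delta> n\<close> is what lets the error be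
  absorbed.\<close>

lemma H_fun_bounded_limit:
  fixes K :: "'a::euclidean_space set"
  assumes m: "approx_identity (m :: nat \<Rightarrow> 'a \<Rightarrow> real)" and K: "compact K"
    and w: "continuous_on K w" "\<And>x. x \<in> K \<Longrightarrow> 0 \<le> w x"
    and \<alpha>: "1 < \<alpha>" and \<epsilon>: "0 < \<epsilon>"
    and \<delta>: "\<And>n. 0 < \<delta> n" "\<And>n. \<delta> n \<le> 1 / (2 * \<alpha>)" "\<delta> \<longlonglongrightarrow> 0"
    and q: "q \<in> radon K" and Q: "\<And>n. Q n \<in> radon K" and conv: "weak_star_conv K Q q"
    and le: "\<And>n. H_fun \<alpha> w K \<nu> \<epsilon> (\<delta> n) (Q n) \<le> ereal c"
  shows "H_fun \<alpha> w K \<nu> \<epsilon> 0 q \<le> ereal c"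
proof -
  let ?M = "lebesgue_on K" and ?p = "conj_exp \<alpha>"
  have Ks: "K \<in> sets lebesgue" "bounded K" using K by (auto simp: borel_compact compact_imp_bounded)
  interpret finite_measure ?M by (rule finite_measure_lebesgue_on_bounded[OF Ks])
  note p = conj_exp_arith[OF \<alpha>]
  have \<alpha>0: "0 < \<alpha>" using \<alpha> by simp
  define f where "f n = density_of K (Q n)" for n
  have cond: "abs_cont_lebesgue K (Q n) \<and> f n \<in> Lp \<alpha> K \<and> (\<forall>\<phi>\<in>C1 K. divergence K (f n) \<phi> = \<nu> \<phi>)" for n
    using le[of n] unfolding H_fun_def f_def by (auto split: if_splits)
  then have Qac: "\<And>n. abs_cont_lebesgue K (Q n)" and fL: "\<And>n. f n \<in> Lp \<alpha> K"
    and dv: "\<And>n \<phi>. \<phi> \<in> C1 K \<Longrightarrow> divergence K (f n) \<phi> = \<nu> \<phi>" by auto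
  have E: "(LINT x|?M. G_star \<alpha> w \<epsilon> (\<delta> n) x (f n x)) \<le> c" for n
    using le[of n] cond[of n] unfolding H_fun_def f_def by simp
  have fi: "integrable ?M (\<lambda>x. norm (f n x) powr \<alpha>)" for n using fL[of n] by (simp add: Lp_def)
  obtain W where W: "\<And>x. x \<in> K \<Longrightarrow> \<bar>w x\<bar> \<le> W"
    using compact_imp_bounded[OF compact_continuous_image[OF w(1) K]] by (auto simp: bounded_iff)
  \<comment> \<open>The integral over \<open>K\<close> of the part of the error in
    \<open>low\<close> that does not depend on \<open>v\<close>.\<close>
  define V where "V = (2 * W + \<epsilon>) * measure lebesgue K"
  have Gi: "integrable ?M (\<lambda>x. G_star \<alpha> w \<epsilon> d x (u x))" if "0 \<le> d" "u \<in> Lp \<alpha> K" for d u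
    by (rule G_star_integrable[OF \<alpha> \<epsilon> K w that])
  have low: "G_star \<alpha> w \<epsilon> 0 x v \<le> G_star \<alpha> w \<epsilon> (\<delta> n) x v + \<delta> n * ((2 * W + \<epsilon>) + \<epsilon> * norm v powr \<alpha>)"
    if "x \<in> K" for x v n
  proof -
    have "\<delta> n * (2 * w x + \<epsilon> * (1 + norm v powr \<alpha>)) \<le> \<delta> n * ((2 * W + \<epsilon>) + \<epsilon> * norm v powr \<alpha>)"
      using W[OF that] \<delta>(1)[of n] by (intro mult_left_mono) (auto simp: distrib_left)
    with G_star_0_le[where w=w, OF \<alpha> \<epsilon> w(2)[OF that] \<delta>(1), of v n] show ?thesis by linarith
  qed
  have int_low: "(LINT x|?M. G_star \<alpha> w \<epsilon> 0 x (f n x))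
    \<le> c + \<delta> n * (V + \<epsilon> * (LINT x|?M. norm (f n x) powr \<alpha>))" for n
  proof -
    have "(LINT x|?M. G_star \<alpha> w \<epsilon> 0 x (f n x))
      \<le> (LINT x|?M. G_star \<alpha> w \<epsilon> (\<delta> n) x (f n x) + \<delta> n * ((2 * W + \<epsilon>) + \<epsilon> * norm (f n x) powr \<alpha>))"
      using fi Gi[OF _ fL] \<delta>(1)[of n] low by (intro integral_mono) (auto simp: less_imp_le)
    also have "\<dots> = (LINT x|?M. G_star \<alpha> w \<epsilon> (\<delta> n) x (f n x))
        + \<delta> n * ((2 * W + \<epsilon>) * measure ?M (space ?M) + \<epsilon> * (LINT x|?M. norm (f n x) powr \<alpha>))"
      using fi Gi[OF _ fL] \<delta>(1)[of n] by (simp add: less_imp_le mult.commute)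
    also have "measure ?M (space ?M) = measure lebesgue K"
      using Ks by (simp add: measure_restrict_space)
    finally show ?thesis using E[of n] by (simp add: V_def)
  qed
  \<comment> \<open>Solves \<open>\<epsilon> / \<alpha> * I \<le> c + |V| + \<epsilon> / (2 *
    \<alpha>) * I\<close> for the integral \<open>I\<close> of the power. The last summand bounds
    the error, as \<open>\<delta> n \<le> 1 / (2 * \<alpha>)\<close>; the absolute value spares a
    discussion of the sign of \<open>V\<close>.\<close>
  define C where "C = 2 * \<alpha> / \<epsilon> * (c + \<bar>V\<bar>)"
  have fC: "(LINT x|?M. norm (f n x) powr \<alpha>) \<le> C" for n
  proof -
    let ?I = "LINT x|?M. norm (f n x) powr \<alpha>"
    have "(LINT x|?M. \<epsilon> / \<alpha> * norm (f n x) powr \<alpha>) \<le> (LINT x|?M. G_star \<alpha> w \<epsilon> 0 x (f n x))"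
      by (rule integral_mono[OF integrable_mult_right[OF fi] Gi[OF order_refl fL]])
        (use w(2) in \<open>simp add: G_star_def\<close>)
    then have "\<epsilon> / \<alpha> * ?I \<le> c + \<delta> n * (V + \<epsilon> * ?I)" using int_low[of n] by simp
    also have "\<dots> \<le> c + (\<bar>V\<bar> + 1 / (2 * \<alpha>) * (\<epsilon> * ?I))"
    proof -
      have "1 / (2 * \<alpha>) \<le> 1" using \<alpha> by simp
      then have "\<delta> n \<le> 1" using \<delta>(2)[of n] by linarith
      then have "\<delta> n * \<bar>V\<bar> \<le> 1 * \<bar>V\<bar>" by (rule mult_right_mono) simp
      moreover have "\<delta> n * V \<le> \<delta> n * \<bar>V\<bar>" using \<delta>(1)[of n] by (intro mult_left_mono) auto
      moreover have "\<delta> n * (\<epsilon> * ?I) \<le> 1 / (2 * \<alpha>) * (\<epsilon> * ?I)"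
        using \<delta>(2) \<epsilon> by (intro mult_right_mono) auto
      ultimately show ?thesis by (simp add: distrib_left)
    qed
    finally have "\<epsilon> / (2 * \<alpha>) * ?I \<le> c + \<bar>V\<bar>" using \<alpha> by (simp add: field_simps)
    then have "2 * \<alpha> / \<epsilon> * (\<epsilon> / (2 * \<alpha>) * ?I) \<le> C"
      unfolding C_def using \<alpha> \<epsilon> by (intro mult_left_mono) auto
    then show ?thesis using \<alpha> \<epsilon> by simp
  qed
  note lim = abs_cont_and_Lp_of_limit[OF K \<alpha> q Q Qac fL[unfolded f_def] fC[unfolded f_def] conv]
  define g where "g = density_of K q"
  have gL: "g \<in> Lp \<alpha> K" using lim(2) by (simp add: g_def)
  have gm[measurable]: "g \<in> borel_measurable ?M" and gi: "integrable ?M (\<lambda>x. norm (g x) powr \<alpha>)"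
    using gL by (auto simp: Lp_def)
  have weak: "(\<lambda>n. LINT x|?M. P x \<bullet> f n x) \<longlonglongrightarrow> (LINT x|?M. P x \<bullet> g x)" if "P \<in> Lp ?p K" for P
    using lim(3)[OF that] by (simp add: f_def g_def)
  have dvg: "divergence K g \<phi> = \<nu> \<phi>" if \<phi>: "\<phi> \<in> C1 K" for \<phi>
  proof -
    obtain D where D: "continuous_on K D" "AE x in lebesgue_on (interior K). weak_gradient (interior K) \<phi> x = D x"
      using C1_weak_gradient[OF m K \<phi>] by blast
    let ?P = "\<lambda>x. indicat_real (interior K) x *\<^sub>R D x"
    obtain B where B: "\<And>x. x \<in> K \<Longrightarrow> norm (D x) \<le> B"
      using compact_imp_bounded[OF compact_continuous_image[OF D(1) K]] by (auto simp: bounded_iff)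
    have "?P \<in> Lp ?p K"
    proof (rule bounded_in_Lp[OF Ks _ _ p(4)])
      have "indicat_real (interior K) \<in> borel_measurable ?M"
        using Ks interior_subset[of K] by (intro borel_measurable_indicator) (auto simp: sets_restrict_space_iff)
      then show "?P \<in> borel_measurable ?M"
        using continuous_imp_measurable_on_sets_lebesgue[OF D(1) Ks(1)] by measurable
      show "norm (?P x) \<le> B" if "x \<in> K" for x
        using B[OF that] norm_ge_zero[of "D x"] by (auto simp: indicator_def simp del: norm_ge_zero)
    qed
    then have "(\<lambda>n. - (LINT x|?M. ?P x \<bullet> f n x)) \<longlonglongrightarrow> - (LINT x|?M. ?P x \<bullet> g x)"
      by (intro tendsto_minus weak)
    moreover have "- (LINT x|?M. ?P x \<bullet> f n x) = \<nu> \<phi>" for n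
      using divergence_eq[OF K _ D, of "f n"] fL[of n] dv[OF \<phi>, of n] by (simp add: Lp_def)
    moreover have "- (LINT x|?M. ?P x \<bullet> g x) = divergence K g \<phi>"
      using divergence_eq[OF K gm D] by simp
    ultimately show ?thesis by (simp add: LIMSEQ_const_iff)
  qed
  have wm[measurable]: "w \<in> borel_measurable ?M"
    by (rule continuous_imp_measurable_on_sets_lebesgue[OF w(1) Ks(1)])
  \<comment> \<open>The subgradient at the limit density. It lies in the dual space because
    \<open>(\<alpha> - 1) * ?p = \<alpha>\<close> and the weight is bounded on
    \<open>K\<close>.\<close>
  define P where "P x = (w x + \<epsilon> * norm (g x) powr (\<alpha> - 1)) *\<^sub>R sgn (g x)" for x
  have PL: "P \<in> Lp ?p K"
    unfolding Lp_def
  proof (intro CollectI conjI)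
    show Pm: "P \<in> borel_measurable ?M" unfolding P_def sgn_div_norm by measurable
    show "integrable ?M (\<lambda>x. norm (P x) powr ?p)"
    proof (rule Bochner_Integration.integrable_bound)
      show "integrable ?M (\<lambda>x. 2 powr ?p * (W powr ?p + \<epsilon> powr ?p * norm (g x) powr \<alpha>))"
        using gi by simp
      show "(\<lambda>x. norm (P x) powr ?p) \<in> borel_measurable ?M" using Pm by measurable
      show "AE x in ?M. norm (norm (P x) powr ?p) \<le> norm (2 powr ?p * (W powr ?p + \<epsilon> powr ?p * norm (g x) powr \<alpha>))"
      proof (intro AE_I2)
        fix x assume "x \<in> space ?M"
        then have x: "x \<in> K" by simp
        have W0: "0 \<le> W" using W[OF x] by linarith
        have "norm (P x) \<le> (W + \<epsilon> * norm (g x) powr (\<alpha> - 1)) * 1"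
          unfolding P_def norm_scaleR using W[OF x] w(2)[OF x] \<epsilon> by (intro mult_mono) (auto simp: norm_sgn)
        then have "norm (P x) powr ?p \<le> (W + \<epsilon> * norm (g x) powr (\<alpha> - 1)) powr ?p"
          using p(4) by (intro powr_mono2) auto
        also have "\<dots> \<le> 2 powr ?p * (W powr ?p + (\<epsilon> * norm (g x) powr (\<alpha> - 1)) powr ?p)"
          using W0 \<epsilon> p(4) by (intro powr_abs_le_add) auto
        also have "(\<epsilon> * norm (g x) powr (\<alpha> - 1)) powr ?p = \<epsilon> powr ?p * norm (g x) powr \<alpha>"
          using \<epsilon> by (simp add: powr_mult powr_powr p(3))
        finally show "norm (norm (P x) powr ?p) \<le> norm (2 powr ?p * (W powr ?p + \<epsilon> powr ?p * norm (g x) powr \<alpha>))"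
          by simp
      qed
    qed
  qed
  \<comment> \<open>The difference of the two pairings with \<open>P\<close> tends to 0 by weak
    convergence and the error on the right vanishes with \<open>\<delta> n\<close>, so the limit
    energy is at most \<open>c\<close>.\<close>
  have sub: "(LINT x|?M. G_star \<alpha> w \<epsilon> 0 x (g x)) + ((LINT x|?M. P x \<bullet> f n x) - (LINT x|?M. P x \<bullet> g x))
      \<le> c + \<delta> n * (\<bar>V\<bar> + \<epsilon> * C)" for n
  proof -
    note i = Lp_integrals(1)[OF \<alpha> fL PL, of n] Lp_integrals(1)[OF \<alpha> gL PL] Gi[OF order_refl gL] Gi[OF order_refl fL, of n]
    have "(LINT x|?M. G_star \<alpha> w \<epsilon> 0 x (g x)) + ((LINT x|?M. P x \<bullet> f n x) - (LINT x|?M. P x \<bullet> g x))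
      = (LINT x|?M. G_star \<alpha> w \<epsilon> 0 x (g x) + (P x \<bullet> f n x - P x \<bullet> g x))"
      using i by simp
    also have "\<dots> \<le> (LINT x|?M. G_star \<alpha> w \<epsilon> 0 x (f n x))"
    proof (rule integral_mono)
      fix x assume "x \<in> space ?M"
      then have x: "x \<in> K" by simp
      show "G_star \<alpha> w \<epsilon> 0 x (g x) + (P x \<bullet> f n x - P x \<bullet> g x) \<le> G_star \<alpha> w \<epsilon> 0 x (f n x)"
        using G_star_0_subgradient[where w=w and u="g x" and v="f n x", OF \<alpha> \<epsilon> w(2)[OF x]]
        by (simp add: P_def inner_diff_right)
    qed (use i in auto)
    also have "\<dots> \<le> c + \<delta> n * (V + \<epsilon> * (LINT x|?M. norm (f n x) powr \<alpha>))" by (rule int_low)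
    also have "\<dots> \<le> c + \<delta> n * (\<bar>V\<bar> + \<epsilon> * C)"
      using fC[of n] \<delta>(1)[of n] \<epsilon> by (intro add_left_mono mult_left_mono add_mono) auto
    finally show ?thesis .
  qed
  have "(\<lambda>n. (LINT x|?M. G_star \<alpha> w \<epsilon> 0 x (g x)) + ((LINT x|?M. P x \<bullet> f n x) - (LINT x|?M. P x \<bullet> g x)))
    \<longlonglongrightarrow> (LINT x|?M. G_star \<alpha> w \<epsilon> 0 x (g x)) + ((LINT x|?M. P x \<bullet> g x) - (LINT x|?M. P x \<bullet> g x))"
    by (intro tendsto_intros weak PL)
  moreover have "(\<lambda>n. c + \<delta> n * (\<bar>V\<bar> + \<epsilon> * C)) \<longlonglongrightarrow> c + 0 * (\<bar>V\<bar> + \<epsilon> * C)"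
    by (intro tendsto_intros \<delta>(3))
  ultimately have "(LINT x|?M. G_star \<alpha> w \<epsilon> 0 x (g x)) \<le> c"
    using sub LIMSEQ_le[of _ "LINT x|?M. G_star \<alpha> w \<epsilon> 0 x (g x)" _ c] by simp
  then show ?thesis
    using lim(1) gL dvg unfolding H_fun_def g_def by simp
qed

text \<open>Any level above the lower limit exceeds the values along some subsequence, on which
  \<open>\<delta>\<close> can also be taken small enough; this subsequence still converges weak-* to
  the same limit.\<close>

lemma H_fun_liminf:
  fixes K :: "'a::euclidean_space set"
  assumes m: "approx_identity (m :: nat \<Rightarrow> 'a \<Rightarrow> real)" and K: "compact K"
    and w: "continuous_on K w" "\<And>x. x \<in> K \<Longrightarrow> 0 \<le> w x"
    and \<alpha>: "1 < \<alpha>" and \<epsilon>: "0 < \<epsilon>" and \<delta>: "\<And>n. 0 < \<delta> n" "\<delta> \<longlonglongrightarrow> 0"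
    and q: "q \<in> radon K" and Q: "\<And>n. Q n \<in> radon K" and conv: "weak_star_conv K Q q"
  shows "H_fun \<alpha> w K \<nu> \<epsilon> 0 q \<le> liminf (\<lambda>n. H_fun \<alpha> w K \<nu> \<epsilon> (\<delta> n) (Q n))" (is "_ \<le> liminf ?F")
proof (rule dense_ge)
  \<comment> \<open>Only a real \<open>z\<close> needs an argument: infinity bounds everything, and
    minus infinity is not above the lower limit.\<close>
  fix z assume z: "liminf ?F < z"
  show "H_fun \<alpha> w K \<nu> \<epsilon> 0 q \<le> z"
  proof (cases z)
    case (real c)
    have "\<exists>\<^sub>F n in sequentially. ?F n < z"
      using z Liminf_bounded[of z ?F sequentially] unfolding frequently_def not_less by auto
    moreover have "\<forall>\<^sub>F n in sequentially. \<delta> n < 1 / (2 * \<alpha>)"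
      using \<alpha> by (intro order_tendstoD(2)[OF \<delta>(2)]) simp
    ultimately have "\<exists>\<^sub>F n in sequentially. ?F n < z \<and> \<delta> n < 1 / (2 * \<alpha>)"
      by (rule frequently_eventually_frequently)
    then have "infinite {n. ?F n < z \<and> \<delta> n < 1 / (2 * \<alpha>)}"
      by (simp add: cofinite_eq_sequentially[symmetric] frequently_cofinite)
    then obtain r :: "nat \<Rightarrow> nat" where r: "strict_mono r"
      "\<And>n. ?F (r n) < z \<and> \<delta> (r n) < 1 / (2 * \<alpha>)"
      using infinite_enumerate by blast
    have "H_fun \<alpha> w K \<nu> \<epsilon> 0 q \<le> ereal c"
    proof (rule H_fun_bounded_limit[OF m K w \<alpha> \<epsilon>, where \<delta>="\<lambda>n. \<delta> (r n)" and Q="\<lambda>n. Q (r n)"])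
      show "(\<lambda>n. \<delta> (r n)) \<longlonglongrightarrow> 0" using LIMSEQ_subseq_LIMSEQ[OF \<delta>(2) r(1)] by (simp add: o_def)
      show "weak_star_conv K (\<lambda>n. Q (r n)) q"
        using conv LIMSEQ_subseq_LIMSEQ[OF _ r(1)] unfolding weak_star_conv_def o_def by blast
      show "H_fun \<alpha> w K \<nu> \<epsilon> (\<delta> (r n)) (Q (r n)) \<le> ereal c" for n using r(2)[of n] real by (auto intro: less_imp_le)
      show "\<delta> (r n) \<le> 1 / (2 * \<alpha>)" for n using r(2)[of n] by simp
    qed (use \<delta> q Q in auto)
    then show ?thesis using real by simp
  qed (use z in auto)
qed

text \<open>The constraints do not involve \<open>\<delta>\<close>, so both functionals are infinite
  on the same set functions and elsewhere the integrands are compared.\<close>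

lemma H_fun_le_H_fun_0:
  fixes K :: "'a::euclidean_space set"
  assumes K: "compact K" and w: "continuous_on K w" "\<And>x. x \<in> K \<Longrightarrow> 0 \<le> w x"
    and \<alpha>: "1 < \<alpha>" and \<epsilon>: "0 < \<epsilon>" and \<delta>: "0 < \<delta>"
  shows "H_fun \<alpha> w K \<nu> \<epsilon> \<delta> q \<le> H_fun \<alpha> w K \<nu> \<epsilon> 0 q"
proof -
  have "(LINT x|lebesgue_on K. G_star \<alpha> w \<epsilon> \<delta> x (f x)) \<le> (LINT x|lebesgue_on K. G_star \<alpha> w \<epsilon> 0 x (f x))"
    if "f \<in> Lp \<alpha> K" for f
    using \<delta> that G_star_le_G_star_0[where w=w, OF \<alpha> \<epsilon> _ \<delta>] w(2)
    by (intro integral_mono G_star_integrable[OF \<alpha> \<epsilon> K w]) auto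
  then show ?thesis by (auto simp: H_fun_def)
qed

theorem theorem4p8:
  fixes \<Omega> :: "'a::euclidean_space set"
    and w w_hat :: "'a \<Rightarrow> real"
    and \<alpha> \<epsilon> :: real
    and T :: "nat \<Rightarrow> real"
    and mol :: "real \<Rightarrow> 'a \<Rightarrow> real"
    and s :: "real \<Rightarrow> real"
    and \<nu> :: "('a \<Rightarrow> real) \<Rightarrow> real"
  assumes "compact \<Omega>"
    and "lipschitz_domain (interior \<Omega>)"
    and "strictly_star_shaped \<Omega>"
    and "continuous_on \<Omega> w" and "\<forall>x\<in>\<Omega>. 0 \<le> w x"
    and "1 < \<alpha>"
    and "DIM('a) = 1 \<or> \<alpha> < real DIM('a) / (real DIM('a) - 1)"
    and "poisson_regular \<alpha> \<Omega>"
    \<comment> \<open>the parameters and the mollifiers\<close>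
    and "\<forall>k. 0 < T k" and "T \<longlonglongrightarrow> 0"
    and "\<forall>k. mol (T k) \<in> Cc_infty UNIV \<and> (\<forall>x. 0 \<le> mol (T k) x) \<and> (LINT x|lborel. mol (T k) x) = 1"
    and "\<forall>r>0. \<forall>\<^sub>F k in sequentially. supp (mol (T k)) \<subseteq> ball 0 r"
    \<comment> \<open>the enlarged domains\<close>
    and "\<forall>k. 0 < s (T k)" and "(\<lambda>k. s (T k)) \<longlonglongrightarrow> 0"
    and "\<forall>k. {x + y | x y. x \<in> \<Omega> \<and> y \<in> supp (mol (T k))} \<subseteq> dilate \<Omega> (s (T k))"
    and "\<forall>j k. T j > T k \<longrightarrow> dilate \<Omega> (s (T k)) \<subseteq> dilate \<Omega> (s (T j))"
    \<comment> \<open>the extension of the weight\<close>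
    and "continuous_on (\<Union>k. dilate \<Omega> (s (T k))) w_hat"
    and "\<forall>x\<in>\<Omega>. w_hat x = w x"
    and "\<exists>m. has_minimum w \<Omega> m \<and> has_minimum w_hat (\<Union>k. dilate \<Omega> (s (T k))) m"
    and "\<epsilon> \<in> range T"
    and "\<nu> \<in> C1_dual (dilate \<Omega> (s \<epsilon>))" and "\<nu> (\<lambda>_. 1) = 0"
  shows "\<forall>\<delta> :: nat \<Rightarrow> real. (\<forall>n. 0 < \<delta> n) \<and> \<delta> \<longlonglongrightarrow> 0 \<longrightarrow>
    Gamma_limit (radon (dilate \<Omega> (s \<epsilon>))) (weak_star_conv (dilate \<Omega> (s \<epsilon>)))
      (\<lambda>n. H_fun \<alpha> w_hat (dilate \<Omega> (s \<epsilon>)) \<nu> \<epsilon> (\<delta> n))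
      (H_fun \<alpha> w_hat (dilate \<Omega> (s \<epsilon>)) \<nu> \<epsilon> 0)"
proof (intro allI impI, elim conjE)
  fix \<delta> :: "nat \<Rightarrow> real" assume \<delta>: "\<forall>n. 0 < \<delta> n" "\<delta> \<longlonglongrightarrow> 0"
  define K where "K = dilate \<Omega> (s \<epsilon>)"
  have K: "compact K" unfolding K_def by (rule compact_scaling[OF assms(1)])
  obtain k where k: "\<epsilon> = T k" using assms(20) by blast
  then have \<epsilon>: "0 < \<epsilon>" using assms(9) by simp
  have sub: "K \<subseteq> (\<Union>k. dilate \<Omega> (s (T k)))" unfolding K_def k by blast
  have wc: "continuous_on K w_hat" by (rule continuous_on_subset[OF assms(17) sub])
  \<comment> \<open>Nonnegativity of the extended weight on the enlarged domain comes from the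
    common minimum, which is attained by \<open>w\<close> on \<open>\<Omega>\<close>.\<close>
  obtain \<mu> where "has_minimum w \<Omega> \<mu>" and \<mu>: "has_minimum w_hat (\<Union>k. dilate \<Omega> (s (T k))) \<mu>"
    using assms(19) by (elim exE conjE)
  then have "0 \<le> \<mu>" using assms(5) by (auto simp only: has_minimum_def image_iff)
  moreover have "\<mu> \<le> w_hat x" if "x \<in> K" for x
    using \<mu> subsetD[OF sub that] by (simp only: has_minimum_def)
  ultimately have w0: "0 \<le> w_hat x" if "x \<in> K" for x using that by (metis order_trans)
  have m: "approx_identity (\<lambda>k. mol (T k))" using assms(11,12) by (simp add: approx_identity_def)
  show "Gamma_limit (radon (dilate \<Omega> (s \<epsilon>))) (weak_star_conv (dilate \<Omega> (s \<epsilon>)))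
      (\<lambda>n. H_fun \<alpha> w_hat (dilate \<Omega> (s \<epsilon>)) \<nu> \<epsilon> (\<delta> n))
      (H_fun \<alpha> w_hat (dilate \<Omega> (s \<epsilon>)) \<nu> \<epsilon> 0)"
    unfolding K_def[symmetric] Gamma_limit_def
  proof (intro conjI ballI allI impI, elim conjE)
    fix q \<xi> assume "q \<in> radon K" "\<forall>n. \<xi> n \<in> radon K" "weak_star_conv K \<xi> q"
    then show "H_fun \<alpha> w_hat K \<nu> \<epsilon> 0 q \<le> liminf (\<lambda>n. H_fun \<alpha> w_hat K \<nu> \<epsilon> (\<delta> n) (\<xi> n))"
      using \<delta> by (intro H_fun_liminf[OF m K wc w0 assms(6) \<epsilon>]) auto
  next
    fix q assume q: "q \<in> radon K"
    have "limsup (\<lambda>n. H_fun \<alpha> w_hat K \<nu> \<epsilon> (\<delta> n) q) \<le> H_fun \<alpha> w_hat K \<nu> \<epsilon> 0 q"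
      using \<delta>(1) by (intro Limsup_bounded always_eventually allI H_fun_le_H_fun_0[OF K wc w0 assms(6) \<epsilon>]) auto
    then show "\<exists>\<xi>. (\<forall>n. \<xi> n \<in> radon K) \<and> weak_star_conv K \<xi> q \<and>
        limsup (\<lambda>n. H_fun \<alpha> w_hat K \<nu> \<epsilon> (\<delta> n) (\<xi> n)) \<le> H_fun \<alpha> w_hat K \<nu> \<epsilon> 0 q"
      using q by (intro exI[of _ "\<lambda>_. q"]) (simp add: weak_star_conv_def)
  qed
qed

end
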